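(* Let $P$ be a finite connected graded poset of height $h$, and let $G_P$ be its auxiliary graph with independence number $\alpha(G_P)$. Then \[ \mathrm{La}(n,P)\le \left(\frac{|P|+h-\alpha(G_P)-2}{2}\right)\binom{n}{\lfloor n/2\rfloor}. \]
   Context: All posets are finite and connected (connected means that the Hasse diagram is connected). A poset $Q$ contains a poset $P$ as a (weak) subposet if there is an injection $f:P\to Q$ such that $a\le_P b$ implies $f(a)\le_Q f(b)$; otherwise $Q$ is $P$-free. $B_n=(2^{[n]},\subseteq)$ is the Boolean lattice, $[n]=\{1,\dots,n\}$, and $\mathrm{La}(n,P)$ is the largest size of a family $F\subseteq 2^{[n]}$ which, ordered by inclusion, is $P$-free. The height $h=h(P)$ is the largest size of a chain in $P$. $P$ is graded if every maximal chain has exactly $h$ elements. Its levels $L_1,\dots,L_h$ are defined by: $L_1$ is the set of minimal elements of $P$, and $L_i$ is the set of minimal elements of $P\setminus\bigcup_{j<i}L_j$ for $i\ge2$. Auxiliary graph $G_P$ of a graded poset $P$: the vertices are the sets $\{x,y,z\}\subseteq P$ of three mutually incomparable elements of one of two types: $V$-type, if for some $i$ one has $x\in L_i$ and $y,z\in L_{i+1}$; $\Lambda$-type, if for some $i$ one has $x,y\in L_i$ and $z\in L_{i+1}$. Two distinct vertices $v,v'$ are adjacent if and only if either $v,v'\subset L_i\cup L_{i+1}$ for some $i$, or (up to exchanging the names $v$ and $v'$) $v\subset L_{i-1}\cup L_i$ and $v'\subset L_i\cup L_{i+1}$ for some $i$ and one of the following holds: (1) $|L_i|\ge5$ and $v\cap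 v'\ne\varnothing$; (2) $|L_i|\in\{3,4\}$ and $v\cap v'\neq\varnothing$, except in the case where $v$ is $V$-type, $v'$ is $\Lambda$-type and $|v\cap v'|=1$; (3) $|L_i|\in\{3,4\}$, $v\cap v'=\varnothing$ and $|v\cap L_i|+|v'\cap L_i|=|L_i|$; (4) $|L_i|=2$. $\alpha(G_P)$ is the maximum size of an independent set of $G_P$ ($0$ if $G_P$ has no vertices).
   Formalization: The case n = 1 is excluded: for the three-element poset V (or its dual) one has |P| = 3, h = 2, α(G_P) = 0, so the bound would be 3/2, while La(1,P) = 2; the inequality is proved for n = 0 and all n ≥ 2. *)

theory Defs
  imports Complex_Main
begin

text \<open>
  A poset is a set \<open>P\<close> of elements of an ordered type, with the induced order.
\<close>

definition contains_poset :: "'b::order set \<Rightarrow> 'a::order set \<Rightarrow> bool" where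
  "contains_poset Q P \<longleftrightarrow> (\<exists>f. inj_on f P \<and> f ` P \<subseteq> Q \<and> mono_on P f)"

text \<open>
  For \<open>P = {}\<close> the maximum below ranges over the empty set, so \<open>La\<close> is only
  meaningful for nonempty \<open>P\<close>.
\<close>

definition La :: "nat \<Rightarrow> 'a::order set \<Rightarrow> nat" where
  "La n P = Max {card F | F :: nat set set. F \<subseteq> Pow {1..n} \<and> \<not> contains_poset F P}"

definition covers :: "'a::order set \<Rightarrow> 'a \<Rightarrow> 'a \<Rightarrow> bool" where
  "covers P x y \<longleftrightarrow> x \<in> P \<and> y \<in> P \<and> x < y \<and> (\<nexists>z. z \<in> P \<and> x < z \<and> z < y)"

text \<open>As usual for graphs, connectedness includes nonemptiness.\<close>

definition connected_poset :: "'a::order set \<Rightarrow> bool" where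
  "connected_poset P \<longleftrightarrow>
     P \<noteq> {} \<and> (\<forall>x\<in>P. \<forall>y\<in>P. (\<lambda>u v. covers P u v \<or> covers P v u)\<^sup>*\<^sup>* x y)"

definition height :: "'a::order set \<Rightarrow> nat" where
  "height P = Max {card C | C. pred_on.chain P (<) C}"

definition graded :: "'a::order set \<Rightarrow> bool" where
  "graded P \<longleftrightarrow> (\<forall>C. pred_on.maxchain P (<) C \<longrightarrow> card C = height P)"

definition minimal_elements :: "'a::order set \<Rightarrow> 'a set" where
  "minimal_elements A = {x \<in> A. \<nexists>y. y \<in> A \<and> y < x}"

text \<open>Levels are numbered from 1; the empty \<open>level P 0\<close> is only a filler.\<close>

fun level :: "'a::order set \<Rightarrow> nat \<Rightarrow> 'a set" where
  "level P 0 = {}"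
| "level P (Suc i) = minimal_elements (P - (\<Union>j\<in>{..i}. level P j))"

definition incomparable :: "'a::order \<Rightarrow> 'a \<Rightarrow> bool" where
  "incomparable x y \<longleftrightarrow> \<not> x \<le> y \<and> \<not> y \<le> x"

text \<open>Mutually incomparable elements are in particular distinct.\<close>

definition V_type :: "'a::order set \<Rightarrow> 'a set \<Rightarrow> bool" where
  "V_type P v \<longleftrightarrow>
     (\<exists>x y z. v = {x, y, z} \<and> incomparable x y \<and> incomparable x z \<and> incomparable y z \<and>
        (\<exists>i\<ge>1. x \<in> level P i \<and> y \<in> level P (i + 1) \<and> z \<in> level P (i + 1)))"

definition Lambda_type :: "'a::order set \<Rightarrow> 'a set \<Rightarrow> bool" where
  "Lambda_type P v \<longleftrightarrow>
     (\<exists>x y z. v = {x, y, z} \<and> incomparable x y \<and> incomparable x z \<and> incomparable y z \<and>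
        (\<exists>i\<ge>1. x \<in> level P i \<and> y \<in> level P i \<and> z \<in> level P (i + 1)))"

definition G_verts :: "'a::order set \<Rightarrow> 'a set set" where
  "G_verts P = {v. V_type P v \<or> Lambda_type P v}"

text \<open>
  Adjacency of \<open>v\<close> and \<open>w\<close> when \<open>v\<close> lies in the two levels just below those of \<open>w\<close>;
  \<open>level P i\<close> is the shared level.
\<close>

definition G_adj_consecutive :: "'a::order set \<Rightarrow> 'a set \<Rightarrow> 'a set \<Rightarrow> bool" where
  "G_adj_consecutive P v w \<longleftrightarrow>
     (\<exists>i\<ge>2. v \<subseteq> level P (i - 1) \<union> level P i \<and> w \<subseteq> level P i \<union> level P (i + 1) \<and>
        (card (level P i) \<ge> 5 \<and> v \<inter> w \<noteq> {} \<or>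
         card (level P i) \<in> {3, 4} \<and> v \<inter> w \<noteq> {} \<and>
           \<not> (V_type P v \<and> Lambda_type P w \<and> card (v \<inter> w) = 1) \<or>
         card (level P i) \<in> {3, 4} \<and> v \<inter> w = {} \<and>
           card (v \<inter> level P i) + card (w \<inter> level P i) = card (level P i) \<or>
         card (level P i) = 2))"

definition G_adj :: "'a::order set \<Rightarrow> 'a set \<Rightarrow> 'a set \<Rightarrow> bool" where
  "G_adj P v w \<longleftrightarrow>
     v \<in> G_verts P \<and> w \<in> G_verts P \<and> v \<noteq> w \<and>
     ((\<exists>i\<ge>1. v \<subseteq> level P i \<union> level P (i + 1) \<and> w \<subseteq> level P i \<union> level P (i + 1)) \<or>
      G_adj_consecutive P v w \<or> G_adj_consecutive P w v)"

definition G_independent :: "'a::order set \<Rightarrow> 'a set set \<Rightarrow> bool" where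
  "G_independent P S \<longleftrightarrow> S \<subseteq> G_verts P \<and> (\<forall>v\<in>S. \<forall>w\<in>S. \<not> G_adj P v w)"

definition alpha_G :: "'a::order set \<Rightarrow> nat" where
  "alpha_G P = Max {card S | S. G_independent P S}"

end

theory Submission imports Defs "HOL-Combinatorics.Multiset_Permutations" begin

text \<open>
  \<^bold>\<open>Counting along double chains.\<close> For a permutation of \<open>{1..n}\<close> let \<open>A\<^sub>m\<close> be the set of its first \<open>m\<close> entries
  and let \<open>B\<^sub>m\<close>, the partner of \<open>A\<^sub>m\<close>, arise from \<open>A\<^sub>m\<close> by exchanging its last entry for the next one. A
  set of size \<open>m\<close> with \<open>0 < m < n\<close> is \<open>A\<^sub>m\<close> for \<open>m! (n - m)!\<close> permutations and \<open>B\<^sub>m\<close> for as many. Hence, if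
  \<open>n \<ge> 2\<close> and a family has at most \<open>c\<close> members on an average double chain, its size is at most \<open>c / 2\<close> times the
  central binomial coefficient (\<open>card_bound_from_average\<close>). The value to be reached is
  \<open>c = |P| + h - \<alpha> - 2\<close>, which is \<open>|P| - 1\<close> plus the number of those of the \<open>h - 1\<close> boundaries between
  consecutive levels that carry no triple of a fixed maximum independent set of \<open>G\<^sub>P\<close>; such a set has
  at most one triple at each boundary.

  \<^bold>\<open>Greedy embedding.\<close> On a double chain two sets of different sizes are comparable unless they are \<open>B\<^sub>m\<close> and
  \<open>B\<^sub>m\<^sub>+\<^sub>1\<close>. Walk up the chain and put the elements of \<open>P\<close>, level by level, onto the members of \<open>F\<close> that
  are met. Every member finds a use, except that one partner set may be lost when a boundary is
  crossed. This gives \<open>|P| - 1\<close> plus the number of all boundaries for a \<open>P\<close>-free family. At a boundary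
  with a triple nothing is lost: if a level is entered from a set that is incomparable to the last
  one of the level below, the two incomparable elements of the triple can be put onto these two sets
  (\<open>state_step\<close>). The elements of a level are therefore numbered so that a triple at its upper
  boundary sits at the last positions (\<open>Hi\<close>) and a triple at its lower boundary at the first ones (\<open>Lo\<close>).
  The rules of adjacency in \<open>G\<^sub>P\<close> are what makes these two demands compatible (\<open>both\<close>).

  \<^bold>\<open>The shared level.\<close> There is one exception. A level of size four between a \<open>V\<close>-triple below and a
  \<open>\<Lambda>\<close>-triple above that share an element (\<open>shared\<close>) admits double chains that meet one member of \<open>F\<close> too many
  although no copy of \<open>P\<close> can be found on them, for instance for levels of sizes 2, 4, 2 if the
  members met are \<open>B\<^sub>1, A\<^sub>2, B\<^sub>2, B\<^sub>3, B\<^sub>4, A\<^sub>5, B\<^sub>5, B\<^sub>6\<close>. Here the average over permutations helps. Let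
  \<open>A\<close> be the set at which the trouble starts, and let \<open>H\<close> be the last set of the permutation above which
  the part of \<open>P\<close> beyond the shared level still embeds into \<open>F\<close>. All orders of \<open>H - A\<close> are equally
  likely. As the shared level must not fit between \<open>A\<close> and \<open>H\<close>, the family has few members
  there, and those demanded by one bad order are not met by most of the other orders: either some other
  arrangement of the sets saves the bad order, or the average over all orders of \<open>H - A\<close> obeys the bound
  (\<open>run\<close>, \<open>stuck\<close>, \<open>class_sum\<close>, \<open>window_total\<close>). If, on the other hand, the upper part of \<open>P\<close> no longer embeds above
  the current set, then the remaining members are bounded by the theorem for that upper part
  (\<open>tail_bound\<close>); this is why everything is stated for the part of \<open>P\<close> from a level \<open>s\<close> upwards and
  proved by induction downwards in \<open>s\<close>.
\<close>

section \<open>Double chains and permutations\<close>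

text \<open>
  Members of \<open>F\<close> on the double chain from \<open>U\<close> along \<open>ys\<close>, whose sets are \<open>aset\<close> and \<open>bset\<close>
  below. The bottom set \<open>U\<close> is not counted: in every use it has been dealt with already.
\<close>

fun chain_count :: "'b set set \<Rightarrow> 'b set \<Rightarrow> 'b list \<Rightarrow> int" where
  "chain_count F U [] = 0"
| "chain_count F U (y # ys) = of_bool (insert y U \<in> F)
     + (case ys of [] \<Rightarrow> 0 | q # _ \<Rightarrow> of_bool (insert q U \<in> F)) + chain_count F (insert y U) ys"

definition aset :: "'b set \<Rightarrow> 'b list \<Rightarrow> nat \<Rightarrow> 'b set" where
  "aset U ys m = U \<union> set (take m ys)"

text \<open>
  The first \<open>m\<close> entries with the last of them replaced by the next entry; meaningful for \<open>1 \<le> m\<close> and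
  \<open>m < length ys\<close>.
\<close>

definition bset :: "'b set \<Rightarrow> 'b list \<Rightarrow> nat \<Rightarrow> 'b set" where
  "bset U ys m = insert (ys ! m) (U \<union> set (take (m - 1) ys))"

lemma aset_Cons: "aset U (y # ys) (Suc m) = aset (insert y U) ys m"
  by (auto simp: aset_def)

lemma bset_Cons: "m \<ge> 1 \<Longrightarrow> bset U (y # ys) (Suc m) = bset (insert y U) ys m"
  by (cases m) (auto simp: bset_def)

text \<open>
  The entry \<open>t\<close> behind the cut is still needed for the partner of the last set before the cut.
\<close>

lemma chain_count_append:
  "chain_count F U (xs @ t # zs) =
     (\<Sum>m=1..length xs. of_bool (aset U (xs @ [t]) m \<in> F) + of_bool (bset U (xs @ [t]) m \<in> F))
     + chain_count F (U \<union> set xs) (t # zs)"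
proof (induction xs arbitrary: U)
  case Nil
  then show ?case by simp
next
  case (Cons x xs)
  let ?g = "\<lambda>U ys m. (of_bool (aset U ys m \<in> F) + of_bool (bset U ys m \<in> F) :: int)"
  have "(\<Sum>m=1..length (x # xs). ?g U ((x # xs) @ [t]) m)
      = ?g U ((x # xs) @ [t]) 1 + (\<Sum>m=Suc 1..Suc (length xs). ?g U ((x # xs) @ [t]) m)"
    using sum.atLeast_Suc_atMost[of 1 "length (x # xs)" "?g U ((x # xs) @ [t])"] by simp
  also have "(\<Sum>m=Suc 1..Suc (length xs). ?g U ((x # xs) @ [t]) m)
      = (\<Sum>m=1..length xs. ?g U ((x # xs) @ [t]) (Suc m))"
    by (rule sum.shift_bounds_cl_Suc_ivl)
  also have "\<dots> = (\<Sum>m=1..length xs. ?g (insert x U) (xs @ [t]) m)"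
    by (rule sum.cong) (simp_all add: aset_Cons bset_Cons)
  finally have eq: "(\<Sum>m=1..length (x # xs). ?g U ((x # xs) @ [t]) m)
      = ?g U ((x # xs) @ [t]) 1 + (\<Sum>m=1..length xs. ?g (insert x U) (xs @ [t]) m)" .
  have 1: "?g U ((x # xs) @ [t]) 1 = of_bool (insert x U \<in> F)
       + (case xs @ t # zs of [] \<Rightarrow> 0 | q # _ \<Rightarrow> of_bool (insert q U \<in> F))"
    by (cases xs) (simp_all add: aset_def bset_def)
  have "chain_count F U ((x # xs) @ t # zs) = ?g U ((x # xs) @ [t]) 1 + chain_count F (insert x U) (xs @ t # zs)"
    unfolding 1 by simp
  also have "chain_count F (insert x U) (xs @ t # zs) = (\<Sum>m=1..length xs. ?g (insert x U) (xs @ [t]) m)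
      + chain_count F (insert x U \<union> set xs) (t # zs)"
    by (rule Cons.IH)
  finally show ?case using eq by simp
qed

lemma sum_permutations_step:
  assumes "X \<noteq> {}"
  shows "(\<Sum>ys\<in>permutations_of_set X. g ys)
    = (\<Sum>q\<in>X. \<Sum>zs\<in>permutations_of_set (X - {q}). g (q # zs))"
proof (cases "finite X")
  case True
  have "(\<Sum>ys\<in>permutations_of_set X. g ys)
    = (\<Sum>q\<in>X. \<Sum>ys\<in>(#) q ` permutations_of_set (X - {q}). g ys)"
    unfolding permutations_of_set_nonempty[OF assms]
    by (rule sum.UNION_disjoint) (use True in auto)
  also have "\<dots> = (\<Sum>q\<in>X. \<Sum>zs\<in>permutations_of_set (X - {q}). g (q # zs))"
    by (rule sum.cong) (auto simp: sum.reindex)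
  finally show ?thesis .
qed (simp add: permutations_of_set_infinite)

lemma card_prefix:
  assumes Z: "finite Z" and S: "S \<subseteq> Z"
  shows "card {ms \<in> permutations_of_set Z. set (take (card S) ms) = S}
    = fact (card S) * fact (card Z - card S)"
proof -
  let ?P = "permutations_of_set S \<times> permutations_of_set (Z - S)"
  have fS: "finite S" using Z S by (rule rev_finite_subset)
  have "bij_betw (\<lambda>(xs, zs). xs @ zs) ?P {ms \<in> permutations_of_set Z. set (take (card S) ms) = S}"
  proof (rule bij_betwI')
    fix x y assume "x \<in> ?P" "y \<in> ?P"
    then show "((case x of (xs, zs) \<Rightarrow> xs @ zs) = (case y of (xs, zs) \<Rightarrow> xs @ zs)) = (x = y)"
      by (auto simp: length_finite_permutations_of_set)
  next
    fix x assume "x \<in> ?P"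
    then show "(case x of (xs, zs) \<Rightarrow> xs @ zs) \<in> {ms \<in> permutations_of_set Z. set (take (card S) ms) = S}"
      using S by (auto simp: permutations_of_set_def distinct_card)
  next
    fix ms assume "ms \<in> {ms \<in> permutations_of_set Z. set (take (card S) ms) = S}"
    then have ms: "set ms = Z" "distinct ms" "set (take (card S) ms) = S"
      by (auto simp: permutations_of_set_def)
    have "set (drop (card S) ms) = Z - S"
      using ms set_take_disj_set_drop_if_distinct[OF ms(2), of "card S" "card S"]
      by (metis (no_types, lifting) Diff_cancel Diff_triv Int_commute Un_Diff append_take_drop_id order_refl set_append sup_bot_left)
    then have "(take (card S) ms, drop (card S) ms) \<in> ?P"
      using ms by (auto simp: permutations_of_set_def)
    then show "\<exists>x\<in>?P. ms = (case x of (xs, zs) \<Rightarrow> xs @ zs)"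
      by (rule rev_bexI) simp
  qed
  then have "card {ms \<in> permutations_of_set Z. set (take (card S) ms) = S} = card ?P"
    by (simp add: bij_betw_same_card)
  then show ?thesis using Z S fS by (simp add: card_cartesian_product card_Diff_subset)
qed

text \<open>
  Exchanging the entries at the positions \<open>card S - 1\<close> and \<open>card S\<close> reduces this to prefixes.
\<close>

lemma card_prefix_swap:
  assumes Z: "finite Z" and S: "S \<subseteq> Z" and s: "1 \<le> card S" "card S < card Z"
  shows "card {ms \<in> permutations_of_set Z. insert (ms ! card S) (set (take (card S - 1) ms)) = S}
    = fact (card S) * fact (card Z - card S)"
proof -
  define s where "s = card S"
  define f where "f = (\<lambda>ms :: 'a list. ms[s - 1 := ms ! s, s := ms ! (s - 1)])"
  let ?A = "{ms \<in> permutations_of_set Z. set (take s ms) = S}"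
  let ?B = "{ms \<in> permutations_of_set Z. insert (ms ! s) (set (take (s - 1) ms)) = S}"
  have s1: "1 \<le> s" "s < card Z" using s by (auto simp: s_def)
  have perm: "f ms \<in> permutations_of_set Z" if "ms \<in> permutations_of_set Z" for ms
  proof -
    have l: "length ms = card Z" using that by (rule length_finite_permutations_of_set)
    have "mset (f ms) = mset ms"
      unfolding f_def using s1 l by (intro mset_swap) auto
    then show ?thesis using that
      by (metis mset_eq_setD mset_eq_imp_distinct_iff permutations_of_setD permutations_of_setI)
  qed
  have inv: "f (f ms) = ms" if "length ms = card Z" for ms
    unfolding f_def using s1 that by (auto simp: list_eq_iff_nth_eq nth_list_update)
  have tk: "set (take s xs) = insert (xs ! (s - 1)) (set (take (s - 1) xs))" if "length xs = card Z" for xs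
  proof -
    have "take (Suc (s - 1)) xs = take (s - 1) xs @ [xs ! (s - 1)]"
      by (rule take_Suc_conv_app_nth) (use s1 that in auto)
    then show ?thesis using s1 by simp
  qed
  have fn: "f xs ! (s - 1) = xs ! s" "f xs ! s = xs ! (s - 1)"
    "take (s - 1) (f xs) = take (s - 1) xs" if "length xs = card Z" for xs
    unfolding f_def using s1 that by (auto simp: nth_list_update)
  have len: "length ms = card Z" if "ms \<in> permutations_of_set Z" for ms
    using that by (rule length_finite_permutations_of_set)
  have lf: "length (f ms) = length ms" for ms by (simp add: f_def)
  have "bij_betw f ?A ?B"
    by (rule bij_betw_byWitness[where f' = f])
       (auto simp: inv len perm tk fn lf simp del: One_nat_def)
  then have "card ?A = card ?B" by (rule bij_betw_same_card)
  then show ?thesis using card_prefix[OF Z S] by (simp add: s_def)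
qed

text \<open>
  The common part of the counts for \<open>aset\<close> and \<open>bset\<close>: \<open>c\<close> picks from each permutation a set of size \<open>m\<close>, and all
  these sets are picked equally often.
\<close>

lemma card_sets_of_size:
  assumes Z: "finite Z" and UZ: "U \<inter> Z = {}"
    and cnt: "\<And>S. S \<subseteq> Z \<Longrightarrow> card S = m \<Longrightarrow> card {ms \<in> permutations_of_set Z. c ms = S} = k"
    and sub: "\<And>ms. ms \<in> permutations_of_set Z \<Longrightarrow> c ms \<subseteq> Z \<and> card (c ms) = m"
  shows "(\<Sum>ms\<in>permutations_of_set Z. of_bool (U \<union> c ms \<in> F))
    = int (card {G \<in> F. U \<subseteq> G \<and> G \<subseteq> U \<union> Z \<and> card (G - U) = m}) * int k"
proof -
  let ?I = "{G \<in> F. U \<subseteq> G \<and> G \<subseteq> U \<union> Z \<and> card (G - U) = m}"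
  let ?J = "{S. S \<subseteq> Z \<and> card S = m \<and> U \<union> S \<in> F}"
  have bij: "bij_betw (\<lambda>S. U \<union> S) ?J ?I"
  proof (rule bij_betw_byWitness[where f' = "\<lambda>G. G - U"])
    show "\<forall>S\<in>?J. U \<union> S - U = S" using UZ by blast
    show "\<forall>G\<in>?I. U \<union> (G - U) = G" by blast
    show "(\<lambda>S. U \<union> S) ` ?J \<subseteq> ?I"
    proof
      fix G assume "G \<in> (\<lambda>S. U \<union> S) ` ?J"
      then obtain S where S: "S \<subseteq> Z" "card S = m" "U \<union> S \<in> F" "G = U \<union> S" by auto
      have "G - U = S" using S UZ by blast
      then show "G \<in> ?I" using S by auto
    qed
    show "(\<lambda>G. G - U) ` ?I \<subseteq> ?J" 
    proof
      fix S assume "S \<in> (\<lambda>G. G - U) ` ?I"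
      then obtain G where G: "G \<in> F" "U \<subseteq> G" "G \<subseteq> U \<union> Z" "card (G - U) = m" "S = G - U" by auto
      then have "U \<union> S = G" by blast
      then show "S \<in> ?J" using G by auto
    qed
  qed
  have fJ: "finite ?J" using Z by (auto intro: finite_subset[of _ "Pow Z"])
  have "(\<Sum>ms\<in>permutations_of_set Z. of_bool (U \<union> c ms \<in> F))
      = (\<Sum>ms\<in>permutations_of_set Z. \<Sum>S\<in>?J. (of_bool (c ms = S) :: int))"
  proof (rule sum.cong)
    fix ms assume ms: "ms \<in> permutations_of_set Z"
    have "(\<Sum>S\<in>?J. (of_bool (c ms = S) :: int)) = of_bool (c ms \<in> ?J)"
      using fJ by (simp add: of_bool_def sum.delta)
    then show "of_bool (U \<union> c ms \<in> F) = (\<Sum>S\<in>?J. (of_bool (c ms = S) :: int))"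
      using sub[OF ms] by simp
  qed simp
  also have "\<dots> = (\<Sum>S\<in>?J. \<Sum>ms\<in>permutations_of_set Z. of_bool (c ms = S))"
    by (rule sum.swap)
  also have "\<dots> = (\<Sum>S\<in>?J. int (card {ms \<in> permutations_of_set Z. c ms = S}))"
    by (simp add: of_bool_def sum.If_cases Int_def)
  also have "\<dots> = (\<Sum>S\<in>?J. int k)"
    by (rule sum.cong) (auto simp: cnt)
  also have "\<dots> = int (card ?I) * int k"
    using bij_betw_same_card[OF bij] by simp
  finally show ?thesis .
qed

lemma sum_aset:
  assumes Z: "finite Z" and UZ: "U \<inter> Z = {}" and m: "m \<le> card Z"
  shows "(\<Sum>ms\<in>permutations_of_set Z. of_bool (aset U ms m \<in> F))
    = int (card {G \<in> F. U \<subseteq> G \<and> G \<subseteq> U \<union> Z \<and> card (G - U) = m}) * (fact m * fact (card Z - m))"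
proof -
  have "(\<Sum>ms\<in>permutations_of_set Z. of_bool (U \<union> set (take m ms) \<in> F))
    = int (card {G \<in> F. U \<subseteq> G \<and> G \<subseteq> U \<union> Z \<and> card (G - U) = m}) * int (fact m * fact (card Z - m))"
  proof (rule card_sets_of_size[OF Z UZ])
    show "card {ms \<in> permutations_of_set Z. set (take m ms) = S} = fact m * fact (card Z - m)"
      if "S \<subseteq> Z" "card S = m" for S
      using card_prefix[OF Z that(1)] that by simp
    show "set (take m ms) \<subseteq> Z \<and> card (set (take m ms)) = m" if "ms \<in> permutations_of_set Z" for ms
      using that m length_finite_permutations_of_set[OF that]
      using set_take_subset[of m ms] by (simp add: permutations_of_set_def distinct_card)
  qed
  then show ?thesis by (simp add: aset_def)
qed

lemma sum_bset:
  assumes Z: "finite Z" and UZ: "U \<inter> Z = {}" and m: "1 \<le> m" "m < card Z"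
  shows "(\<Sum>ms\<in>permutations_of_set Z. of_bool (bset U ms m \<in> F))
    = int (card {G \<in> F. U \<subseteq> G \<and> G \<subseteq> U \<union> Z \<and> card (G - U) = m}) * (fact m * fact (card Z - m))"
proof -
  have "(\<Sum>ms\<in>permutations_of_set Z. of_bool (U \<union> insert (ms ! m) (set (take (m - 1) ms)) \<in> F))
    = int (card {G \<in> F. U \<subseteq> G \<and> G \<subseteq> U \<union> Z \<and> card (G - U) = m}) * int (fact m * fact (card Z - m))"
  proof (rule card_sets_of_size[OF Z UZ])
    show "card {ms \<in> permutations_of_set Z. insert (ms ! m) (set (take (m - 1) ms)) = S} = fact m * fact (card Z - m)"
      if "S \<subseteq> Z" "card S = m" for S
      using card_prefix_swap[OF Z that(1)] that m by simp
    show "insert (ms ! m) (set (take (m - 1) ms)) \<subseteq> Z \<and> card (insert (ms ! m) (set (take (m - 1) ms))) = m"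
      if ms: "ms \<in> permutations_of_set Z" for ms
    proof -
      have l: "length ms = card Z" "distinct ms" "set ms = Z"
        using ms length_finite_permutations_of_set[OF ms] by (auto simp: permutations_of_set_def)
      have "ms ! m \<notin> set (take (m - 1) ms)"
      proof
        assume "ms ! m \<in> set (take (m - 1) ms)"
        then obtain i where i: "i < length (take (m - 1) ms)" "take (m - 1) ms ! i = ms ! m"
          unfolding in_set_conv_nth by blast
        then have "ms ! i = ms ! m" "i < m" by auto
        moreover have "m < length ms" "i < length ms" using l(1) m(2) \<open>i < m\<close> by linarith+
        ultimately show False using nth_eq_iff_index_eq[OF l(2)] by blast
      qed
      moreover have "card (set (take (m - 1) ms)) = m - 1"
        using l m by (simp add: distinct_card)
      moreover have "set (take (m - 1) ms) \<subseteq> Z" "ms ! m \<in> Z"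
        using l m set_take_subset[of "m - 1" ms] nth_mem[of m ms] by simp_all
      ultimately show ?thesis using m by (simp add: card_insert_if)
    qed
  qed
  then show ?thesis by (simp add: bset_def)
qed

section \<open>Leveled posets with triples at their boundaries\<close>

text \<open>
  The triple that a chosen independent set of triples has at the boundary of two consecutive levels:
  none, one of \<open>V\<close>-type or one of \<open>\<Lambda>\<close>-type.
\<close>

datatype boundary = Full | Vee | Wedge

text \<open>
  The elements are the pairs \<open>(r, j)\<close> with \<open>1 \<le> r \<le> h\<close> and \<open>1 \<le> j \<le> l r\<close>. Elements of different levels are related
  unless they belong to a common triple, as described by \<open>prec\<close>; this is at least as strong as the
  order of the given poset. The sizes demanded by \<open>T_two\<close>, \<open>T_Wedge\<close> and \<open>T_Vee\<close> follow from gradedness; \<open>T_both\<close>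
  is what the adjacency rules say about levels of at most three elements.
\<close>

locale levels =
  fixes h :: nat and l :: "nat \<Rightarrow> nat" and T :: "nat \<Rightarrow> boundary"
  assumes l_pos: "1 \<le> r \<Longrightarrow> r \<le> h \<Longrightarrow> 1 \<le> l r"
    and T_range: "T r \<noteq> Full \<Longrightarrow> 1 \<le> r \<and> r < h"
    and T_two: "T r \<noteq> Full \<Longrightarrow> 2 \<le> l r \<and> 2 \<le> l (Suc r)"
    and T_Wedge: "T r = Wedge \<Longrightarrow> 3 \<le> l r"
    and T_Vee: "T r = Vee \<Longrightarrow> 3 \<le> l (Suc r)"
    and T_both: "T r \<noteq> Full \<Longrightarrow> T (Suc r) \<noteq> Full \<Longrightarrow>
      3 \<le> l (Suc r) \<and> (l (Suc r) = 3 \<longrightarrow> T r \<noteq> T (Suc r))"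
begin

text \<open>
  The level for which a single double chain is not enough. Its two triples have one element in common,
  which gets position 3.
\<close>

definition shared :: "nat \<Rightarrow> bool" where
  "shared r \<longleftrightarrow> T (r - 1) = Vee \<and> T r = Wedge \<and> l r = 4"

text \<open>
  The elements of level \<open>r\<close> in the triple at its upper boundary, and \<open>Lo\<close> those in the triple at its lower
  boundary. Last and first positions overlap in a level of three elements, as the two triples do there. In
  a shared level the first two positions would be disjoint from the last two, so \<open>Lo\<close> takes position 3.
\<close>

definition Hi :: "nat \<Rightarrow> nat set" where
  "Hi r = (case T r of Full \<Rightarrow> {} | Vee \<Rightarrow> {l r} | Wedge \<Rightarrow> {l r - 1, l r})"

definition Lo :: "nat \<Rightarrow> nat set" where
  "Lo r = (case T (r - 1) of Full \<Rightarrow> {} | Wedge \<Rightarrow> {1} | Vee \<Rightarrow> if shared r then {1, 3} else {1, 2})"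

text \<open>
  The pairs of elements in a common triple.
\<close>

definition conf :: "nat \<times> nat \<Rightarrow> nat \<times> nat \<Rightarrow> bool" where
  "conf p q \<longleftrightarrow> fst q = Suc (fst p) \<and> snd p \<in> Hi (fst p) \<and> snd q \<in> Lo (fst q)"

definition prec :: "nat \<times> nat \<Rightarrow> nat \<times> nat \<Rightarrow> bool" where
  "prec p q \<longleftrightarrow> fst p < fst q \<and> \<not> conf p q"

text \<open>
  What has been placed when level \<open>r\<close> has received \<open>k\<close> elements; the levels below \<open>s\<close> are ignored.
\<close>

definition seg :: "nat \<Rightarrow> nat \<Rightarrow> nat \<Rightarrow> (nat \<times> nat) set" where
  "seg s r k = {(i, j). 1 \<le> j \<and> (s \<le> i \<and> i < r \<and> j \<le> l i \<or> i = r \<and> j \<le> k)}"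

definition elems :: "nat \<Rightarrow> (nat \<times> nat) set" where
  "elems s = {(i, j). s \<le> i \<and> i \<le> h \<and> 1 \<le> j \<and> j \<le> l i}"

definition place :: "'b set set \<Rightarrow> (nat \<times> nat) set \<Rightarrow> (nat \<times> nat \<Rightarrow> 'b set) \<Rightarrow> bool" where
  "place F I f \<longleftrightarrow> inj_on f I \<and> f ` I \<subseteq> F \<and> (\<forall>p\<in>I. \<forall>q\<in>I. prec p q \<longrightarrow> f p \<subset> f q)"

definition embeds :: "'b set set \<Rightarrow> (nat \<times> nat) set \<Rightarrow> bool" where
  "embeds F I \<longleftrightarrow> (\<exists>f. place F I f)"

text \<open>
  The situation when the chain goes from \<open>U\<close> to the next set \<open>V\<close>. The sets used so far lie strictly below
  \<open>V\<close>, hence below all later sets except for the partner \<open>B\<close> of \<open>V\<close>. For \<open>B\<close> one needs to be below \<open>U\<close>; this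
  may fail only for the elements of \<open>ex\<close>, which sit on the partner of \<open>U\<close>.
\<close>

definition progress :: "'b set set \<Rightarrow> (nat \<times> nat) set \<Rightarrow> (nat \<times> nat) set \<Rightarrow> 'b set \<Rightarrow> 'b set \<Rightarrow> bool" where
  "progress F I ex U V \<longleftrightarrow> (\<exists>f. place F I f \<and> (\<forall>p\<in>I. f p \<subset> V) \<and> (\<forall>p\<in>I - ex. f p \<subseteq> U))"

text \<open>
  The one set of \<open>F\<close> that may be lost at the upper boundary of level \<open>r\<close>.
\<close>

definition zi :: "nat \<Rightarrow> int" where
  "zi r = of_bool (r < h \<and> T r = Full)"

text \<open>
  How many sets of \<open>F\<close> can still come once level \<open>r\<close> and its upper boundary are done. The last
  element of the poset is never placed, whence the \<open>- 1\<close>.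
\<close>

definition mu :: "nat \<Rightarrow> int" where
  "mu r = (\<Sum>i\<in>{r<..h}. int (l i) + zi i) - 1"

text \<open>
  How many sets of \<open>F\<close> can still come if level \<open>r\<close> has received \<open>k\<close> elements. In a complete level a partner set
  can be lost only as long as some element (position \<open>e \<noteq> 0\<close>) still sits on the preceding partner.
\<close>

definition remaining :: "nat \<Rightarrow> nat \<Rightarrow> nat \<Rightarrow> int" where
  "remaining r k e = mu r + (if k < l r then int (l r) - int k + zi r else if e \<noteq> 0 then zi r else 0)"

text \<open>
  The element on the partner set has position \<open>e\<close>, where 0 means that there is none. If there is a triple at the
  upper boundary of level \<open>r\<close> and this level is complete, or lacks one element below a \<open>\<Lambda>\<close>-triple, this element must
  belong to the triple, for
  the next partner may have to carry an element of the triple in the level above.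
\<close>

definition good :: "nat \<Rightarrow> nat \<Rightarrow> nat \<Rightarrow> bool" where
  "good r k e \<longleftrightarrow> e \<le> k \<and> (T r = Wedge \<longrightarrow> l r - 1 \<le> k \<longrightarrow> e = 0 \<or> l r - 1 \<le> e)
     \<and> (T r = Vee \<longrightarrow> k = l r \<longrightarrow> e = 0 \<or> e = l r)"

definition exs :: "nat \<Rightarrow> nat \<Rightarrow> (nat \<times> nat) set" where
  "exs r e = (if e = 0 then {} else {(r, e)})"

text \<open>
  For \<open>r > s\<close> at least one element of level \<open>r\<close> has been placed; a complete level \<open>r - 1\<close> is described by
  \<open>k = l (r - 1)\<close> instead.
\<close>

definition state :: "'b set set \<Rightarrow> nat \<Rightarrow> nat \<Rightarrow> nat \<Rightarrow> nat \<Rightarrow> 'b set \<Rightarrow> 'b set \<Rightarrow> bool" where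
  "state F s r k e U V \<longleftrightarrow> 1 \<le> s \<and> s \<le> r \<and> r \<le> h \<and> k \<le> l r \<and> (1 \<le> k \<or> r = s) \<and> good r k e
     \<and> progress F (seg s r k) (exs r e) U V"

lemma mu_Suc: "r < h \<Longrightarrow> mu r = int (l (Suc r)) + zi (Suc r) + mu (Suc r)"
proof -
  assume "r < h"
  then have "{r<..h} = insert (Suc r) {Suc r<..h}" by auto
  then show ?thesis by (simp add: mu_def)
qed

lemma mu_h: "mu h = -1" by (simp add: mu_def)

lemma mu_nonneg: "r < h \<Longrightarrow> 0 \<le> mu r"
proof -
  assume r: "r < h"
  have "1 \<le> int (l h) + zi h" using l_pos[of h] r by (simp add: zi_def)
  also have "\<dots> \<le> (\<Sum>i\<in>{r<..h}. int (l i) + zi i)"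
    by (rule member_le_sum) (use r in \<open>auto simp: zi_def\<close>)
  finally show ?thesis by (simp add: mu_def)
qed

lemma zi_nonneg: "0 \<le> zi r" by (simp add: zi_def)

lemma elems_eq_seg: "s \<le> h \<Longrightarrow> elems s = seg s h (l h)"
proof -
  assume "s \<le> h"
  then have "(s \<le> i \<and> i \<le> h \<and> 1 \<le> j \<and> j \<le> l i) = (1 \<le> j \<and> (s \<le> i \<and> i < h \<and> j \<le> l i \<or> i = h \<and> j \<le> l h))" for i j
    by (cases "i = h") auto
  then show ?thesis unfolding elems_def seg_def by presburger
qed

lemma seg_Suc: "seg s r (Suc k) = insert (r, Suc k) (seg s r k)"
proof -
  have "(1 \<le> j \<and> (s \<le> i \<and> i < r \<and> j \<le> l i \<or> i = r \<and> j \<le> Suc k))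
      = ((i, j) = (r, Suc k) \<or> 1 \<le> j \<and> (s \<le> i \<and> i < r \<and> j \<le> l i \<or> i = r \<and> j \<le> k))" for i j
    by (cases "j = Suc k") (auto simp: le_Suc_eq)
  then show ?thesis unfolding seg_def by blast
qed

lemma seg_next: "s \<le> r \<Longrightarrow> seg s (Suc r) 0 = seg s r (l r)"
  by (auto simp: seg_def less_Suc_eq)

lemma seg_next1: "s \<le> r \<Longrightarrow> seg s (Suc r) 1 = insert (Suc r, 1) (seg s r (l r))"
  using seg_Suc[of s "Suc r" 0] seg_next by simp

lemma seg_next2: "s \<le> r \<Longrightarrow> seg s (Suc r) 2 = insert (Suc r, 2) (insert (Suc r, 1) (seg s r (l r)))"
  using seg_Suc[of s "Suc r" 1] seg_next1 by (simp add: numeral_2_eq_2)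

lemma Hi_last: "T r \<noteq> Full \<Longrightarrow> l r \<in> Hi r"
  by (cases "T r") (auto simp: Hi_def)

lemma Lo_first: "T r \<noteq> Full \<Longrightarrow> 1 \<in> Lo (Suc r)"
  by (cases "T r") (auto simp: Lo_def)

lemma place_subset: "place F I f \<Longrightarrow> J \<subseteq> I \<Longrightarrow> place F J f"
  unfolding place_def using inj_on_subset[of f I J] image_mono[of J I f] in_mono[of J I]
  by (metis order_trans)

lemma progress_subset: "progress F I ex U V \<Longrightarrow> J \<subseteq> I \<Longrightarrow> progress F J ex U V"
  unfolding progress_def using place_subset[of F I _ J] by (metis Diff_mono in_mono order_refl)

lemma progress_embeds: "progress F I ex U V \<Longrightarrow> embeds F I"
  by (auto simp: progress_def embeds_def)

lemma progress_none: "progress F I ex U V \<Longrightarrow> V \<subset> V' \<Longrightarrow> progress F I {} V V'"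
  unfolding progress_def by fast

lemma place_insert:
  assumes "place F I f" "p \<notin> I" "G \<in> F" "\<forall>p'\<in>I. f p' \<noteq> G"
    and "\<And>p'. p' \<in> I \<Longrightarrow> \<not> prec p p'" and "\<And>p'. p' \<in> I \<Longrightarrow> prec p' p \<Longrightarrow> f p' \<subset> G"
  shows "place F (insert p I) (f(p := G))"
proof -
  have np: "\<not> prec p p" by (simp add: prec_def)
  have "inj_on (f(p := G)) (insert p I)"
    using assms by (auto simp: place_def inj_on_def)
  then show ?thesis
    using assms np by (auto simp: place_def)
qed

text \<open>
  The three ways to use the next set \<open>V\<close> and its partner \<open>B\<close>: \<open>V\<close> alone, \<open>B\<close> alone, or both. The set \<open>V\<close> is above
  everything placed so far, while \<open>B\<close> can only carry elements unrelated to those of \<open>ex\<close> and to the one on \<open>V\<close>.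
\<close>

lemma progress_A:
  assumes "progress F I ex U V" "V \<in> F" "V \<subset> V'" "p \<notin> I" "\<And>p'. p' \<in> I \<Longrightarrow> \<not> prec p p'"
  shows "progress F (insert p I) {} V V'"
proof -
  obtain f where f: "place F I f" "\<forall>p\<in>I. f p \<subset> V"
    using assms(1) by (auto simp: progress_def)
  have "place F (insert p I) (f(p := V))"
    by (rule place_insert) (use f assms in auto)
  then show ?thesis unfolding progress_def
    using f(2) assms(3,4) by (intro exI[of _ "f(p := V)"]) auto
qed

lemma progress_B:
  assumes "progress F I ex U V" "B \<in> F" "U \<subset> B" "B \<subset> V'" "\<not> B \<subseteq> V" "V \<subset> V'" "p \<notin> I"
    and "\<And>p'. p' \<in> I \<Longrightarrow> \<not> prec p p'" and "\<And>p'. p' \<in> ex \<Longrightarrow> \<not> prec p' p"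
  shows "progress F (insert p I) {p} V V'"
proof -
  obtain f where f: "place F I f" "\<forall>p\<in>I. f p \<subset> V" "\<forall>p\<in>I - ex. f p \<subseteq> U"
    using assms(1) by (auto simp: progress_def)
  have "place F (insert p I) (f(p := B))"
  proof (rule place_insert)
    show "f p' \<subset> B" if "p' \<in> I" "prec p' p" for p'
      using f(3) that assms(3,9) by blast
    show "\<forall>p'\<in>I. f p' \<noteq> B" using f(2) assms(5) by blast
  qed (use f assms in auto)
  then show ?thesis unfolding progress_def
    using f(2) assms(4,6,7) by (intro exI[of _ "f(p := B)"]) auto
qed

lemma progress_AB:
  assumes "progress F I ex U V" "V \<in> F" "B \<in> F" "U \<subset> B" "B \<subset> V'" "\<not> B \<subseteq> V" "V \<subset> V'"
    and "p \<notin> I" "q \<notin> I" "p \<noteq> q"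
    and "\<And>p'. p' \<in> I \<Longrightarrow> \<not> prec p p'" and "\<And>p'. p' \<in> I \<Longrightarrow> \<not> prec q p'" and "\<not> prec q p" "\<not> prec p q"
    and "\<And>p'. p' \<in> ex \<Longrightarrow> \<not> prec p' q"
  shows "progress F (insert q (insert p I)) {q} V V'"
proof -
  obtain f where f: "place F I f" "\<forall>p\<in>I. f p \<subset> V" "\<forall>p\<in>I - ex. f p \<subseteq> U"
    using assms(1) by (auto simp: progress_def)
  have 1: "place F (insert p I) (f(p := V))"
    by (rule place_insert) (use f assms in auto)
  have "place F (insert q (insert p I)) (f(p := V, q := B))"
  proof (rule place_insert[OF 1])
    show "(f(p := V)) p' \<subset> B" if "p' \<in> insert p I" "prec p' q" for p'
    proof -
      have "p' \<noteq> p" using that assms by auto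
      moreover from this have "p' \<in> I - ex" using that assms(15) by blast
      ultimately show ?thesis using f(3) assms(4) by auto
    qed
    show "\<forall>p'\<in>insert p I. (f(p := V)) p' \<noteq> B" using f(2) assms(6) by auto
    show "\<not> prec q p'" if "p' \<in> insert p I" for p' using that assms(12,13) by blast
  qed (use assms in auto)
  then show ?thesis unfolding progress_def
    using f(2) assms(5,7,8,9,10) by (intro exI[of _ "f(p := V, q := B)"]) auto
qed

section \<open>One step along a double chain\<close>

lemma prec_seg: "p' \<in> seg s r k \<Longrightarrow> r \<le> fst p \<Longrightarrow> \<not> prec p p'"
  by (auto simp: prec_def seg_def)

lemma not_in_seg: "k < j \<Longrightarrow> (r, j) \<notin> seg s r k" "r < i \<Longrightarrow> (i, j) \<notin> seg s r k"
  by (auto simp: seg_def)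

lemma not_prec_same: "\<not> prec (r, i) (r, j)" by (simp add: prec_def)

lemma not_prec_exs: "p' \<in> exs r e \<Longrightarrow> \<not> prec p' (r, j)"
  by (auto simp: exs_def prec_def split: if_splits)

lemma conf_Suc: "i \<in> Hi r \<Longrightarrow> j \<in> Lo (Suc r) \<Longrightarrow> \<not> prec (r, i) (Suc r, j)"
  by (simp add: prec_def conf_def)

lemma good0: "good r k 0" by (simp add: good_def)

lemma Hi_good: "T r \<noteq> Full \<Longrightarrow> good r (l r) e \<Longrightarrow> p' \<in> exs r e \<Longrightarrow> j \<in> Lo (Suc r) \<Longrightarrow> \<not> prec p' (Suc r, j)"
proof -
  assume a: "T r \<noteq> Full" "good r (l r) e" "p' \<in> exs r e" "j \<in> Lo (Suc r)"
  then have "e \<noteq> 0" "p' = (r, e)" by (auto simp: exs_def split: if_splits)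
  moreover from this have "e \<in> Hi r"
    using a(1,2) by (cases "T r") (auto simp: good_def Hi_def)
  ultimately show ?thesis using a(4) conf_Suc by simp
qed

text \<open>
  The members of \<open>F\<close> among \<open>V\<close> and its partner \<open>B\<close> are paid from the value of the state. The only configuration
  that leaves the states is the last one: one element of level \<open>r\<close> is missing, a \<open>V\<close>-triple is at its upper boundary, both
  sets are present, and some element sits on the partner of \<open>U\<close>, so that \<open>B\<close> cannot carry the first element of
  the next level. Then \<open>V\<close> gets that element and \<open>B\<close> gets \<open>(r, l r)\<close>, to which it is unrelated; now an
  element of level \<open>r\<close> instead of \<open>r + 1\<close> sits on the partner.
\<close>

lemma state_step:
  assumes st: "state F s r k e U V" and free: "\<not> embeds F (elems s)"
    and V: "V = insert y U" "y \<notin> U" "q \<notin> V"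
  defines "B \<equiv> insert q U" and "V' \<equiv> insert q V"
  shows "(\<exists>r' k' e'. state F s r' k' e' V V' \<and> of_bool (V \<in> F) + of_bool (B \<in> F) + remaining r' k' e' \<le> remaining r k e
            \<and> (r' = r \<and> k \<le> k' \<and> (k = l r \<longrightarrow> e' = 0) \<or> r' = Suc r))
       \<or> V \<in> F \<and> B \<in> F \<and> T r = Vee \<and> Suc k = l r \<and> e \<noteq> 0
            \<and> progress F (seg s (Suc r) 1) {(r, l r)} V V'"
proof -
  have s: "1 \<le> s" "s \<le> r" "r \<le> h" "k \<le> l r" "1 \<le> k \<or> r = s" "good r k e"
    and re: "progress F (seg s r k) (exs r e) U V"
    using st by (auto simp: state_def)
  have sub: "U \<subset> B" "B \<subset> V'" "\<not> B \<subseteq> V" "V \<subset> V'"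
    using V by (auto simp: B_def V'_def)
  have noth: "\<not> (k = l r \<and> r = h)"
    using re free progress_embeds[OF re] s elems_eq_seg[of s] by auto
  have ek: "e \<le> k" using s by (simp add: good_def)
  note sA = progress_A[OF re _ sub(4)] and sB = progress_B[OF re _ sub]
    and sAB = progress_AB[OF re _ _ sub]
  have zr: "zi r = of_bool (T r = Full)" if "r < h" using that by (simp add: zi_def)
  have lr: "1 \<le> l r" using l_pos s by auto
  have nin: "(r, Suc k) \<notin> seg s r k" "(r, Suc (Suc k)) \<notin> seg s r k" "(Suc r, j) \<notin> seg s r k" for j
    by (simp_all add: not_in_seg)
  have pre: "\<not> prec (i, j) p'" if "p' \<in> seg s r k" "r \<le> i" for p' i j
    using prec_seg[OF that(1), of "(i, j)"] that(2) by simp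
  have preS: "\<And>p' j. p' \<in> seg s r k \<Longrightarrow> \<not> prec (r, j) p'" and pre1: "\<And>p' j. p' \<in> seg s r k \<Longrightarrow> \<not> prec (Suc r, j) p'"
    by (simp_all add: pre)
  have preE: "\<And>p' j. p' \<in> exs r e \<Longrightarrow> \<not> prec p' (r, j)"
    by (rule not_prec_exs)
  have down: "\<not> prec (Suc r, i) (r, j)" for i j by (simp add: prec_def)
  have fin: ?thesis
    if "state F s r' k' e' V V'" "of_bool (V \<in> F) + of_bool (B \<in> F) + remaining r' k' e' \<le> remaining r k e"
      "r' = r \<and> k \<le> k' \<and> (k = l r \<longrightarrow> e' = 0) \<or> r' = Suc r" for r' k' e'
    using that by blast
  show ?thesis
  proof (cases "k = l r")
    case False
    then have k: "k < l r" using s by simp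
    consider "V \<notin> F" "B \<notin> F" | "V \<in> F" "B \<notin> F" | "V \<notin> F" "B \<in> F" | "V \<in> F" "B \<in> F" by blast
    then show ?thesis
    proof cases
      case 1
      have "state F s r k 0 V V'" using progress_none[OF re sub(4)] s good0 by (auto simp: state_def exs_def)
      then show ?thesis using 1 k by (intro fin[of r k 0]) (auto simp: remaining_def)
    next
      case 2
      have "progress F (seg s r (Suc k)) {} V V'" unfolding seg_Suc
        by (rule sA[OF 2(1) nin(1) preS])
      then have "state F s r (Suc k) 0 V V'" using s k good0 by (auto simp: state_def exs_def)
      then show ?thesis using 2 k zi_nonneg[of r] by (intro fin[of r "Suc k" 0]) (auto simp: remaining_def)
    next
      case 3
      have "progress F (seg s r (Suc k)) {(r, Suc k)} V V'" unfolding seg_Suc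
        by (rule sB[OF 3(2) nin(1) preS preE])
      moreover have "good r (Suc k) (Suc k)" using k by (auto simp: good_def)
      ultimately have "state F s r (Suc k) (Suc k) V V'" using s k by (auto simp: state_def exs_def)
      then show ?thesis using 3 k by (intro fin[of r "Suc k" "Suc k"]) (auto simp: remaining_def)
    next
      case 4
      show ?thesis
      proof (cases "Suc k = l r")
        case False
        have "progress F (insert (r, Suc (Suc k)) (insert (r, Suc k) (seg s r k))) {(r, Suc (Suc k))} V V'"
          by (rule sAB[OF 4 nin(1,2) _ preS preS not_prec_same not_prec_same preE]) simp
        then have "progress F (seg s r (Suc (Suc k))) {(r, Suc (Suc k))} V V'" by (simp add: seg_Suc)
        moreover have "good r (Suc (Suc k)) (Suc (Suc k))" using k False by (auto simp: good_def)
        ultimately have "state F s r (Suc (Suc k)) (Suc (Suc k)) V V'"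
          using s k False by (auto simp: state_def exs_def)
        then show ?thesis using 4 k False
          by (intro fin[of r "Suc (Suc k)" "Suc (Suc k)"]) (auto simp: remaining_def)
      next
        case True
        have A: "progress F (seg s r (l r)) {} V V'" unfolding True[symmetric] seg_Suc
          by (rule sA[OF 4(1) nin(1) preS])
        then have rh: "r < h"
          using free progress_embeds[OF A] s elems_eq_seg[of s] by (cases "r = h") auto
        show ?thesis
        proof (cases "T r = Full")
          case full: True
          have "state F s r (l r) 0 V V'" using A s lr good0 by (auto simp: state_def exs_def)
          then show ?thesis using 4 k True full rh
            by (intro fin[of r "l r" 0]) (auto simp: remaining_def zr)
        next
          case nfull: False
          have l1: "2 \<le> l (Suc r)" using T_two nfull by auto
          have mur: "mu r = int (l (Suc r)) + zi (Suc r) + mu (Suc r)" by (rule mu_Suc[OF rh])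
          have rem1: "2 + remaining (Suc r) 1 e' \<le> remaining r k e" for e'
            using mur l1 k True nfull by (simp add: remaining_def zr rh)
          show ?thesis
          proof (cases "e = 0 \<or> T r = Wedge")
            case True': True
            have "progress F (insert (Suc r, 1) (insert (r, Suc k) (seg s r k))) {(Suc r, 1)} V V'"
            proof (rule sAB[OF 4 nin(1,3) _ preS pre1 down])
              show "\<not> prec (r, Suc k) (Suc r, 1)"
                using Hi_last[OF nfull] Lo_first[OF nfull] True conf_Suc by metis
              show "\<not> prec p' (Suc r, 1)" if "p' \<in> exs r e" for p'
              proof -
                have "e \<noteq> 0" "p' = (r, e)" using that by (auto simp: exs_def split: if_splits)
                then have "T r = Wedge" "l r - 1 \<le> e" using True' s True by (auto simp: good_def)
                then have "e \<in> Hi r" using ek True by (auto simp: Hi_def)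
                then show ?thesis using \<open>p' = (r, e)\<close> Lo_first[OF nfull] conf_Suc by metis
              qed
            qed simp
            then have "progress F (seg s (Suc r) 1) {(Suc r, 1)} V V'"
              using seg_next1[OF s(2)] seg_Suc[of s r k] True by (simp del: One_nat_def)
            moreover have "good (Suc r) 1 1"
              using l1 T_Wedge[of "Suc r"] by (auto simp: good_def)
            ultimately have "state F s (Suc r) 1 1 V V'" using s l1 rh by (auto simp: state_def exs_def)
            then show ?thesis using 4 rem1
              by (intro fin[of "Suc r" "1" 1]) auto
          next
            case False
            then have vee: "T r = Vee" "e \<noteq> 0" using nfull by (cases "T r"; auto)+
            have "progress F (insert (r, Suc k) (insert (Suc r, 1) (seg s r k))) {(r, Suc k)} V V'"
            proof (rule sAB[OF 4 nin(3,1) _ pre1 preS _ down preE])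
              show "\<not> prec (r, Suc k) (Suc r, 1)"
                using Hi_last[OF nfull] Lo_first[OF nfull] True conf_Suc by metis
            qed simp
            then have "progress F (seg s (Suc r) 1) {(r, l r)} V V'"
              using seg_next1[OF s(2)] seg_Suc[of s r k] True
              by (simp add: insert_commute del: One_nat_def)
            then show ?thesis using 4 True vee by blast
          qed
        qed
      qed
    qed
  next
    case kl: True
    then have rh: "r < h" using noth s by auto
    have mur: "mu r = int (l (Suc r)) + zi (Suc r) + mu (Suc r)" by (rule mu_Suc[OF rh])
    have l1: "1 \<le> l (Suc r)" using l_pos rh by auto
    have none: "state F s r (l r) 0 V V'"
      using progress_none[OF re sub(4)] s lr good0 kl by (auto simp: state_def exs_def)
    have g1: "good (Suc r) 1 1"
      using l1 T_Wedge[of "Suc r"] by (auto simp: good_def)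
    consider "V \<notin> F" "B \<notin> F" | "V \<in> F" "B \<notin> F" | "V \<notin> F" "B \<in> F" | "V \<in> F" "B \<in> F" by blast
    then show ?thesis
    proof cases
      case 1
      then show ?thesis using none kl
        by (intro fin[of r "l r" 0]) (auto simp: remaining_def zi_nonneg)
    next
      case 2
      have "progress F (insert (Suc r, 1) (seg s r k)) {} V V'"
        by (rule sA[OF 2(1) nin(3) pre1])
      then have "state F s (Suc r) 1 0 V V'"
        using s kl l1 rh good0 by (simp add: state_def exs_def seg_next1 del: One_nat_def)
      then show ?thesis using 2 kl mur l1 zi_nonneg[of "Suc r"] zi_nonneg[of r]
        by (intro fin[of "Suc r" 1 0]) (auto simp: remaining_def)
    next
      case 3
      show ?thesis
      proof (cases "e \<noteq> 0 \<and> T r = Full")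
        case True
        then show ?thesis using none 3 kl rh
          by (intro fin[of r "l r" 0]) (auto simp: remaining_def zr)
      next
        case False
        have "progress F (insert (Suc r, 1) (seg s r k)) {(Suc r, 1)} V V'"
        proof (rule sB[OF 3(2) nin(3) pre1])
          show "\<not> prec p' (Suc r, 1)" if "p' \<in> exs r e" for p'
          proof -
            have "e \<noteq> 0" using that by (auto simp: exs_def split: if_splits)
            then have nf: "T r \<noteq> Full" using False by simp
            then show ?thesis using Hi_good[OF nf _ that Lo_first[OF nf]] s kl by simp
          qed
        qed
        then have "state F s (Suc r) 1 1 V V'"
          using s kl l1 rh g1 by (simp add: state_def exs_def seg_next1 del: One_nat_def)
        moreover have "1 + remaining (Suc r) 1 1 \<le> remaining r k e"
          using kl mur l1 zi_nonneg[of "Suc r"] zi_nonneg[of r] by (auto simp: remaining_def)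
        ultimately show ?thesis using 3
          by (intro fin[of "Suc r" 1 1]) auto
      qed
    next
      case 4
      have A: "progress F (insert (Suc r, 1) (seg s r k)) {} V V'"
        by (rule sA[OF 4(1) nin(3) pre1])
      then have A1: "state F s (Suc r) 1 0 V V'"
        using s kl l1 rh good0 by (simp add: state_def exs_def seg_next1 del: One_nat_def)
      have nh: "\<not> (Suc r = h \<and> l (Suc r) = 1)"
        using free progress_embeds[OF A] s elems_eq_seg[of s] kl seg_next1[of s r] by (auto simp del: One_nat_def)
      consider "e \<noteq> 0" "T r = Full" | "l (Suc r) = 1" "\<not> (e \<noteq> 0 \<and> T r = Full)" | "2 \<le> l (Suc r)" "\<not> (e \<noteq> 0 \<and> T r = Full)"
        using l1 by linarith
      then show ?thesis
      proof cases
        case 1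
        then show ?thesis using A1 4 kl rh mur l1 zi_nonneg[of "Suc r"]
          by (intro fin[of "Suc r" 1 0]) (auto simp: remaining_def zr)
      next
        case 2
        then have "T (Suc r) = Full" "Suc r < h" using T_two[of "Suc r"] nh rh by auto
        then have "zi (Suc r) = 1" by (simp add: zi_def)
        then show ?thesis using A1 4 kl rh mur l1 2 zi_nonneg[of r]
          by (intro fin[of "Suc r" 1 0]) (auto simp: remaining_def)
      next
        case 3
        \<comment> \<open>The element on the partner set is \<open>j\<close>: it must be unrelated to the last elements of level \<open>r\<close>, and
          fit the demands of \<open>good\<close> in case level \<open>r + 1\<close> is nearly complete already.\<close>
        obtain i j :: nat where ij: "{i, j} = {1, 2}" "i \<noteq> j" "T r \<noteq> Full \<longrightarrow> j \<in> Lo (Suc r)"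
          "T r = Vee \<longrightarrow> \<not> shared (Suc r) \<longrightarrow> j = 2" "T r \<noteq> Vee \<longrightarrow> T r \<noteq> Full \<longrightarrow> j = 1" "T r = Full \<longrightarrow> j = 2"
        proof (cases "T r = Full \<or> T r = Vee \<and> \<not> shared (Suc r)")
          case True
          then show ?thesis using that[of 1 2] by (auto simp: Lo_def)
        next
          case False
          then show ?thesis using that[of 2 1] Lo_first[of r] by auto
        qed
        have "progress F (insert (Suc r, j) (insert (Suc r, i) (seg s r k))) {(Suc r, j)} V V'"
        proof (rule sAB[OF 4 nin(3,3) _ pre1 pre1 not_prec_same not_prec_same])
          show "\<not> prec p' (Suc r, j)" if "p' \<in> exs r e" for p'
          proof -
            have "e \<noteq> 0" using that by (auto simp: exs_def split: if_splits)
            then have nf: "T r \<noteq> Full" using 3 by simp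
            then show ?thesis using Hi_good[OF nf _ that] ij(3) s kl by simp
          qed
        qed (use ij(2) in simp)
        moreover have "insert (Suc r, j) (insert (Suc r, i) (seg s r k)) = seg s (Suc r) 2"
          using ij(1) s kl by (auto simp: seg_next2 doubleton_eq_iff)
        ultimately have "progress F (seg s (Suc r) 2) {(Suc r, j)} V V'" by simp
        moreover have "good (Suc r) 2 j"
        proof -
          have "j \<le> 2" "1 \<le> j" using ij(1) by (auto simp: doubleton_eq_iff)
          moreover have "l (Suc r) - 1 \<le> j" if W: "T (Suc r) = Wedge" "l (Suc r) - 1 \<le> 2"
          proof -
            have "l (Suc r) = 3" using T_Wedge[OF W(1)] W by simp
            moreover have "T r \<noteq> Wedge" using T_both[of r] W(1) \<open>l (Suc r) = 3\<close> by auto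
            moreover have "\<not> shared (Suc r)" using \<open>l (Suc r) = 3\<close> by (simp add: shared_def)
            ultimately show ?thesis using ij by (cases "T r") auto
          qed
          moreover have "j = 2" if W: "T (Suc r) = Vee" "2 = l (Suc r)"
          proof -
            have "T r = Full" using T_both[of r] W by auto
            then show ?thesis using ij by simp
          qed
          ultimately show ?thesis by (auto simp: good_def)
        qed
        moreover have "j \<noteq> 0" using ij(1) by (auto simp: doubleton_eq_iff)
        ultimately have st2: "state F s (Suc r) 2 j V V'"
          using s 3(1) rh by (simp add: state_def exs_def)
        have "remaining (Suc r) 2 j = mu (Suc r) + int (l (Suc r)) - 2 + zi (Suc r)"
          using 3(1) \<open>j \<noteq> 0\<close> by (cases "l (Suc r) = 2") (simp_all add: remaining_def)
        moreover have "mu r \<le> remaining r k e"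
          using zi_nonneg[of r] by (simp add: remaining_def kl)
        ultimately have "2 + remaining (Suc r) 2 j \<le> remaining r k e"
          using mur by linarith
        then show ?thesis using fin[OF st2] 4 by simp
      qed
    qed
  qed
qed

section \<open>Crossing into a shared level\<close>

text \<open>
  Below a level that is not shared the exceptional configuration of \<open>state_step\<close> is over after one step, since the
  next partner can carry the second element of the \<open>V\<close>-triple in level \<open>r + 1\<close>. If that level is shared, a lone
  partner has to go to position 3 ahead of position 2.
\<close>

lemma vee_step:
  assumes T: "T r = Vee" and s: "1 \<le> s" "s \<le> r"
    and re: "progress F (seg s (Suc r) 1) {(r, l r)} U V"
    and V: "V = insert y U" "y \<notin> U" "q \<notin> V"
  defines "B \<equiv> insert q U" and "V' \<equiv> insert q V"
  shows "(\<exists>k' e'. state F s (Suc r) k' e' V V' \<and> of_bool (V \<in> F) + of_bool (B \<in> F) + remaining (Suc r) k' e' \<le> remaining (Suc r) 1 0)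
       \<or> shared (Suc r) \<and> V \<notin> F \<and> B \<in> F \<and> progress F (insert (Suc r, 3) (seg s (Suc r) 1)) {(Suc r, 3)} V V'"
proof -
  let ?R = "Suc r"
  have l3: "3 \<le> l ?R" using T_Vee T by auto
  have R: "?R \<le> h" "s \<le> ?R" using T_range[of r] T s by auto
  have sub: "U \<subset> B" "B \<subset> V'" "\<not> B \<subseteq> V" "V \<subset> V'"
    using V by (auto simp: B_def V'_def)
  have nin: "(?R, 2) \<notin> seg s ?R 1" "(?R, 3) \<notin> seg s ?R 1" by (simp_all add: seg_def)
  have pre: "\<And>p' j. p' \<in> seg s ?R 1 \<Longrightarrow> \<not> prec (?R, j) p'"
    using prec_seg by simp
  have exL: "\<And>p'. p' \<in> {(r, l r)} \<Longrightarrow> \<not> prec p' (?R, j)" if "j \<in> Lo ?R" for j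
    using conf_Suc[OF Hi_last that] T by simp
  note sA = progress_A[OF re _ sub(4)] and sB = progress_B[OF re _ sub]
    and sAB = progress_AB[OF re _ _ sub]
  have seg2: "seg s ?R 2 = insert (?R, 2) (seg s ?R 1)"
    using seg_Suc[of s ?R 1] by (simp add: numeral_2_eq_2)
  have seg3: "seg s ?R 3 = insert (?R, 3) (seg s ?R 2)"
    using seg_Suc[of s ?R 2] by (simp add: numeral_3_eq_3 numeral_2_eq_2)
  have fin: ?thesis
    if "progress F (seg s ?R k') (exs ?R e') V V'" "good ?R k' e'" "1 \<le> k'" "k' \<le> l ?R"
      "of_bool (V \<in> F) + of_bool (B \<in> F) \<le> int k' - 1" for k' e'
  proof -
    have "state F s ?R k' e' V V'" using that R s by (simp add: state_def)
    moreover have "int k' - 1 + remaining ?R k' e' \<le> remaining ?R 1 0"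
      using that l3 zi_nonneg[of ?R] by (auto simp: remaining_def)
    ultimately show ?thesis using that(5) by (intro disjI1 exI[of _ k'] exI[of _ e']) linarith
  qed
  consider "V \<notin> F" "B \<notin> F" | "V \<in> F" "B \<notin> F" | "V \<notin> F" "B \<in> F" | "V \<in> F" "B \<in> F" by blast
  then show ?thesis
  proof cases
    case 1
    then show ?thesis using fin[of 1 0] progress_none[OF re sub(4)] l3 good0 by (simp add: exs_def)
  next
    case 2
    have "progress F (seg s ?R 2) {} V V'"
      unfolding seg2 by (rule sA[OF 2(1) nin(1) pre])
    then show ?thesis using fin[of 2 0] 2 l3 good0 by (simp add: exs_def)
  next
    case 3
    show ?thesis
    proof (cases "shared ?R")
      case True
      have "progress F (insert (?R, 3) (seg s ?R 1)) {(?R, 3)} V V'"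
        by (rule sB[OF 3(2) nin(2) pre exL]) (use True T in \<open>simp_all add: Lo_def\<close>)
      then show ?thesis using True 3 by blast
    next
      case False
      have "progress F (seg s ?R 2) {(?R, 2)} V V'"
        unfolding seg2 by (rule sB[OF 3(2) nin(1) pre exL]) (use False T in \<open>simp_all add: Lo_def\<close>)
      moreover have "good ?R 2 2" using l3 by (auto simp: good_def)
      ultimately show ?thesis using fin[of 2 2] 3 l3 by (simp add: exs_def)
    qed
  next
    case 4
    show ?thesis
    proof (cases "shared ?R")
      case True
      have "progress F (insert (?R, 3) (insert (?R, 2) (seg s ?R 1))) {(?R, 3)} V V'"
        by (rule sAB[OF 4 nin _ pre pre not_prec_same not_prec_same exL]) (use True T in \<open>simp_all add: Lo_def\<close>)
      then have "progress F (seg s ?R 3) {(?R, 3)} V V'" by (simp only: seg3 seg2)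
      moreover have "good ?R 3 3" using True by (auto simp: good_def shared_def)
      ultimately show ?thesis using fin[of 3 3] 4 l3 by (simp add: exs_def)
    next
      case False
      have "progress F (insert (?R, 2) (insert (?R, 3) (seg s ?R 1))) {(?R, 2)} V V'"
        by (rule sAB[OF 4 nin(2,1) _ pre pre not_prec_same not_prec_same exL]) (use False T in \<open>simp_all add: Lo_def\<close>)
      then have "progress F (seg s ?R 3) {(?R, 2)} V V'" by (simp only: seg3 seg2 insert_commute)
      moreover have "good ?R 3 2"
        using T False T_both[of r] l3 by (auto simp: good_def shared_def)
      ultimately show ?thesis using fin[of 3 2] 4 l3 by (simp add: exs_def)
    qed
  qed
qed

lemma shared_facts:
  assumes "shared (Suc r)"
  shows "T r = Vee" "T (Suc r) = Wedge" "l (Suc r) = 4" "zi (Suc r) = 0" "Lo (Suc r) = {1, 3}"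
    "Hi (Suc r) = {3, 4}" "Lo (Suc (Suc r)) = {1}" "1 \<le> r" "Suc r < h" "2 \<le> l (Suc (Suc r))" "3 \<le> l r \<or> 2 \<le> l r"
  using assms T_range[of "Suc r"] T_range[of r] T_two[of "Suc r"] T_two[of r]
  by (auto simp: shared_def zi_def Lo_def Hi_def)

lemma remaining_shared:
  assumes "shared (Suc r)"
  shows "remaining (Suc r) 1 e = mu (Suc r) + 3" "remaining (Suc r) 2 e = mu (Suc r) + 2"
    "remaining (Suc r) 3 e = mu (Suc r) + 1" "remaining (Suc r) 4 e = mu (Suc r)"
  using shared_facts(3,4)[OF assms] by (simp_all add: remaining_def)

lemma seg_numerals:
  "seg s R 2 = insert (R, 2) (seg s R 1)" "seg s R 3 = insert (R, 3) (seg s R 2)"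
  "seg s R 4 = insert (R, 4) (seg s R 3)"
  using seg_Suc[of s R 1] seg_Suc[of s R 2] seg_Suc[of s R 3]
  by (simp_all add: eval_nat_numeral)

text \<open>
  Positions 1 and 3 of the shared level are taken, and 2 is the next one to fill. If it lands on a partner
  set, the result is not a state: an element outside the \<open>\<Lambda>\<close>-triple sits there when just one position
  is left.
\<close>

lemma two_step:
  assumes sh: "shared (Suc r)" and s: "1 \<le> s" "s \<le> r"
    and re: "progress F (insert (Suc r, 3) (seg s (Suc r) 1)) ex U V" and ex: "ex \<subseteq> {(Suc r, 3)}"
    and V: "V = insert y U" "y \<notin> U" "q \<notin> V"
  defines "B \<equiv> insert q U" and "V' \<equiv> insert q V"
  shows "(\<exists>k' e'. state F s (Suc r) k' e' V V' \<and> of_bool (V \<in> F) + of_bool (B \<in> F) + remaining (Suc r) k' e' \<le> mu (Suc r) + 2)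
       \<or> V \<notin> F \<and> B \<notin> F \<and> progress F (insert (Suc r, 3) (seg s (Suc r) 1)) {} V V'
       \<or> V \<notin> F \<and> B \<in> F \<and> progress F (seg s (Suc r) 3) {(Suc r, 2)} V V'"
proof -
  let ?R = "Suc r" and ?I = "insert (Suc r, 3) (seg s (Suc r) 1)"
  note sf = shared_facts[OF sh] and rs = remaining_shared[OF sh]
  have R: "?R \<le> h" "s \<le> ?R" using sf s by auto
  have sub: "U \<subset> B" "B \<subset> V'" "\<not> B \<subseteq> V" "V \<subset> V'"
    using V by (auto simp: B_def V'_def)
  have nin: "(?R, 2) \<notin> ?I" "(?R, 4) \<notin> ?I" by (simp_all add: seg_def)
  have pre: "\<And>p' j. p' \<in> ?I \<Longrightarrow> \<not> prec (?R, j) p'"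
    using prec_seg by (auto simp: prec_def)
  have exL: "\<And>p' j. p' \<in> ex \<Longrightarrow> \<not> prec p' (?R, j)" using ex by (auto simp: prec_def)
  note sA = progress_A[OF re _ sub(4)] and sB = progress_B[OF re _ sub]
    and sAB = progress_AB[OF re _ _ sub]
  have seg3: "seg s ?R 3 = insert (?R, 2) ?I" by (simp add: seg_numerals insert_commute)
  consider "V \<notin> F" "B \<notin> F" | "V \<in> F" "B \<notin> F" | "V \<notin> F" "B \<in> F" | "V \<in> F" "B \<in> F" by blast
  then show ?thesis
  proof cases
    case 1
    then show ?thesis using progress_none[OF re sub(4)] by blast
  next
    case 2
    have "progress F (seg s ?R 3) {} V V'"
      unfolding seg3 by (rule sA[OF 2(1) nin(1) pre])
    then have "state F s ?R 3 0 V V'" using R s sf good0 by (simp add: state_def exs_def)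
    then show ?thesis using 2 rs by (intro disjI1 exI[of _ 3] exI[of _ "0::nat"]) simp
  next
    case 3
    have "progress F (seg s ?R 3) {(?R, 2)} V V'"
      unfolding seg3 by (rule sB[OF 3(2) nin(1) pre exL])
    then show ?thesis using 3 by blast
  next
    case 4
    have "progress F (insert (?R, 4) (insert (?R, 2) ?I)) {(?R, 4)} V V'"
      by (rule sAB[OF 4 nin _ pre pre not_prec_same not_prec_same exL]) simp
    then have "progress F (seg s ?R 4) {(?R, 4)} V V'" by (simp add: seg3 seg_numerals(3))
    then have "state F s ?R 4 4 V V'" using R s sf by (simp add: state_def exs_def good_def)
    then show ?thesis using 4 rs by (intro disjI1 exI[of _ 4] exI[of _ 4]) simp
  qed
qed

text \<open>
  Excluded by \<open>n\<close> is the only step that counts more sets than it can use: \<open>V\<close> completes the level, but \<open>B\<close>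
  cannot start the next one because of the element at position 2.
\<close>

lemma three_step:
  assumes sh: "shared (Suc r)" and s: "1 \<le> s" "s \<le> r"
    and re: "progress F (seg s (Suc r) 3) {(Suc r, 2)} U V"
    and V: "V = insert y U" "y \<notin> U" "q \<notin> V"
  defines "B \<equiv> insert q U" and "V' \<equiv> insert q V"
  assumes n: "\<not> (V \<in> F \<and> B \<in> F)"
  shows "\<exists>k' e'. state F s (Suc r) k' e' V V' \<and> of_bool (V \<in> F) + of_bool (B \<in> F) + remaining (Suc r) k' e' \<le> mu (Suc r) + 1"
proof -
  let ?R = "Suc r"
  note sf = shared_facts[OF sh] and rs = remaining_shared[OF sh]
  have R: "?R \<le> h" "s \<le> ?R" using sf s by auto
  have sub: "U \<subset> B" "B \<subset> V'" "\<not> B \<subseteq> V" "V \<subset> V'"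
    using V by (auto simp: B_def V'_def)
  have nin: "(?R, 4) \<notin> seg s ?R 3" by (simp add: seg_def)
  have pre: "\<And>p' j. p' \<in> seg s ?R 3 \<Longrightarrow> \<not> prec (?R, j) p'" using prec_seg by simp
  have exL: "\<And>p' j. p' \<in> {(?R, 2)} \<Longrightarrow> \<not> prec p' (?R, j)" by (auto simp: prec_def)
  note sA = progress_A[OF re _ sub(4)] and sB = progress_B[OF re _ sub]
  consider "V \<notin> F" "B \<notin> F" | "V \<in> F" "B \<notin> F" | "V \<notin> F" "B \<in> F" using n by blast
  then show ?thesis
  proof cases
    case 1
    have "state F s ?R 3 0 V V'" using progress_none[OF re sub(4)] R s sf good0 by (simp add: state_def exs_def)
    then show ?thesis using 1 rs by (intro exI[of _ 3] exI[of _ "0::nat"]) simp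
  next
    case 2
    have "progress F (seg s ?R 4) {} V V'"
      unfolding seg_numerals(3) by (rule sA[OF 2(1) nin(1) pre])
    then have "state F s ?R 4 0 V V'" using R s sf good0 by (simp add: state_def exs_def)
    then show ?thesis using 2 rs by (intro exI[of _ 4] exI[of _ "0::nat"]) simp
  next
    case 3
    have "progress F (seg s ?R 4) {(?R, 4)} V V'"
      unfolding seg_numerals(3) by (rule sB[OF 3(2) nin(1) pre exL])
    then have "state F s ?R 4 4 V V'" using R s sf by (simp add: state_def exs_def good_def)
    then show ?thesis using 3 rs by (intro exI[of _ 4] exI[of _ 4]) simp
  qed
qed

text \<open>
  While this holds at \<open>V\<close>, a family without a copy of the poset cannot complete level \<open>R\<close> below \<open>V\<close>; once it
  fails, the bound for the levels beyond \<open>R\<close> limits what is still to come.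
\<close>

definition Up :: "'b set set \<Rightarrow> nat \<Rightarrow> 'b set \<Rightarrow> bool" where
  "Up F R V \<longleftrightarrow> embeds {G \<in> F. V \<subseteq> G} (elems (Suc R))"

lemma Up_mono: "Up F R V \<Longrightarrow> U \<subseteq> V \<Longrightarrow> Up F R U"
proof -
  assume a: "Up F R V" "U \<subseteq> V"
  then obtain g where "place {G \<in> F. V \<subseteq> G} (elems (Suc R)) g" by (auto simp: Up_def embeds_def)
  then have "place {G \<in> F. U \<subseteq> G} (elems (Suc R)) g" using a(2) by (auto simp: place_def)
  then show "Up F R U" by (auto simp: Up_def embeds_def)
qed

lemma Up_complete:
  assumes re: "progress F (seg s R (l R)) ex U V" and up: "Up F R V" and s: "1 \<le> s" "s \<le> R" "R \<le> h"
  shows "embeds F (elems s)"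
proof -
  obtain f where f: "place F (seg s R (l R)) f" "\<And>p. p \<in> seg s R (l R) \<Longrightarrow> f p \<subset> V"
    using re by (auto simp: progress_def)
  obtain g where g: "place {G \<in> F. V \<subseteq> G} (elems (Suc R)) g" using up by (auto simp: Up_def embeds_def)
  define k where "k = (\<lambda>p. if p \<in> seg s R (l R) then f p else g p)"
  have dis: "p \<notin> elems (Suc R)" if "p \<in> seg s R (l R)" for p using that by (auto simp: seg_def elems_def)
  have "p \<in> elems s \<longleftrightarrow> p \<in> seg s R (l R) \<or> p \<in> elems (Suc R)" for p
    using s by (cases "fst p" R rule: linorder_cases) (auto simp: seg_def elems_def)
  then have un: "elems s = seg s R (l R) \<union> elems (Suc R)" by blast
  have gV: "V \<subseteq> g p" "g p \<in> F" if "p \<in> elems (Suc R)" for p using g that by (auto simp: place_def)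
  have lev: "\<not> prec q p" if "p \<in> seg s R (l R)" "q \<in> elems (Suc R)" for p q
    using that by (auto simp: prec_def seg_def elems_def)
  have kf: "k p = f p" if "p \<in> seg s R (l R)" for p using that by (simp add: k_def)
  have kg: "k p = g p" if "p \<in> elems (Suc R)" for p using that dis[of p] unfolding k_def by meson
  have lt: "f p \<subset> g q" if "p \<in> seg s R (l R)" "q \<in> elems (Suc R)" for p q
    using f(2)[OF that(1)] gV(1)[OF that(2)] by blast
  have "place F (elems s) k"
    unfolding place_def
  proof (intro conjI ballI impI)
    show "inj_on k (elems s)"
    proof (rule inj_onI)
      fix p q assume pq: "p \<in> elems s" "q \<in> elems s" "k p = k q"
      have fi: "inj_on f (seg s R (l R))" and gi: "inj_on g (elems (Suc R))" using f g by (auto simp: place_def)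
      consider "p \<in> seg s R (l R)" "q \<in> seg s R (l R)" | "p \<in> seg s R (l R)" "q \<in> elems (Suc R)"
        | "p \<in> elems (Suc R)" "q \<in> seg s R (l R)" | "p \<in> elems (Suc R)" "q \<in> elems (Suc R)"
        using pq un by blast
      then show "p = q"
      proof cases
        case 1 then show ?thesis using pq(3) inj_onD[OF fi] by (simp add: kf)
      next
        case 2 then show ?thesis using pq(3) lt[OF 2] by (simp add: kf kg)
      next
        case 3 then show ?thesis using pq(3) lt[OF 3(2,1)] by (simp add: kf kg)
      next
        case 4 then show ?thesis using pq(3) inj_onD[OF gi] by (simp add: kg)
      qed
    qed
    show "k ` elems s \<subseteq> F"
    proof
      fix G assume "G \<in> k ` elems s"
      then obtain p where p: "p \<in> elems s" "G = k p" by blast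
      show "G \<in> F"
      proof (cases "p \<in> seg s R (l R)")
        case True
        then show ?thesis using p f(1) kf by (auto simp: place_def)
      next
        case False
        then have "p \<in> elems (Suc R)" using p un by blast
        then show ?thesis using p gV kg by simp
      qed
    qed
    fix p q assume pq: "p \<in> elems s" "q \<in> elems s" "prec p q"
    consider "p \<in> seg s R (l R)" "q \<in> seg s R (l R)" | "p \<in> seg s R (l R)" "q \<in> elems (Suc R)"
      | "p \<in> elems (Suc R)" "q \<in> seg s R (l R)" | "p \<in> elems (Suc R)" "q \<in> elems (Suc R)"
      using pq un by blast
    then show "k p \<subset> k q"
    proof cases
      case 1 then show ?thesis using pq(3) f(1) by (simp add: kf place_def)
    next
      case 2 then show ?thesis using lt by (simp add: kf kg)
    next
      case 3 then show ?thesis using lev pq(3) by blast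
    next
      case 4 then show ?thesis using pq(3) g by (simp add: kg place_def)
    qed
  qed
  then show ?thesis by (auto simp: embeds_def)
qed

lemma place_extend:
  assumes "place F I f" "p \<notin> I" "f p \<in> F" "\<And>p'. p' \<in> I \<Longrightarrow> f p' \<noteq> f p"
    and "\<And>p'. p' \<in> I \<Longrightarrow> \<not> prec p p'" and "\<And>p'. p' \<in> I \<Longrightarrow> prec p' p \<Longrightarrow> f p' \<subset> f p"
  shows "place F (insert p I) f"
  using place_insert[of F I f p "f p"] assms by simp

end

section \<open>Arrangements of a shared level above a fixed set\<close>

text \<open>
  The moment before a shared level is entered in the exceptional way: all of level \<open>r\<close> but its last
  element is placed, at most \<open>(r, e)\<close> sits on the partner of \<open>M\<close>, and the next set \<open>A\<close> belongs to \<open>F\<close>.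
\<close>

locale window = levels +
  fixes F :: "'b set set" and s r :: nat and f :: "nat \<times> nat \<Rightarrow> 'b set" and e :: nat and M A :: "'b set" and a :: 'b
  assumes sh: "shared (Suc r)" and s: "1 \<le> s" "s \<le> r"
    and f: "place F (seg s r (l r - 1)) f"
    and fA: "\<And>p. p \<in> seg s r (l r - 1) \<Longrightarrow> f p \<subset> A"
    and fM: "\<And>p. p \<in> seg s r (l r - 1) \<Longrightarrow> p \<noteq> (r, e) \<Longrightarrow> f p \<subseteq> M"
    and A: "A = insert a M" "a \<notin> M" and AF: "A \<in> F"
    and free: "\<not> embeds F (elems s)"
begin

lemma MA: "M \<subset> A" using A by blast

abbreviation "R \<equiv> Suc r"

text \<open>
  The sets that can carry the missing element of level \<open>r\<close>: \<open>A\<close> itself, or a set of the same size that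
  differs from \<open>A\<close> by the last entry.
\<close>

definition top_of_r :: "'b set \<Rightarrow> bool" where
  "top_of_r G \<longleftrightarrow> G \<in> F \<and> (G = A \<or> (\<exists>c. c \<notin> A \<and> G = insert c M))"

text \<open>
  Sets for \<open>(r, l r)\<close> and for the four elements of the shared level, all of the latter above \<open>A\<close>. The
  elements 1 and 3 are unrelated to \<open>(r, l r)\<close>, so only 2 and 4 need to lie above its set. These
  sets need not come from one double chain.
\<close>

definition fill :: "'b set \<Rightarrow> (nat \<Rightarrow> 'b set) \<Rightarrow> bool" where
  "fill Gx g \<longleftrightarrow> top_of_r Gx \<and> g ` {1..4} \<subseteq> F \<and> inj_on g {1..4}
     \<and> (\<forall>j\<in>{1..4}. A \<subseteq> g j \<and> Gx \<noteq> g j) \<and> Gx \<subset> g 2 \<and> Gx \<subset> g 4"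

definition filling :: "'b set \<Rightarrow> (nat \<Rightarrow> 'b set) \<Rightarrow> nat \<times> nat \<Rightarrow> 'b set" where
  "filling Gx g = (\<lambda>(i, j). if i = R then g j else if (i, j) = (r, l r) then Gx else f (i, j))"

lemma filling_low: "p \<in> seg s r (l r - 1) \<Longrightarrow> filling Gx g p = f p"
proof -
  assume "p \<in> seg s r (l r - 1)"
  moreover have "1 \<le> l r" using shared_facts(11)[OF sh] by linarith
  ultimately have "fst p \<noteq> R" "p \<noteq> (r, l r)" by (auto simp: seg_def)
  then show ?thesis by (cases p) (auto simp: filling_def)
qed

lemma fill_above: "fill Gx g \<Longrightarrow> j \<in> {1..4} \<Longrightarrow> A \<subseteq> g j"
  by (simp add: fill_def)

lemma filling_mid: "filling Gx g (r, l r) = Gx" "filling Gx g (R, j) = g j"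
  by (simp_all add: filling_def)

lemma seg_top: "seg s r (l r) = insert (r, l r) (seg s r (l r - 1))"
  using seg_Suc[of s r "l r - 1"] shared_facts[OF sh] by auto

lemma seg_R: "p \<in> seg s R j \<longleftrightarrow> p \<in> seg s r (l r - 1) \<or> p = (r, l r) \<or> (\<exists>i\<in>{1..j}. p = (R, i))"
proof -
  have "p \<in> seg s R j \<longleftrightarrow> p \<in> seg s R 0 \<or> (\<exists>i\<in>{1..j}. p = (R, i))"
    by (cases p) (auto simp: seg_def)
  then show ?thesis by (simp only: seg_next[OF s(2)] seg_top insert_iff) blast
qed

lemma place_filling:
  assumes "fill Gx g"
  shows "place F (seg s R 4) (filling Gx g)"
proof -
  let ?k = "filling Gx g"
  note sf = shared_facts[OF sh]
  have Gx: "Gx \<in> F" "Gx = A \<or> (\<exists>c. c \<notin> A \<and> Gx = insert c M)"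
    using assms by (auto simp: fill_def top_of_r_def)
  have p0: "place F (seg s r (l r - 1)) ?k"
    using f unfolding place_def by (auto simp: filling_low inj_on_def)
  have p1: "place F (seg s r (l r)) ?k"
    unfolding seg_top
  proof (rule place_extend[OF p0])
    show "(r, l r) \<notin> seg s r (l r - 1)" using sf by (auto simp: seg_def)
    show "?k (r, l r) \<in> F" using Gx by (simp add: filling_mid)
    fix p' assume p': "p' \<in> seg s r (l r - 1)"
    have "f p' \<noteq> Gx" using fA[OF p'] Gx(2) by blast
    then show "?k p' \<noteq> ?k (r, l r)" unfolding filling_mid filling_low[OF p'] .
    show "\<not> prec (r, l r) p'" using prec_seg[OF p'] by simp
    assume "prec p' (r, l r)"
    then have "p' \<noteq> (r, e)" by (auto simp: prec_def)
    then have "f p' \<subseteq> M" "f p' \<subset> A" using fM fA p' by auto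
    then have "f p' \<subset> Gx" using Gx(2) MA by blast
    then show "?k p' \<subset> ?k (r, l r)" unfolding filling_mid filling_low[OF p'] .
  qed
  have "g ` {1..4} \<subseteq> F" "\<forall>j\<in>{1..4}. A \<subseteq> g j \<and> Gx \<noteq> g j" using assms unfolding fill_def by blast+
  then have g: "g j \<in> F" "A \<subseteq> g j" "Gx \<noteq> g j" if "j \<in> {1..4}" for j using that by blast+
  have gx: "Gx \<subset> g j" if "j \<in> {1..4}" "j \<notin> {1, 3}" for j
  proof -
    have "j = 2 \<or> j = 4" using that by auto
    then show ?thesis using assms by (auto simp: fill_def)
  qed
  have "place F (seg s R j) ?k" if "j \<le> 4" for j
    using that
  proof (induction j)
    case 0
    then show ?case using p1 seg_next[OF s(2)] by simp
  next
    case (Suc j)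
    let ?j = "Suc j"
    have j: "?j \<in> {1..4}" using Suc.prems by auto
    show ?case unfolding seg_Suc
    proof (rule place_extend)
      show "place F (seg s R j) ?k" using Suc by simp
      show "(R, ?j) \<notin> seg s R j" by (simp add: not_in_seg)
      show "?k (R, ?j) \<in> F" using g j by (simp add: filling_mid)
      fix p' assume p': "p' \<in> seg s R j"
      show "\<not> prec (R, ?j) p'" using prec_seg[OF p'] by simp
      consider "p' \<in> seg s r (l r - 1)" | "p' = (r, l r)" | i where "p' = (R, i)" "1 \<le> i" "i \<le> j"
        using p'[unfolded seg_R] by fastforce
      then have "?k p' \<noteq> ?k (R, ?j) \<and> (prec p' (R, ?j) \<longrightarrow> ?k p' \<subset> ?k (R, ?j))"
      proof cases
        case 1
        have "f p' \<subset> g ?j" using fA[OF 1] g(2)[OF j] by blast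
        then show ?thesis unfolding filling_mid filling_low[OF 1] by blast
      next
        case 2
        have "Gx \<subset> g ?j" if "prec (r, l r) (R, ?j)"
        proof -
          have "l r \<in> Hi r" using Hi_last[of r] sf(1) by simp
          then have "?j \<notin> Lo R" using that conf_Suc[of "l r" r ?j] by blast
          then have "?j \<notin> {1, 3}" using sf(5) by simp
          then show ?thesis using gx j by blast
        qed
        then show ?thesis using 2 g(3)[OF j] by (simp add: filling_mid)
      next
        case 3
        have "inj_on g {1..4}" using assms unfolding fill_def by blast
        moreover have "i \<in> {1..4}" "i \<noteq> ?j" using 3 Suc.prems by auto
        ultimately have "g i \<noteq> g ?j" using j by (metis inj_onD)
        then show ?thesis using 3 by (simp add: filling_mid not_prec_same)
      qed
      then show "?k p' \<noteq> ?k (R, ?j)" "prec p' (R, ?j) \<Longrightarrow> ?k p' \<subset> ?k (R, ?j)" by auto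
    qed
  qed
  then show ?thesis by simp
qed

lemma filling_cases:
  assumes "p \<in> seg s R 4"
  obtains "filling Gx g p \<subset> A" | "filling Gx g p = Gx" | j where "j \<in> {1..4}" "filling Gx g p = g j"
  using assms[unfolded seg_R] fA filling_low filling_mid by metis

lemma fill_progress:
  assumes "fill Gx g" "A \<subseteq> H" "Gx \<subseteq> H" "Gx \<subset> V'" "\<And>j. j \<in> {1..4} \<Longrightarrow> g j \<subseteq> H \<and> g j \<subset> V'"
  shows "progress F (seg s R 4) {} H V'"
proof -
  have AV: "A \<subseteq> V'"
    using fill_above[OF assms(1), of 1] assms(5)[of 1] by auto
  have "filling Gx g p \<subset> V' \<and> filling Gx g p \<subseteq> H" if "p \<in> seg s R 4" for p
    using that
  proof (cases rule: filling_cases[of p Gx g])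
    case 1
    then show ?thesis using AV assms(2) by blast
  next
    case 2
    then show ?thesis using assms(3,4) by simp
  next
    case (3 j)
    then show ?thesis using assms(5) by simp
  qed
  then show ?thesis unfolding progress_def using place_filling[OF assms(1)] by blast
qed

lemma fill_state:
  assumes "fill Gx g" "Gx \<subseteq> H" "H \<subset> V'" "\<And>j. j \<in> {1..4} \<Longrightarrow> g j \<subseteq> H"
  shows "state F s R 4 0 H V'"
proof -
  have "A \<subseteq> H" using fill_above[OF assms(1), of 1] assms(4)[of 1] by auto
  then have "progress F (seg s R 4) {} H V'"
    using assms(2,3,4) by (intro fill_progress[OF assms(1)]) blast+
  then show ?thesis using s shared_facts[OF sh] by (simp add: state_def exs_def good0)
qed

text \<open>
  The first element of level \<open>R + 1\<close> is unrelated to 3 and 4, so its set \<open>Y\<close> only has to lie above those of 1 and 2.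
\<close>

lemma fill_state_next:
  assumes fl: "fill Gx g" and H: "Gx \<subseteq> H" "H \<subset> V'" "\<And>j. j \<in> {1..4} \<Longrightarrow> g j \<subseteq> H"
    and Y: "Y \<in> F" "Gx \<subset> Y" "A \<subseteq> Y" "g 1 \<subset> Y" "g 2 \<subset> Y" "Y \<noteq> g 3" "Y \<noteq> g 4" "Y \<subset> V'"
  shows "state F s (Suc R) 1 (if Y \<subseteq> H then 0 else 1) H V'"
proof -
  let ?k = "(filling Gx g)(((Suc R, 1)) := Y)" and ?I = "seg s R 4"
  note sf = shared_facts[OF sh]
  have AH: "A \<subseteq> H" using fill_above[OF fl, of 1] H(3)[of 1] by auto
  have pl: "place F (insert (Suc R, 1) ?I) ?k"
  proof (rule place_insert[OF place_filling[OF fl]])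
    show "(Suc R, 1) \<notin> ?I" by (simp add: seg_def)
    have *: "filling Gx g p' \<noteq> Y \<and> (prec p' (Suc R, 1) \<longrightarrow> filling Gx g p' \<subset> Y)" if "p' \<in> ?I" for p'
      using that[unfolded seg_R]
    proof (elim disjE bexE)
      assume "p' \<in> seg s r (l r - 1)"
      then show ?thesis using fA[of p'] Y(3) filling_low[of p'] by auto
    next
      assume "p' = (r, l r)"
      then show ?thesis using Y(2) by (auto simp: filling_mid)
    next
      fix j assume j: "j \<in> {1..4}" "p' = (R, j)"
      then have "j = 1 \<or> j = 2 \<or> j = 3 \<or> j = 4" by auto
      moreover have "\<not> prec (R, j) (Suc R, 1)" if "j = 3 \<or> j = 4"
        using that sf(6,7) conf_Suc[of j R 1] by auto
      ultimately show ?thesis using j(2) Y(4-7) by (auto simp: filling_mid)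
    qed
    show "\<forall>p'\<in>?I. filling Gx g p' \<noteq> Y" using * by blast
    show "\<And>p'. p' \<in> ?I \<Longrightarrow> prec p' (Suc R, 1) \<Longrightarrow> filling Gx g p' \<subset> Y" using * by blast
    show "\<not> prec (Suc R, 1) p'" if "p' \<in> ?I" for p' using prec_seg[OF that] by simp
  qed (use Y in simp)
  have ne: "p \<noteq> (Suc R, 1)" if "p \<in> ?I" for p using that by (auto simp: seg_def)
  have low: "filling Gx g p \<subseteq> H" if "p \<in> ?I" for p
    using that
  proof (cases rule: filling_cases[of p Gx g])
    case 1
    then show ?thesis using AH by blast
  next
    case 2
    then show ?thesis using H by simp
  next
    case (3 j)
    then show ?thesis using H(3) by simp
  qed
  have "progress F (insert (Suc R, 1) ?I) (exs (Suc R) (if Y \<subseteq> H then 0 else 1)) H V'"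
    unfolding progress_def
  proof (intro exI[of _ ?k] conjI pl ballI)
    show "?k p \<subset> V'" if "p \<in> insert (Suc R, 1) ?I" for p
    proof (cases "p = (Suc R, 1)")
      case False
      then have "filling Gx g p \<subseteq> H" using low that by blast
      then show ?thesis using False H(2) by auto
    qed (use Y in simp)
    show "?k p \<subseteq> H" if "p \<in> insert (Suc R, 1) ?I - exs (Suc R) (if Y \<subseteq> H then 0 else 1)" for p
      using that low by (cases "p = (Suc R, 1)") (auto simp: exs_def split: if_splits)
  qed
  moreover have "insert (Suc R, 1) ?I = seg s (Suc R) 1"
    using seg_next1[of s R] s sf(3) by simp
  moreover have "good (Suc R) 1 (if Y \<subseteq> H then 0 else 1)"
    using sf(10) T_Wedge[of "Suc R"] by (auto simp: good_def)
  ultimately show ?thesis using s sf by (simp add: state_def)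
qed

end

context levels begin

text \<open>
  Reasons for which at most \<open>c\<close> further sets of \<open>F\<close> are to be expected on average: because of an ordinary state, because of the
  exceptional configuration below a level that is not shared, or because the levels beyond a shared
  level do not fit above \<open>V\<close> any more.
\<close>

definition value_le :: "'b set set \<Rightarrow> nat \<Rightarrow> 'b set \<Rightarrow> 'b set \<Rightarrow> int \<Rightarrow> bool" where
  "value_le F s U V c \<longleftrightarrow>
     (\<exists>r k e. state F s r k e U V \<and> remaining r k e \<le> c)
   \<or> (\<exists>r. T r = Vee \<and> 1 \<le> s \<and> s \<le> r \<and> \<not> shared (Suc r)
        \<and> progress F (seg s (Suc r) 1) {(r, l r)} U V \<and> remaining (Suc r) 1 0 \<le> c)
   \<or> (\<exists>r. shared (Suc r) \<and> s \<le> r \<and> \<not> Up F (Suc r) V \<and> mu (Suc r) + 1 \<le> c)"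

lemma value_leI:
  "state F s r k e U V \<Longrightarrow> remaining r k e \<le> c \<Longrightarrow> value_le F s U V c"
  "T r = Vee \<Longrightarrow> 1 \<le> s \<Longrightarrow> s \<le> r \<Longrightarrow> \<not> shared (Suc r) \<Longrightarrow>
     progress F (seg s (Suc r) 1) {(r, l r)} U V \<Longrightarrow> remaining (Suc r) 1 0 \<le> c \<Longrightarrow> value_le F s U V c"
  "shared (Suc r) \<Longrightarrow> s \<le> r \<Longrightarrow> \<not> Up F (Suc r) V \<Longrightarrow> mu (Suc r) + 1 \<le> c \<Longrightarrow> value_le F s U V c"
  unfolding value_le_def by blast+

end

section \<open>Running through a window\<close>

context window begin

lemma facts: "T r = Vee" "T R = Wedge" "l R = 4" "zi R = 0" "Lo R = {1, 3}"
    "Hi R = {3, 4}" "Lo (Suc R) = {1}" "1 \<le> r" "R < h" "2 \<le> l (Suc R)" "2 \<le> l r"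
  using shared_facts[OF sh] by auto

lemma start_progress: "progress F (seg s r (l r - 1)) {(r, e)} M A"
  unfolding progress_def using f fA fM by blast

lemma start_none:
  assumes "q \<notin> A"
  shows "state F s r (l r) 0 A (insert q A)"
proof -
  have "progress F (seg s r (l r)) {} A (insert q A)"
    unfolding seg_top
    by (rule progress_A[OF start_progress AF]) (use assms prec_seg facts in \<open>auto simp: seg_def\<close>)
  then show ?thesis using s facts by (simp add: state_def exs_def good0)
qed

lemma start_vee:
  assumes "q \<notin> A" "insert q M \<in> F"
  shows "progress F (seg s R 1) {(r, l r)} A (insert q A)"
proof -
  let ?I = "seg s r (l r - 1)"
  have nin: "(R, 1) \<notin> ?I" "(r, l r) \<notin> ?I" using facts by (auto simp: seg_def)
  have pre: "\<And>p'. p' \<in> ?I \<Longrightarrow> \<not> prec (R, 1) p'" "\<And>p'. p' \<in> ?I \<Longrightarrow> \<not> prec (r, l r) p'"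
    using prec_seg by simp_all
  have c: "\<not> prec (r, l r) (R, 1)" using Hi_last[of r] facts by (intro conf_Suc) auto
  have "progress F (insert (r, l r) (insert (R, 1) ?I)) {(r, l r)} A (insert q A)"
    by (rule progress_AB[OF start_progress AF assms(2) _ _ _ _ nin _ pre c])
       (use assms A in \<open>auto simp: prec_def\<close>)
  moreover have "insert (r, l r) (insert (R, 1) ?I) = seg s R 1"
    using seg_next1[OF s(2)] seg_top by (simp add: insert_commute)
  ultimately show ?thesis by simp
qed

text \<open>
  The chain continues from \<open>A\<close> through \<open>H\<close> to \<open>insert t H\<close>, and \<open>H\<close> is its last set above which the levels beyond the
  shared one fit. The window consists of the sets from \<open>A\<close> to \<open>H\<close> and their partners.
\<close>

context
  fixes ms :: "'b list" and t :: 'b and H :: "'b set"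
  assumes ms: "distinct (ms @ [t])" "set (ms @ [t]) \<inter> A = {}" "H = A \<union> set ms"
    and up: "Up F R H" and nup: "\<not> Up F R (insert t H)"
begin

abbreviation "ys \<equiv> ms @ [t]"

definition cnt :: "nat \<Rightarrow> int" where
  "cnt m = (\<Sum>i=1..m. of_bool (aset A ys i \<in> F) + of_bool (bset A ys i \<in> F))"

text \<open>
  As \<open>A = insert a M\<close>, the set in question is the partner of \<open>A\<close>.
\<close>

definition fb :: int where "fb = of_bool (insert (ys ! 0) M \<in> F)"

text \<open>
  The window may spend \<open>mu R + 5\<close> in all, and \<open>A\<close> itself has been paid already.
\<close>

definition budget :: "nat \<Rightarrow> int" where "budget m = mu R + 4 - fb - cnt m"

text \<open>
  The only beginning of a window that leads to two configurations which are not states: the partner of \<open>A\<close>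
  and the next partner are in \<open>F\<close>, but the next set of the chain is not.
\<close>

definition pattern :: bool where
  "pattern \<longleftrightarrow> fb = 1 \<and> aset A ys 1 \<notin> F \<and> bset A ys 1 \<in> F"

definition run_inv :: "nat \<Rightarrow> bool" where
  "run_inv m \<longleftrightarrow> (\<exists>r' k' e'. state F s r' k' e' (aset A ys m) (aset A ys (Suc m)) \<and> remaining r' k' e' \<le> budget m
        \<and> (r' = r \<and> k' = l r \<or> r' = R))
     \<or> m = 0 \<and> fb = 1 \<and> progress F (seg s R 1) {(r, l r)} (aset A ys m) (aset A ys (Suc m))
     \<or> (pattern \<and> cnt m = 1 \<and> 1 \<le> m \<and> (\<exists>ex. ex \<subseteq> {(R, 3)} \<and> progress F (insert (R, 3) (seg s R 1)) ex (aset A ys m) (aset A ys (Suc m))))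
     \<or> (pattern \<and> cnt m = 2 \<and> 2 \<le> m \<and> aset A ys m \<notin> F \<and> bset A ys m \<in> F
          \<and> progress F (seg s R 3) {(R, 2)} (aset A ys m) (aset A ys (Suc m)))"

lemma aset_step:
  assumes "m \<le> length ms"
  shows "aset A ys (Suc m) = insert (ys ! m) (aset A ys m)" "ys ! m \<notin> aset A ys m"
    "bset A ys (Suc m) = insert (ys ! Suc m) (aset A ys m)"
proof -
  have "take (Suc m) ys = take m ys @ [ys ! m]"
    by (rule take_Suc_conv_app_nth) (use assms in simp)
  then show "aset A ys (Suc m) = insert (ys ! m) (aset A ys m)" by (auto simp: aset_def)
  have "ys ! m \<in> set ys" by (rule nth_mem) (use assms in simp)
  moreover have "ys ! m \<notin> set (take m ys)"
  proof
    assume "ys ! m \<in> set (take m ys)"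
    then obtain i where i: "i < length (take m ys)" "take m ys ! i = ys ! m"
      unfolding in_set_conv_nth by blast
    from i(1) have "i < m" by (simp only: length_take min_less_iff_conj)
    then have "take m ys ! i = ys ! i" by (rule nth_take)
    then have "ys ! i = ys ! m" using i(2) by metis
    moreover have "m < length ys" "i < length ys" using assms \<open>i < m\<close> by auto
    ultimately have "i = m" using nth_eq_iff_index_eq[OF ms(1), of i m] by blast
    then show False using \<open>i < m\<close> by simp
  qed
  ultimately show "ys ! m \<notin> aset A ys m" using ms(2) by (auto simp: aset_def)
  show "bset A ys (Suc m) = insert (ys ! Suc m) (aset A ys m)" by (simp add: bset_def aset_def)
qed

lemma aset0: "aset A ys 0 = A" by (simp add: aset_def)

lemma aset_H: "aset A ys (length ms) = H" "aset A ys (Suc (length ms)) = insert t H"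
  using ms(3) by (auto simp: aset_def)

lemma aset_mono: "m \<le> n \<Longrightarrow> aset A ys m \<subseteq> aset A ys n"
  unfolding aset_def using set_take_subset_set_take[of m n ys] by blast

lemma cnt_Suc: "cnt (Suc m) = cnt m + (of_bool (aset A ys (Suc m) \<in> F) + of_bool (bset A ys (Suc m) \<in> F))"
  by (simp add: cnt_def)

lemma run_inv0: "run_inv 0"
proof -
  have y: "ys ! 0 \<notin> A" using aset_step(2)[of 0] aset0 by simp
  have a1: "aset A ys (Suc 0) = insert (ys ! 0) A" using aset_step(1)[of 0] aset0 by simp
  show ?thesis
  proof (cases "insert (ys ! 0) M \<in> F")
    case True
    then have "fb = 1" by (simp add: fb_def)
    then show ?thesis using start_vee[OF y True] unfolding run_inv_def aset0 a1 by blast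
  next
    case False
    then have "fb = 0" by (simp add: fb_def)
    moreover have "remaining r (l r) 0 = mu R + 4"
      using mu_Suc[of r] facts by (simp add: remaining_def)
    ultimately have "remaining r (l r) 0 \<le> budget 0" by (simp add: budget_def cnt_def)
    then show ?thesis using start_none[OF y] unfolding run_inv_def aset0 a1 by blast
  qed
qed

text \<open>
  A shared level completed below \<open>H\<close> would combine with the levels above \<open>H\<close> to a forbidden copy.
\<close>

lemma complete_below_H:
  assumes "progress F (seg s R (l R)) ex U V" "V \<subseteq> H"
  shows False
  using Up_complete[OF assms(1) Up_mono[OF up assms(2)]] free s facts by simp

text \<open>
  The last alternative is the one where the budget is exceeded. It completes the shared level, which is
  impossible below \<open>H\<close>, so it can only arise at the end of the window.
\<close>

lemma run_inv_step:
  assumes inv: "run_inv m" and m: "m < length ms"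
  defines "U \<equiv> aset A ys (Suc m)" and "V \<equiv> aset A ys (Suc (Suc m))"
  shows "(\<exists>r' k' e'. state F s r' k' e' U V \<and> remaining r' k' e' \<le> budget (Suc m)
        \<and> (r' = r \<and> k' = l r \<or> r' = R \<or> r' = Suc R))
     \<or> (pattern \<and> cnt (Suc m) = 1 \<and> (\<exists>ex. ex \<subseteq> {(R, 3)} \<and> progress F (insert (R, 3) (seg s R 1)) ex U V))
     \<or> (pattern \<and> cnt (Suc m) = 2 \<and> 1 \<le> m \<and> U \<notin> F \<and> bset A ys (Suc m) \<in> F
          \<and> progress F (seg s R 3) {(R, 2)} U V)
     \<or> (pattern \<and> cnt (Suc m) = 4 \<and> 2 \<le> m \<and> aset A ys m \<notin> F \<and> bset A ys m \<in> F
          \<and> U \<in> F \<and> bset A ys (Suc m) \<in> F \<and> progress F (seg s R (l R)) {} U V)"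
proof -
  have U: "U = insert (ys ! m) (aset A ys m)" "ys ! m \<notin> aset A ys m"
    and V: "V = insert (ys ! Suc m) U" "ys ! Suc m \<notin> U"
    and B: "bset A ys (Suc m) = insert (ys ! Suc m) (aset A ys m)"
    using aset_step[of m] aset_step[of "Suc m"] m by (auto simp: U_def V_def)
  have cs: "cnt (Suc m) = cnt m + (of_bool (U \<in> F) + of_bool (bset A ys (Suc m) \<in> F))"
    unfolding U_def by (rule cnt_Suc)
  have bs: "budget (Suc m) = budget m - (of_bool (U \<in> F) + of_bool (bset A ys (Suc m) \<in> F))"
    using cs by (simp add: budget_def)
  note UV = U V(2)
  consider (S) r' k' e' where "state F s r' k' e' (aset A ys m) U" "remaining r' k' e' \<le> budget m"
        "r' = r \<and> k' = l r \<or> r' = R"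
    | (Vs) "m = 0" "fb = 1" "progress F (seg s R 1) {(r, l r)} (aset A ys m) U"
    | (Two) ex where "pattern" "cnt m = 1" "1 \<le> m" "ex \<subseteq> {(R, 3)}" "progress F (insert (R, 3) (seg s R 1)) ex (aset A ys m) U"
    | (Three) "pattern" "cnt m = 2" "2 \<le> m" "aset A ys m \<notin> F" "bset A ys m \<in> F" "progress F (seg s R 3) {(R, 2)} (aset A ys m) U"
    using inv unfolding run_inv_def U_def by blast
  then show ?thesis
  proof cases
    case S
    have nv: "\<not> (T r' = Vee \<and> Suc k' = l r')" using S(3) facts by auto
    obtain r'' k'' e'' where st: "state F s r'' k'' e'' U V"
      and rm: "of_bool (U \<in> F) + of_bool (bset A ys (Suc m) \<in> F) + remaining r'' k'' e'' \<le> remaining r' k' e'"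
      and sh: "r'' = r' \<and> k' \<le> k'' \<and> (k' = l r' \<longrightarrow> e'' = 0) \<or> r'' = Suc r'"
      using state_step[OF S(1) free UV] nv unfolding B V(1) by blast
    have "remaining r'' k'' e'' \<le> budget (Suc m)" using rm S(2) bs by linarith
    moreover have "r'' = r \<and> k'' = l r \<or> r'' = R \<or> r'' = Suc R"
      using S(3) sh st by (auto simp: state_def)
    ultimately show ?thesis using st by blast
  next
    case Vs
    have m1: "aset A ys 1 = U" "bset A ys 1 = bset A ys (Suc m)" using Vs(1) by (simp_all add: U_def)
    have c0: "cnt 0 = 0" by (simp add: cnt_def)
    from vee_step[OF facts(1) s Vs(3) UV]
    consider k' e' where "state F s R k' e' U V" "of_bool (U \<in> F) + of_bool (bset A ys (Suc m) \<in> F) + remaining R k' e' \<le> remaining R 1 0"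
      | "U \<notin> F" "bset A ys (Suc m) \<in> F" "progress F (insert (R, 3) (seg s R 1)) {(R, 3)} U V"
      unfolding B V(1) by blast
    then show ?thesis
    proof cases
      case 1
      have "remaining R 1 0 = mu R + 3" using remaining_shared[OF sh] by simp
      then have "remaining R k' e' \<le> budget (Suc m)" using 1(2) bs Vs c0 by (simp add: budget_def)
      then show ?thesis using 1(1) by blast
    next
      case 2
      then have "pattern" "cnt (Suc m) = 1" using Vs m1 cs c0 by (simp_all add: pattern_def)
      then show ?thesis using 2(3) by blast
    qed
  next
    case Two
    have fb1: "fb = 1" using Two by (simp add: pattern_def)
    from two_step[OF sh s Two(5,4) UV]
    consider k' e' where "state F s R k' e' U V" "of_bool (U \<in> F) + of_bool (bset A ys (Suc m) \<in> F) + remaining R k' e' \<le> mu R + 2"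
      | "U \<notin> F" "bset A ys (Suc m) \<notin> F" "progress F (insert (R, 3) (seg s R 1)) {} U V"
      | "U \<notin> F" "bset A ys (Suc m) \<in> F" "progress F (seg s R 3) {(R, 2)} U V"
      unfolding B V(1) by blast
    then show ?thesis
    proof cases
      case 1
      then have "remaining R k' e' \<le> budget (Suc m)" using bs Two(2) fb1 by (simp add: budget_def)
      then show ?thesis using 1(1) by blast
    next
      case 2
      then have "cnt (Suc m) = 1" using cs Two by simp
      then show ?thesis using 2(3) Two(1) by blast
    next
      case 3
      then have "cnt (Suc m) = 2" using cs Two by simp
      then show ?thesis using 3 Two(1,3) by blast
    qed
  next
    case Three
    have fb1: "fb = 1" using Three by (simp add: pattern_def)
    show ?thesis
    proof (cases "U \<in> F \<and> bset A ys (Suc m) \<in> F")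
      case True
      have "progress F (seg s R (l R)) {} U V"
        unfolding facts(3) seg_numerals(3)
        by (rule progress_A[OF Three(6)]) (use True V prec_seg in \<open>auto simp: seg_def\<close>)
      moreover have "cnt (Suc m) = 4" using cs Three True by simp
      ultimately show ?thesis using True Three by blast
    next
      case False
      obtain k' e' where "state F s R k' e' U V" "of_bool (U \<in> F) + of_bool (bset A ys (Suc m) \<in> F) + remaining R k' e' \<le> mu R + 1"
        using three_step[OF sh s Three(6) UV] False unfolding B V(1) by blast
      moreover from this have "remaining R k' e' \<le> budget (Suc m)" using bs Three(2) fb1 by (simp add: budget_def)
      ultimately show ?thesis by blast
    qed
  qed
qed

lemma run_inv_below:
  assumes "run_inv m" "Suc m < length ms"
  shows "run_inv (Suc m)"
proof -
  have H: "aset A ys (Suc (Suc m)) \<subseteq> H" using aset_mono[of "Suc (Suc m)" "length ms"] aset_H assms by simp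
  let ?U = "aset A ys (Suc m)" and ?V = "aset A ys (Suc (Suc m))"
  have nR: False if "state F s (Suc R) k' e' ?U ?V" for k' e'
  proof -
    have "progress F (seg s (Suc R) k') (exs (Suc R) e') ?U ?V" using that by (simp add: state_def)
    moreover have "seg s R (l R) \<subseteq> seg s (Suc R) k'" using s by (auto simp: seg_def)
    ultimately have "progress F (seg s R (l R)) (exs (Suc R) e') ?U ?V" by (rule progress_subset)
    then show False using H by (rule complete_below_H)
  qed
  have m: "m < length ms" "1 \<le> Suc m" using assms by simp_all
  from run_inv_step[OF assms(1) m(1)]
  consider r' k' e' where "state F s r' k' e' ?U ?V" "remaining r' k' e' \<le> budget (Suc m)"
      "r' = r \<and> k' = l r \<or> r' = R \<or> r' = Suc R"
    | ex where "pattern" "cnt (Suc m) = 1" "ex \<subseteq> {(R, 3)}" "progress F (insert (R, 3) (seg s R 1)) ex ?U ?V"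
    | "pattern" "cnt (Suc m) = 2" "1 \<le> m" "?U \<notin> F" "bset A ys (Suc m) \<in> F" "progress F (seg s R 3) {(R, 2)} ?U ?V"
    | "progress F (seg s R (l R)) {} ?U ?V"
    by blast
  then show ?thesis
  proof cases
    case 1
    then have "r' = r \<and> k' = l r \<or> r' = R" using nR by blast
    then show ?thesis unfolding run_inv_def using 1(1,2) by blast
  next
    case 2
    then show ?thesis unfolding run_inv_def using m(2) by blast
  next
    case 3
    then have "2 \<le> Suc m" by simp
    then show ?thesis unfolding run_inv_def using 3 by blast
  next
    case 4
    then show ?thesis using complete_below_H[OF 4 H] by blast
  qed
qed

lemma run_inv_all: "m < length ms \<or> m = 0 \<Longrightarrow> run_inv m"
proof (induction m)
  case 0
  then show ?case using run_inv0 by simp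
next
  case (Suc m)
  then show ?case using run_inv_below by simp
qed

text \<open>
  What an order of \<open>H - A\<close> must look like if it exceeds its budget.
\<close>

definition trouble :: bool where
  "trouble \<longleftrightarrow> 3 \<le> length ms \<and> insert (ms ! 0) M \<in> F \<and> insert (ms ! 0) A \<notin> F \<and> insert (ms ! 1) A \<in> F
     \<and> H - {ms ! (length ms - 1)} \<notin> F \<and> H - {ms ! (length ms - 2)} \<in> F \<and> H \<in> F
     \<and> insert t (H - {ms ! (length ms - 1)}) \<in> F \<and> fb + cnt (length ms) = 5"

lemma aset_remove:
  assumes "Suc m \<le> length ms"
  shows "aset A ys m = aset A ys (Suc m) - {ys ! m}"
  using aset_step(1,2)[of m] assms by auto

lemma run: "value_le F s H (insert t H) (budget (length ms)) \<or> trouble"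
proof (cases "length ms")
  case 0
  have i: "run_inv 0" by (rule run_inv0)
  have a: "aset A ys 0 = H" "aset A ys (Suc 0) = insert t H" using aset_H 0 by simp_all
  from i consider r' k' e' where "state F s r' k' e' H (insert t H)" "remaining r' k' e' \<le> budget 0"
    | "fb = 1" "progress F (seg s R 1) {(r, l r)} H (insert t H)"
    unfolding run_inv_def a by auto
  then show ?thesis
  proof cases
    case 1
    then show ?thesis using value_leI(1) 0 by auto
  next
    case 2
    have "mu R + 1 \<le> budget 0" using 2 by (simp add: budget_def cnt_def)
    then show ?thesis using value_leI(3)[OF sh s(2) nup] 0 by simp
  qed
next
  case (Suc m)
  have i: "run_inv m" by (rule run_inv_all) (use Suc in auto)
  have m: "m < length ms" using Suc by simp
  have a: "aset A ys (Suc m) = H" "aset A ys (Suc (Suc m)) = insert t H" using aset_H Suc by simp_all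
  from run_inv_step[OF i m]
  consider r' k' e' where "state F s r' k' e' H (insert t H)" "remaining r' k' e' \<le> budget (Suc m)"
    | ex where "pattern" "cnt (Suc m) = 1" "ex \<subseteq> {(R, 3)}" "progress F (insert (R, 3) (seg s R 1)) ex H (insert t H)"
    | "pattern" "cnt (Suc m) = 2" "progress F (seg s R 3) {(R, 2)} H (insert t H)"
    | "pattern" "cnt (Suc m) = 4" "2 \<le> m" "aset A ys m \<notin> F" "bset A ys m \<in> F" "H \<in> F" "bset A ys (Suc m) \<in> F"
    unfolding a by blast
  then show ?thesis
  proof cases
    case 1
    then show ?thesis using value_leI(1) Suc by auto
  next
    case 2
    have "mu R + 1 \<le> budget (Suc m)" using 2 by (simp add: budget_def pattern_def)
    then show ?thesis using value_leI(3)[OF sh s(2) nup] Suc by simp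
  next
    case 3
    have "mu R + 1 \<le> budget (Suc m)" using 3 by (simp add: budget_def pattern_def)
    then show ?thesis using value_leI(3)[OF sh s(2) nup] Suc by simp
  next
    case 4
    have l3: "3 \<le> length ms" using 4 Suc by simp
    have n: "ys ! i = ms ! i" if "i < length ms" for i using that by (simp add: nth_append)
    have y0: "ys ! 0 = ms ! 0" "ys ! 1 = ms ! 1" "ys ! m = ms ! m" "ys ! (m - 1) = ms ! (m - 1)"
      using n[of 0] n[of 1] n[of m] n[of "m - 1"] l3 Suc by auto
    have a1: "aset A ys 1 = insert (ms ! 0) A" "bset A ys 1 = insert (ms ! 1) A"
      using aset_step[of 0] aset0 y0 by simp_all
    have am: "aset A ys m = H - {ms ! m}" using aset_remove[of m] a y0 Suc by simp
    have m1: "Suc (m - 1) = m" "Suc (m - 1) \<le> length ms" using 4(3) m by auto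
    have am1: "aset A ys (m - 1) = aset A ys m - {ys ! (m - 1)}"
      using aset_remove[of "m - 1"] m1 by simp
    have "bset A ys m = insert (ys ! m) (aset A ys (m - 1))"
      using aset_step(3)[of "m - 1"] m1 by simp
    also have "\<dots> = H - {ms ! (m - 1)}"
    proof -
      have "ms ! m \<in> H" using ms(3) nth_mem[OF m] by simp
      moreover have "ms ! m \<noteq> ms ! (m - 1)"
        using ms(1) m m1 nth_eq_iff_index_eq[of ms m "m - 1"] by auto
      ultimately show ?thesis unfolding am1 am y0 by auto
    qed
    finally have bm: "bset A ys m = H - {ms ! (m - 1)}" .
    have bl: "bset A ys (Suc m) = insert t (H - {ms ! m})"
      using aset_step(3)[of m] m am Suc by (simp add: nth_append)
    have "fb = 1" "aset A ys 1 \<notin> F" "bset A ys 1 \<in> F" using 4(1) by (auto simp: pattern_def)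
    then have "trouble" unfolding trouble_def
      using 4 l3 a1 am bm bl y0 Suc by (auto simp: fb_def)
    then show ?thesis ..
  qed
qed

end
end

section \<open>Averaging over the orders of a window\<close>

lemma sum_perm_hd:
  assumes Z: "finite Z" "Z \<noteq> {}"
  shows "(\<Sum>ms\<in>permutations_of_set Z. g (hd ms)) = (\<Sum>y\<in>Z. g y) * (fact (card Z - 1) :: int)"
proof -
  have "(\<Sum>ms\<in>permutations_of_set Z. g (hd ms)) = (\<Sum>y\<in>Z. \<Sum>zs\<in>permutations_of_set (Z - {y}). g (hd (y # zs)))"
    by (rule sum_permutations_step[OF Z(2)])
  also have "\<dots> = (\<Sum>y\<in>Z. g y * fact (card Z - 1))"
    by (rule sum.cong) (use Z in \<open>simp_all add: card_Diff_singleton\<close>)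
  finally show ?thesis by (simp add: sum_distrib_right)
qed

lemma sum_perm_last:
  assumes Z: "finite Z" "Z \<noteq> {}"
  shows "(\<Sum>ms\<in>permutations_of_set Z. g (last ms)) = (\<Sum>y\<in>Z. g y) * (fact (card Z - 1) :: int)"
proof -
  have "(\<Sum>ms\<in>permutations_of_set Z. g (last ms)) = (\<Sum>ms\<in>rev ` permutations_of_set Z. g (last ms))"
    by simp
  also have "\<dots> = (\<Sum>ms\<in>permutations_of_set Z. g (last (rev ms)))"
    by (subst sum.reindex) (auto simp: inj_on_def)
  also have "\<dots> = (\<Sum>ms\<in>permutations_of_set Z. g (hd ms))"
    by (rule sum.cong) (use Z in \<open>auto simp: last_rev permutations_of_set_def\<close>)
  finally show ?thesis using sum_perm_hd[OF Z] by simp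
qed

text \<open>
  A given proper nonempty subset is a prefix of at most one in \<open>k\<close> of the orders of a set of size \<open>k\<close>.
\<close>

lemma fact_mult_le: 
  assumes "1 \<le> i" "i < k"
  shows "(fact i :: int) * fact (k - i) \<le> fact (k - 1)"
proof -
  have "k \<le> k choose i"
  proof -
    show ?thesis using assms
    proof (induction k arbitrary: i)
      case (Suc k)
      show ?case
      proof (cases "i = k")
        case True
        then show ?thesis using Suc.prems by simp
      next
        case False
        then have "i < k" using Suc.prems by simp
        then have "k \<le> k choose i" using Suc by simp
        moreover have "1 \<le> k choose (i - 1)" using \<open>i < k\<close> by (simp add: Suc_le_eq)
        moreover have "Suc k choose i = (k choose (i - 1)) + (k choose i)"
          using Suc.prems(1) by (cases i) auto
        ultimately show ?thesis by simp
      qed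
    qed simp
  qed
  moreover have "fact i * fact (k - i) * (k choose i) = fact k"
    using assms by (simp add: binomial_fact_lemma)
  moreover have "fact k = k * fact (k - 1)" using assms by (cases k) auto
  ultimately have "k * (fact i * fact (k - i)) \<le> k * fact (k - 1)"
    by (metis mult.commute mult_le_mono1)
  then have "fact i * fact (k - i) \<le> (fact (k - 1) :: nat)" using assms by simp
  then have "int (fact i * fact (k - i)) \<le> int (fact (k - 1))" by (simp only: of_nat_le_iff)
  then show ?thesis by simp
qed

context window begin

context
  fixes ms :: "'b list" and t :: 'b and H :: "'b set"
  assumes ms: "distinct (ms @ [t])" "set (ms @ [t]) \<inter> A = {}" "H = A \<union> set ms"
    and up: "Up F R H" and nup: "\<not> Up F R (insert t H)"
begin

text \<open>
  Four members strictly between \<open>A\<close> and \<open>H\<close> could carry the shared level, with \<open>A\<close> carrying \<open>(r, l r)\<close>.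
\<close>

lemma four_between:
  assumes "g ` {1..4::nat} \<subseteq> {G \<in> F. A \<subset> G \<and> G \<subset> H}" "inj_on g {1..4}"
  shows False
proof -
  have g: "g j \<in> F" "A \<subset> g j" "g j \<subset> H" if "j \<in> {1..4}" for j using assms that by blast+
  have fl: "fill A g"
    unfolding fill_def top_of_r_def using AF g[of 2] g[of 4] g assms by auto
  have "progress F (seg s R 4) {} H H"
  proof (rule fill_progress[OF fl])
    show "A \<subseteq> H" "A \<subseteq> H" "A \<subset> H" using g(2)[of 1] g(3)[of 1] by auto
    show "g j \<subseteq> H \<and> g j \<subset> H" if "j \<in> {1..4}" for j using g(3)[OF that] by blast
  qed
  then show False using complete_below_H[OF ms up nup, of "{}" H H] facts by simp
qed

lemma card_between: "card {G \<in> F. A \<subset> G \<and> G \<subset> H} \<le> 3"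
proof (rule ccontr)
  assume "\<not> ?thesis"
  then have "4 \<le> card {G \<in> F. A \<subset> G \<and> G \<subset> H}" by simp
  then obtain T where T: "T \<subseteq> {G \<in> F. A \<subset> G \<and> G \<subset> H}" "card T = 4" "finite T"
    by (rule obtain_subset_with_card_n)
  obtain g where "bij_betw g {1..card T} T" using ex_bij_betw_nat_finite_1[OF T(3)] by blast
  then have g: "g ` {1..4} = T" "inj_on g {1..4}" unfolding T(2) by (simp_all add: bij_betw_def)
  show False by (rule four_between[of g]) (use g T(1) in simp_all)
qed

lemma remaining_next: "remaining (Suc R) 1 e' = mu R - 1"
  using mu_Suc[of R] facts by (simp add: remaining_def)

text \<open>
  The bad order starts with \<open>b, q\<close> and ends with \<open>p, d\<close>, where \<open>p = q\<close> if it has length three. Its members of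
  \<open>F\<close> fill the shared level inside \<open>H\<close>. If one of the denied memberships held, they could be rearranged so
  that a further member carries the first element of level \<open>R + 1\<close>, and this state is worth one less than
  a complete shared level, which is just what the bad order needs.
\<close>

lemma stuck:
  assumes tr: "trouble ms t H" and ns: "\<not> value_le F s H (insert t H) (budget ms t (length ms))"
  obtains b q p d where "{b, q, p, d} \<subseteq> H - A" "b \<noteq> q" "p \<noteq> d" "b \<noteq> p" "q \<noteq> d" "b \<noteq> d"
    "length ms = 3 \<longrightarrow> p = q" "insert b A \<notin> F" "H - {d} \<notin> F" "insert q M \<notin> F" "insert t (H - {p}) \<notin> F"
    "\<not> (insert d A \<in> F \<and> insert d M \<in> F)" "\<not> (H - {b} \<in> F \<and> insert t (H - {b}) \<in> F)"
    "H \<in> F" "state F s R 4 0 H (insert t H)" "3 \<le> length ms"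
proof -
  define k where "k = length ms"
  define b q p d where "b = ms ! 0" and "q = ms ! 1" and "p = ms ! (k - 2)" and "d = ms ! (k - 1)"
  note defs = b_def q_def p_def d_def
  have T: "3 \<le> k" "insert b M \<in> F" "insert b A \<notin> F" "insert q A \<in> F" "H - {d} \<notin> F" "H - {p} \<in> F" "H \<in> F"
     "insert t (H - {d}) \<in> F" "fb ms t + cnt ms t (length ms) = 5"
    using tr unfolding trouble_def[OF ms up nup] defs k_def by auto
  have bud: "budget ms t (length ms) = mu R - 1"
    using T(9) unfolding budget_def[OF ms up nup] by simp
  have dm: "distinct ms" "set ms \<inter> A = {}" "t \<notin> H" using ms by auto
  have mem: "b \<in> set ms" "q \<in> set ms" "p \<in> set ms" "d \<in> set ms"
    unfolding defs using T(1) k_def by (auto intro!: nth_mem)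
  have idx: "ms ! i \<noteq> ms ! j" if "i < length ms" "j < length ms" "i \<noteq> j" for i j
    using nth_eq_iff_index_eq[OF dm(1) that(1,2)] that(3) by blast
  have ne: "b \<noteq> q" "p \<noteq> d" "b \<noteq> p" "q \<noteq> d" "b \<noteq> d"
    unfolding defs by (rule idx; use T(1) k_def in arith)+
  have hA: "b \<in> H" "q \<in> H" "p \<in> H" "d \<in> H" "b \<notin> A" "q \<notin> A" "p \<notin> A" "d \<notin> A"
    using mem dm(2) ms(3) by auto
  have AH: "A \<subseteq> H" "t \<notin> A" using ms by auto
  have aA: "a \<in> A" "M \<subseteq> A" "a \<notin> M" using A by auto
  let ?E1 = "insert q A" and ?E2 = "H - {p}" and ?V = "insert t H"
  have i4: "{1..4::nat} = {1, 2, 3, 4}" by auto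
  have HV: "H \<subset> ?V" using dm(3) by blast
  have next_state: "value_le F s H ?V (mu R - 1)"
    if "fill Gx g" "Gx \<subseteq> H" "\<And>j. j \<in> {1..4} \<Longrightarrow> g j \<subseteq> H" "Y \<in> F" "Gx \<subset> Y" "A \<subseteq> Y" "g 1 \<subset> Y" "g 2 \<subset> Y"
      "Y \<noteq> g 3" "Y \<noteq> g 4" "Y \<subset> ?V" for Gx g Y
    by (rule value_leI(1)[OF fill_state_next[OF that(1,2) HV that(3-)]]) (simp_all only: remaining_next order_refl)
  define ga where "ga = (\<lambda>w x y z (j::nat). if j = 1 then w else if j = 2 then x else if j = 3 then y else (z :: 'b set))"
  have ga: "ga w x y z 1 = w" "ga w x y z 2 = x" "ga w x y z 3 = y" "ga w x y z 4 = z" for w x y z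
    by (simp_all add: ga_def)
  have fillI: "fill Gx (ga w x y z)"
    if "top_of_r Gx" "w \<in> F" "x \<in> F" "y \<in> F" "z \<in> F" "w \<noteq> x" "w \<noteq> y" "w \<noteq> z" "x \<noteq> y" "x \<noteq> z" "y \<noteq> z"
      "A \<subseteq> w" "A \<subseteq> x" "A \<subseteq> y" "A \<subseteq> z" "Gx \<noteq> w" "Gx \<noteq> y" "Gx \<subset> x" "Gx \<subset> z" for Gx w x y z
    unfolding fill_def i4 using that by (auto simp: ga[unfolded One_nat_def] inj_on_def)
  have b2: "fill (insert b M) (ga A ?E2 ?E1 H)"
    by (rule fillI) (use T AF hA AH aA ne in \<open>auto simp: top_of_r_def\<close>)
  have st4: "state F s R 4 0 H ?V"
    by (rule fill_state[OF b2 _ HV]) (use hA AH aA in \<open>auto simp: i4 ga_def\<close>)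
  have n1: "insert q M \<notin> F"
  proof
    assume qM: "insert q M \<in> F"
    have fl: "fill (insert q M) (ga A ?E1 ?E2 H)"
      by (rule fillI) (use T AF qM hA AH aA ne in \<open>auto simp: top_of_r_def\<close>)
    have "value_le F s H ?V (mu R - 1)"
      by (rule next_state[OF fl, of "insert t (H - {d})"])
         (use T hA AH aA ne dm(3) in \<open>auto simp: i4 ga_def\<close>)
    then show False using ns bud by simp
  qed
  have n2: "insert t (H - {p}) \<notin> F"
  proof
    assume "insert t (H - {p}) \<in> F"
    then have "value_le F s H ?V (mu R - 1)"
      by (intro next_state[OF b2, of "insert t (H - {p})"])
         (use T hA AH aA ne dm(3) in \<open>auto simp: i4 ga_def\<close>)
    then show False using ns bud by simp
  qed
  have n3: "\<not> (insert d A \<in> F \<and> insert d M \<in> F)"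
  proof
    assume dA: "insert d A \<in> F \<and> insert d M \<in> F"
    have fl: "fill (insert d M) (ga A (insert d A) ?E1 ?E2)"
      by (rule fillI) (use T AF dA hA AH aA ne in \<open>auto simp: top_of_r_def\<close>)
    have "value_le F s H ?V (mu R - 1)"
      by (rule next_state[OF fl, of H])
         (use T hA AH aA ne dm(3) in \<open>auto simp: i4 ga_def\<close>)
    then show False using ns bud by simp
  qed
  have n4: "\<not> (H - {b} \<in> F \<and> insert t (H - {b}) \<in> F)"
  proof
    assume hb: "H - {b} \<in> F \<and> insert t (H - {b}) \<in> F"
    have fl: "fill A (ga ?E1 (H - {b}) ?E2 H)"
      by (rule fillI) (use T AF hb hA AH aA ne in \<open>auto simp: top_of_r_def\<close>)
    have "value_le F s H ?V (mu R - 1)"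
      by (rule next_state[OF fl, of "insert t (H - {b})"])
         (use T hb hA AH aA ne dm(3) in \<open>auto simp: i4 ga_def\<close>)
    then show False using ns bud by simp
  qed
  have p3: "length ms = 3 \<longrightarrow> p = q" by (simp add: p_def q_def k_def)
  show ?thesis
    by (rule that[of b q p d]) (use hA ne p3 T n1 n2 n3 n4 st4 k_def in auto)
qed

end

text \<open>
  With \<open>k = card Z\<close>, a random order of \<open>Z\<close> meets the partner of \<open>A\<close> with probability at most \<open>1 - 1/k\<close>, because of \<open>q\<close>,
  the partner of \<open>H\<close> likewise because of \<open>p\<close>, and each of the at most three members strictly between \<open>A\<close> and \<open>H\<close>
  with expectation at most \<open>2/k\<close>. Together with \<open>H\<close> this is at most \<open>3 + 4/k\<close>, which is enough for
  \<open>k \<ge> 4\<close>; for \<open>k = 3\<close> the last two conditions on \<open>d\<close> and \<open>b\<close> save the excess of one third.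
\<close>

lemma class_sum:
  assumes Z: "finite Z" "A \<inter> Z = {}" "t \<notin> A \<union> Z" and H: "H = A \<union> Z"
    and bt: "card {G \<in> F. A \<subset> G \<and> G \<subset> H} \<le> 3"
    and w: "{b, q, p, d} \<subseteq> H - A" "b \<noteq> q" "p \<noteq> d" "b \<noteq> p" "q \<noteq> d" "b \<noteq> d"
    "card Z = 3 \<longrightarrow> p = q" "insert b A \<notin> F" "H - {d} \<notin> F" "insert q M \<notin> F" "insert t (H - {p}) \<notin> F"
    "\<not> (insert d A \<in> F \<and> insert d M \<in> F)" "\<not> (H - {b} \<in> F \<and> insert t (H - {b}) \<in> F)" and k3: "3 \<le> card Z"
  shows "(\<Sum>ms\<in>permutations_of_set Z. of_bool (insert ((ms @ [t]) ! 0) M \<in> F)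
      + (\<Sum>i=1..length ms. of_bool (aset A (ms @ [t]) i \<in> F) + of_bool (bset A (ms @ [t]) i \<in> F)))
     \<le> 4 * (fact (card Z) :: int)"
proof -
  define k where "k = card Z"
  define P where "P = permutations_of_set Z"
  have Z0: "Z \<noteq> {}" using k3 by auto
  have len: "length ms = k" "ms \<noteq> []" "distinct ms" "set ms = Z" if "ms \<in> P" for ms
    using that length_finite_permutations_of_set[of ms Z] k3 by (auto simp: P_def k_def permutations_of_set_def)
  define nb nt nF where "nb = card {y \<in> Z. insert y M \<in> F}" and "nt = card {y \<in> Z. insert t (H - {y}) \<in> F}"
    and "nF = card {G \<in> F. A \<subset> G \<and> G \<subset> H}"
  have fin: "finite {G \<in> F. A \<subset> G \<and> G \<subset> H}"
  proof (rule finite_imageD)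
    show "finite ((\<lambda>G. G - A) ` {G \<in> F. A \<subset> G \<and> G \<subset> H})"
      by (rule finite_subset[of _ "Pow Z"]) (use Z H in auto)
    show "inj_on (\<lambda>G. G - A) {G \<in> F. A \<subset> G \<and> G \<subset> H}" by (auto simp: inj_on_def)
  qed
  have s1: "(\<Sum>ms\<in>P. of_bool (insert ((ms @ [t]) ! 0) M \<in> F)) = int nb * fact (k - 1)"
  proof -
    have "(\<Sum>ms\<in>P. of_bool (insert ((ms @ [t]) ! 0) M \<in> F)) = (\<Sum>ms\<in>P. (of_bool (insert (hd ms) M \<in> F) :: int))"
      by (rule sum.cong) (use len in \<open>auto simp: nth_append hd_conv_nth\<close>)
    also have "\<dots> = (\<Sum>y\<in>Z. of_bool (insert y M \<in> F)) * fact (k - 1)"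
      unfolding P_def k_def by (rule sum_perm_hd[OF Z(1) Z0, of "\<lambda>y. of_bool (insert y M \<in> F)"])
    also have "(\<Sum>y\<in>Z. (of_bool (insert y M \<in> F) :: int)) = int nb"
      using Z by (simp add: nb_def of_bool_def sum.If_cases Int_def)
    finally show ?thesis .
  qed
  have s2: "(\<Sum>ms\<in>P. of_bool (bset A (ms @ [t]) k \<in> F)) = int nt * fact (k - 1)"
  proof -
    have "bset A (ms @ [t]) k = insert t (H - {last ms})" if "ms \<in> P" for ms
    proof -
      have "ms = butlast ms @ [last ms]" using len[OF that] by simp
      then have "set (butlast ms) = Z - {last ms}" using len[OF that]
        by (metis Diff_insert_absorb distinct.simps(2) distinct1_rotate list.simps(15) rotate1.simps(2) set_rotate1)
      moreover have "take (k - 1) (ms @ [t]) = butlast ms" using len[OF that] k3 by (simp add: butlast_conv_take)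
      moreover have "last ms \<notin> A" using len[OF that] Z by (metis IntI empty_iff last_in_set)
      ultimately show ?thesis using len[OF that] H by (auto simp: bset_def nth_append)
    qed
    then have "(\<Sum>ms\<in>P. of_bool (bset A (ms @ [t]) k \<in> F)) = (\<Sum>ms\<in>P. (of_bool (insert t (H - {last ms}) \<in> F) :: int))"
      by (intro sum.cong) auto
    also have "\<dots> = (\<Sum>y\<in>Z. of_bool (insert t (H - {y}) \<in> F)) * fact (k - 1)"
      unfolding P_def k_def by (rule sum_perm_last[OF Z(1) Z0, of "\<lambda>y. of_bool (insert t (H - {y}) \<in> F)"])
    also have "(\<Sum>y\<in>Z. (of_bool (insert t (H - {y}) \<in> F) :: int)) = int nt"
      using Z by (simp add: nt_def of_bool_def sum.If_cases Int_def)
    finally show ?thesis .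
  qed
  define c where "c = (\<lambda>i. card {G \<in> F. A \<subseteq> G \<and> G \<subseteq> A \<union> Z \<and> card (G - A) = i})"
  have s3: "(\<Sum>ms\<in>P. of_bool (aset A (ms @ [t]) i \<in> F) + of_bool (bset A (ms @ [t]) i \<in> F)) \<le> 2 * int (c i) * fact (k - 1)"
    if i: "1 \<le> i" "i < k" for i
  proof -
    have "(\<Sum>ms\<in>P. of_bool (aset A (ms @ [t]) i \<in> F)) = (\<Sum>ms\<in>P. (of_bool (aset A ms i \<in> F) :: int))"
      by (rule sum.cong) (use len i in \<open>auto simp: aset_def\<close>)
    also have "\<dots> = int (c i) * (fact i * fact (k - i))"
      unfolding P_def c_def k_def by (rule sum_aset) (use Z i k_def in auto)
    finally have a: "(\<Sum>ms\<in>P. of_bool (aset A (ms @ [t]) i \<in> F)) = int (c i) * (fact i * fact (k - i))" .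
    have "(\<Sum>ms\<in>P. of_bool (bset A (ms @ [t]) i \<in> F)) = (\<Sum>ms\<in>P. (of_bool (bset A ms i \<in> F) :: int))"
      by (rule sum.cong) (use len i in \<open>auto simp: bset_def nth_append\<close>)
    also have "\<dots> = int (c i) * (fact i * fact (k - i))"
      unfolding P_def c_def k_def by (rule sum_bset) (use Z i k_def in auto)
    finally have b: "(\<Sum>ms\<in>P. of_bool (bset A (ms @ [t]) i \<in> F)) = int (c i) * (fact i * fact (k - i))" .
    have "int (c i) * (fact i * fact (k - i)) \<le> int (c i) * fact (k - 1)"
      using fact_mult_le[OF i] by (intro mult_left_mono) auto
    moreover have "2 * int (c i) * fact (k - 1) = 2 * (int (c i) * fact (k - 1))" by simp
    ultimately show ?thesis using a b by (simp only: sum.distrib)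
  qed
  have s4: "(\<Sum>i=1..<k. c i) \<le> nF"
  proof -
    have "(\<Sum>i=1..<k. c i) = card (\<Union>i\<in>{1..<k}. {G \<in> F. A \<subseteq> G \<and> G \<subseteq> A \<union> Z \<and> card (G - A) = i})"
      unfolding c_def
    proof (rule card_UN_disjoint[symmetric])
      show "\<forall>i\<in>{1..<k}. finite {G \<in> F. A \<subseteq> G \<and> G \<subseteq> A \<union> Z \<and> card (G - A) = i}"
      proof
        fix i assume "i \<in> {1..<k}"
        then have "{G \<in> F. A \<subseteq> G \<and> G \<subseteq> A \<union> Z \<and> card (G - A) = i} \<subseteq> {G \<in> F. A \<subset> G \<and> G \<subset> H}"
          using H Z k_def by (auto simp: Un_Diff Diff_triv Int_commute)
        then show "finite {G \<in> F. A \<subseteq> G \<and> G \<subseteq> A \<union> Z \<and> card (G - A) = i}" using fin by (rule finite_subset)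
      qed
    qed auto
    also have "\<dots> \<le> nF" unfolding nF_def
      by (rule card_mono[OF fin]) (use H Z k_def in \<open>auto simp: Un_Diff Diff_triv Int_commute\<close>)
    finally show ?thesis .
  qed
  have k1: "{1..k} = insert k {1..<k}" using k3 k_def by auto
  have "(\<Sum>ms\<in>P. of_bool (insert ((ms @ [t]) ! 0) M \<in> F)
      + (\<Sum>i=1..length ms. of_bool (aset A (ms @ [t]) i \<in> F) + of_bool (bset A (ms @ [t]) i \<in> F)))
    = (\<Sum>ms\<in>P. of_bool (insert ((ms @ [t]) ! 0) M \<in> F)
      + (\<Sum>i=1..k. of_bool (aset A (ms @ [t]) i \<in> F) + of_bool (bset A (ms @ [t]) i \<in> F)))"
    by (rule sum.cong) (use len in auto)
  also have "\<dots> = int nb * fact (k - 1)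
      + (\<Sum>i=1..k. \<Sum>ms\<in>P. of_bool (aset A (ms @ [t]) i \<in> F) + of_bool (bset A (ms @ [t]) i \<in> F))"
    by (simp only: sum.distrib[of _ _ P] s1 sum.swap[of _ _ P])
  also have "(\<Sum>i=1..k. \<Sum>ms\<in>P. of_bool (aset A (ms @ [t]) i \<in> F) + of_bool (bset A (ms @ [t]) i \<in> F))
     = (\<Sum>ms\<in>P. of_bool (aset A (ms @ [t]) k \<in> F)) + int nt * fact (k - 1)
       + (\<Sum>i=1..<k. \<Sum>ms\<in>P. of_bool (aset A (ms @ [t]) i \<in> F) + of_bool (bset A (ms @ [t]) i \<in> F))"
    unfolding k1 by (simp add: sum.distrib s2)
  also have "(\<Sum>ms\<in>P. (of_bool (aset A (ms @ [t]) k \<in> F) :: int)) \<le> (\<Sum>ms\<in>P. 1)"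
    by (rule sum_mono) simp
  also have "(\<Sum>ms\<in>P. (1::int)) = fact k" using Z by (simp add: P_def k_def)
  also have "(\<Sum>i=1..<k. \<Sum>ms\<in>P. of_bool (aset A (ms @ [t]) i \<in> F) + of_bool (bset A (ms @ [t]) i \<in> F))
     \<le> (\<Sum>i=1..<k. 2 * int (c i) * fact (k - 1))"
    by (rule sum_mono) (use s3 in auto)
  also have "(\<Sum>i=1..<k. 2 * int (c i) * fact (k - 1)) = 2 * int (\<Sum>i=1..<k. c i) * fact (k - 1)"
    by (simp add: sum_distrib_right sum_distrib_left)
  also have "\<dots> \<le> 2 * int nF * fact (k - 1)"
    by (intro mult_right_mono mult_left_mono of_nat_mono s4) auto
  finally have le: "(\<Sum>ms\<in>P. of_bool (insert ((ms @ [t]) ! 0) M \<in> F)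
      + (\<Sum>i=1..length ms. of_bool (aset A (ms @ [t]) i \<in> F) + of_bool (bset A (ms @ [t]) i \<in> F)))
      \<le> int nb * fact (k - 1) + (fact k + int nt * fact (k - 1) + 2 * int nF * fact (k - 1))"
    by (simp add: algebra_simps)
  have zs: "b \<in> Z" "q \<in> Z" "p \<in> Z" "d \<in> Z" using w(1) H by auto
  have nb1: "nb \<le> k - 1"
  proof -
    have "{y \<in> Z. insert y M \<in> F} \<subseteq> Z - {q}" using w by auto
    then have "nb \<le> card (Z - {q})" unfolding nb_def using Z by (intro card_mono) auto
    then show ?thesis using zs by (simp add: k_def)
  qed
  have nt1: "nt \<le> k - 1"
  proof -
    have "{y \<in> Z. insert t (H - {y}) \<in> F} \<subseteq> Z - {p}" using w by auto
    then have "nt \<le> card (Z - {p})" unfolding nt_def using Z by (intro card_mono) auto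
    then show ?thesis using zs by (simp add: k_def)
  qed
  have nF3: "nF \<le> 3" using bt by (simp add: nF_def)
  \<comment> \<open>The contribution of \<open>H\<close> itself is at most one, so three are left for the others.\<close>
  have "nb + nt + 2 * nF \<le> 3 * k"
  proof (cases "k = 3")
    case False
    then have "4 \<le> k" using k3 k_def by simp
    then show ?thesis using nb1 nt1 nF3 by linarith
  next
    case True
    have pq: "p = q" using w(7) True k_def by simp
    have "card {b, q, d} = card Z" using w True k_def by simp
    then have Zeq: "Z = {b, q, d}" using zs card_subset_eq[OF Z(1), of "{b, q, d}"] by auto
    show ?thesis
    proof (cases "nF = 3")
      case False
      then show ?thesis using nb1 nt1 nF3 True by linarith
    next
      case nF: True
      \<comment> \<open>Of the six sets strictly between \<open>A\<close> and \<open>H\<close>, two are not in \<open>F\<close>; three members thus include one of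
        \<open>insert d A\<close> and \<open>H - {b}\<close>.\<close>
      have sub: "{G \<in> F. A \<subset> G \<and> G \<subset> H} \<subseteq> {insert q A, insert d A, H - {q}, H - {b}}"
      proof
        fix G assume "G \<in> {G \<in> F. A \<subset> G \<and> G \<subset> H}"
        then have G: "G \<in> F" "A \<subset> G" "G \<subset> H" by auto
        have GA: "G = A \<union> (G \<inter> {b, q, d})" using G H Zeq by auto
        have "G \<inter> {b, q, d} \<noteq> {}" using GA G(2) by auto
        moreover have "\<not> {b, q, d} \<subseteq> G" using G H Zeq by auto
        moreover have "H = A \<union> {b, q, d}" using H Zeq by simp
        moreover have "b \<notin> A" "q \<notin> A" "d \<notin> A" using w(1) by auto
        moreover have "G \<noteq> insert b A" "G \<noteq> H - {d}" using w G by auto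
        ultimately show "G \<in> {insert q A, insert d A, H - {q}, H - {b}}"
          using GA w(2,4,5,6) by (cases "b \<in> G"; cases "q \<in> G"; cases "d \<in> G") auto
      qed
      have nin: "insert d A \<in> F \<or> H - {b} \<in> F"
      proof (rule ccontr)
        assume "\<not> ?thesis"
        then have "{G \<in> F. A \<subset> G \<and> G \<subset> H} \<subseteq> {insert q A, H - {q}}" using sub by blast
        then have "nF \<le> card {insert q A, H - {q}}" unfolding nF_def by (intro card_mono) auto
        also have "\<dots> \<le> 2" by (simp add: card_insert_if)
        finally show False using nF by simp
      qed
      have b1: "nb \<le> 2" and t1: "nt \<le> 2" using nb1 nt1 True by auto
      have "nb + nt \<le> 3"
      proof (cases "insert d A \<in> F")
        case True
        then have "{y \<in> Z. insert y M \<in> F} \<subseteq> {b}" using w Zeq by auto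
        then have "nb \<le> card {b}" unfolding nb_def by (intro card_mono) auto
        then show ?thesis using t1 by simp
      next
        case False
        then have "{y \<in> Z. insert t (H - {y}) \<in> F} \<subseteq> {d}" using w Zeq nin pq by auto
        then have "nt \<le> card {d}" unfolding nt_def by (intro card_mono) auto
        then show ?thesis using b1 by simp
      qed
      then show ?thesis using nF True by simp
    qed
  qed
  then have "int nb + int nt + 2 * int nF \<le> 3 * int k" by linarith
  then have "(int nb + int nt + 2 * int nF) * fact (k - 1) \<le> 3 * int k * fact (k - 1)"
    by (intro mult_right_mono) auto
  moreover have "(fact k :: int) = int k * fact (k - 1)" using k3 k_def by (simp add: fact_reduce)
  ultimately show ?thesis using le unfolding P_def k_def[symmetric] by (simp add: algebra_simps)
qed

end

text \<open>
  Each permutation is cut at the first entry \<open>t\<close> whose arrival destroys \<open>Q\<close>. The order of the entries before it is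
  then free, and so is the order of those after it.
\<close>

lemma sum_permutations_threshold:
  assumes X: "finite X" and Q0: "Q {}" and QX: "\<not> Q X"
    and mono: "\<And>S S'. S \<subseteq> S' \<Longrightarrow> S' \<subseteq> X \<Longrightarrow> Q S' \<Longrightarrow> Q S"
  shows "(\<Sum>ys\<in>permutations_of_set X. g ys)
    = (\<Sum>(Z, t)\<in>{(Z, t). Z \<subseteq> X \<and> t \<in> X - Z \<and> Q Z \<and> \<not> Q (insert t Z)}.
        \<Sum>ms\<in>permutations_of_set Z. \<Sum>zs\<in>permutations_of_set (X - Z - {t}). g (ms @ t # zs))"
proof -
  let ?VP = "{(Z, t). Z \<subseteq> X \<and> t \<in> X - Z \<and> Q Z \<and> \<not> Q (insert t Z)}"
  let ?D = "Sigma ?VP (\<lambda>(Z, t). permutations_of_set Z \<times> permutations_of_set (X - Z - {t}))"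
  let ?j = "\<lambda>((Z, t), (ms, zs)). ms @ t # zs"
  have finVP: "finite ?VP" by (rule finite_subset[of _ "Pow X \<times> X"]) (use X in auto)
  have bij: "bij_betw ?j ?D (permutations_of_set X)"
    unfolding bij_betw_def
  proof
    show "inj_on ?j ?D"
    proof (rule inj_onI)
      fix p p' assume p: "p \<in> ?D" "p' \<in> ?D" "?j p = ?j p'"
      obtain Z t ms zs where P: "p = ((Z, t), (ms, zs))" by (metis surj_pair)
      obtain Z' t' ms' zs' where P': "p' = ((Z', t'), (ms', zs'))" by (metis surj_pair)
      have 1: "Z \<subseteq> X" "Q Z" "\<not> Q (insert t Z)" "set ms = Z" "t \<in> X" using p(1) P by (auto simp: permutations_of_set_def)
      have 2: "Z' \<subseteq> X" "Q Z'" "\<not> Q (insert t' Z')" "set ms' = Z'" "t' \<in> X" using p(2) P' by (auto simp: permutations_of_set_def)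
      have eq: "ms @ t # zs = ms' @ t' # zs'" using p(3) P P' by simp
      have "length ms = length ms'"
      proof (rule ccontr)
        assume "length ms \<noteq> length ms'"
        then consider "length ms < length ms'" | "length ms' < length ms" by linarith
        then show False
        proof cases
          case less: 1
          have "take (Suc (length ms)) (ms' @ t' # zs') = ms @ [t]" unfolding eq[symmetric] by simp
          then have "ms @ [t] = take (Suc (length ms)) ms'" using less by simp
          then have "set (ms @ [t]) \<subseteq> set ms'" by (metis set_take_subset)
          then have "insert t Z \<subseteq> Z'" using 1 2 by simp
          then show False using mono[of "insert t Z" Z'] 1 2 by simp
        next
          case less: 2
          have "take (Suc (length ms')) (ms @ t # zs) = ms' @ [t']" unfolding eq by simp
          then have "ms' @ [t'] = take (Suc (length ms')) ms" using less by simp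
          then have "set (ms' @ [t']) \<subseteq> set ms" by (metis set_take_subset)
          then have "insert t' Z' \<subseteq> Z" using 1 2 by simp
          then show False using mono[of "insert t' Z'" Z] 1 2 by simp
        qed
      qed
      then have "ms = ms'" "t = t'" "zs = zs'" using eq by auto
      then show "p = p'" using P P' 1 2 by simp
    qed
    show "?j ` ?D = permutations_of_set X"
    proof
      show "?j ` ?D \<subseteq> permutations_of_set X" by (auto simp: permutations_of_set_def)
      show "permutations_of_set X \<subseteq> ?j ` ?D"
      proof
        fix ys assume ys: "ys \<in> permutations_of_set X"
        then have d: "distinct ys" "set ys = X" by (auto simp: permutations_of_set_def)
        define k where "k = (LEAST k. \<not> Q (set (take (Suc k) ys)))"
        have ex: "\<not> Q (set (take (Suc (length ys)) ys))" using QX d by simp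
        have k: "\<not> Q (set (take (Suc k) ys))" unfolding k_def by (rule LeastI[of _ "length ys"]) (rule ex)
        have Qk: "Q (set (take k ys))"
        proof (cases k)
          case 0
          then show ?thesis using Q0 by simp
        next
          case (Suc j)
          then show ?thesis using not_less_Least[of j "\<lambda>k. \<not> Q (set (take (Suc k) ys))"] k_def by auto
        qed
        have kl: "k < length ys" using k Qk by (metis not_less take_all le_SucI)
        have split: "ys = take k ys @ ys ! k # drop (Suc k) ys" by (rule id_take_nth_drop[OF kl])
        let ?Z = "set (take k ys)" and ?t = "ys ! k"
        have "distinct (take k ys @ ys ! k # drop (Suc k) ys)" using d(1) split by simp
        then have dd: "?t \<notin> ?Z" "distinct (take k ys)" "distinct (drop (Suc k) ys)"
          "set (drop (Suc k) ys) \<inter> insert ?t ?Z = {}" by auto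
        have "X = ?Z \<union> insert ?t (set (drop (Suc k) ys))" using d(2) split
          by (metis list.simps(15) set_append)
        then have X': "set (drop (Suc k) ys) = X - ?Z - {?t}" "?Z \<subseteq> X" "?t \<in> X" using dd by auto
        have "insert ?t ?Z = set (take (Suc k) ys)" using kl by (simp add: take_Suc_conv_app_nth)
        then have "((?Z, ?t), (take k ys, drop (Suc k) ys)) \<in> ?D"
          using k Qk X' dd by (auto simp: permutations_of_set_def)
        moreover have "?j ((?Z, ?t), (take k ys, drop (Suc k) ys)) = ys" using split by simp
        ultimately show "ys \<in> ?j ` ?D" by (metis (no_types, lifting) imageI)
      qed
    qed
  qed
  have "(\<Sum>ys\<in>permutations_of_set X. g ys) = (\<Sum>p\<in>?D. g (?j p))"
    by (rule sum.reindex_bij_betw[OF bij, symmetric])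
  also have "\<dots> = (\<Sum>(Zt, mz)\<in>?D. g (?j (Zt, mz)))" by (rule sum.cong) (simp_all only: case_prod_unfold prod.collapse)
  also have "\<dots> = (\<Sum>Zt\<in>?VP. \<Sum>mz\<in>(case Zt of (Z, t) \<Rightarrow> permutations_of_set Z \<times> permutations_of_set (X - Z - {t})). g (?j (Zt, mz)))"
    by (rule sum.Sigma[symmetric]) (use finVP in auto)
  also have "\<dots> = (\<Sum>(Z, t)\<in>?VP. \<Sum>ms\<in>permutations_of_set Z. \<Sum>zs\<in>permutations_of_set (X - Z - {t}). g (ms @ t # zs))"
    by (rule sum.cong) (simp_all add: sum.cartesian_product case_prod_unfold)
  finally show ?thesis .
qed

context window begin

text \<open>
  Consider together all permutations with the same \<open>H = A \<union> Z\<close> and the same next entry \<open>t\<close>. Either each order of \<open>Z\<close>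
  keeps its budget, or one is in trouble without remedy; in the latter case the shared level is complete at \<open>H\<close> for
  all orders of \<open>Z\<close>, since this concerns only the family and \<open>H\<close>, and their average keeps the budget.
\<close>

lemma window_total:
  assumes X: "finite X" "A \<inter> X = {}" and upA: "Up F R A" and FX: "\<And>G. G \<in> F \<Longrightarrow> G \<subseteq> A \<union> X"
    and IH: "\<And>Z t c. Z \<subseteq> X \<Longrightarrow> t \<in> X - Z \<Longrightarrow> value_le F s (A \<union> Z) (insert t (A \<union> Z)) c \<Longrightarrow>
      (\<Sum>zs\<in>permutations_of_set (X - Z - {t}). chain_count F (A \<union> Z) (t # zs)) \<le> c * fact (card (X - Z - {t}))"
  shows "(\<Sum>ys\<in>permutations_of_set X. chain_count F M (a # ys)) \<le> (mu R + 5) * fact (card X)"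
proof -
  let ?C = "mu R + 5"
  have mu0: "0 \<le> mu R" using mu_nonneg facts by simp
  \<comment> \<open>Level \<open>R + 1\<close> has two elements, but \<open>F\<close> has at most one member above \<open>A \<union> X\<close>.\<close>
  have two: "\<not> Up F R (A \<union> X)"
  proof
    assume "Up F R (A \<union> X)"
    then obtain g where g: "place {G \<in> F. A \<union> X \<subseteq> G} (elems (Suc R)) g" by (auto simp: Up_def embeds_def)
    have m: "(Suc R, 1) \<in> elems (Suc R)" "(Suc R, 2) \<in> elems (Suc R)" using facts by (auto simp: elems_def)
    have "g p = A \<union> X" if "p \<in> elems (Suc R)" for p
      using g that FX[of "g p"] by (auto simp: place_def)
    then have "g (Suc R, 1) = g (Suc R, 2)" using m by simp
    moreover have "inj_on g (elems (Suc R))" using g by (simp add: place_def)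
    ultimately show False using m by (auto dest: inj_onD)
  qed
  define VP where "VP = {(Z, t). Z \<subseteq> X \<and> t \<in> X - Z \<and> Up F R (A \<union> Z) \<and> \<not> Up F R (A \<union> insert t Z)}"
  define g where "g = (\<lambda>ys. chain_count F M (a # ys) - ?C)"
  have dec: "(\<Sum>ys\<in>permutations_of_set X. g ys)
    = (\<Sum>(Z, t)\<in>VP. \<Sum>ms\<in>permutations_of_set Z. \<Sum>zs\<in>permutations_of_set (X - Z - {t}). g (ms @ t # zs))"
    unfolding VP_def
    by (rule sum_permutations_threshold[where Q = "\<lambda>Z. Up F R (A \<union> Z)", OF X(1)])
       (use upA two Up_mono in \<open>auto intro: Up_mono\<close>)
  have block: "(\<Sum>ms\<in>permutations_of_set Z. \<Sum>zs\<in>permutations_of_set (X - Z - {t}). g (ms @ t # zs)) \<le> 0"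
    if Zt: "(Z, t) \<in> VP" for Z t
  proof -
    let ?H = "A \<union> Z" and ?Y = "X - Z - {t}"
    let ?n = "fact (card ?Y) :: int"
    have Z: "Z \<subseteq> X" "t \<in> X - Z" "Up F R ?H" "\<not> Up F R (insert t ?H)" using Zt by (auto simp: VP_def)
    have fZ: "finite Z" "finite ?Y" using Z X finite_subset by auto
    define b where "b = (\<lambda>ms. of_bool (insert ((ms @ [t]) ! 0) M \<in> F)
      + (\<Sum>i=1..length ms. of_bool (aset A (ms @ [t]) i \<in> F) + of_bool (bset A (ms @ [t]) i \<in> F)) :: int)"
    have split: "chain_count F M (a # ms @ t # zs) = 1 + b ms + chain_count F ?H (t # zs)" if "ms \<in> permutations_of_set Z" for ms zs
    proof -
      have "set ms = Z" using that by (auto simp: permutations_of_set_def)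
      moreover have "(case ms @ t # zs of [] \<Rightarrow> 0 | q # _ \<Rightarrow> of_bool (insert q M \<in> F)) = (of_bool (insert ((ms @ [t]) ! 0) M \<in> F) :: int)"
        by (cases ms) auto
      ultimately show ?thesis using A AF by (simp add: chain_count_append b_def)
    qed
    have inner: "(\<Sum>zs\<in>permutations_of_set ?Y. g (ms @ t # zs)) \<le> (1 + b ms + c - ?C) * ?n"
      if "ms \<in> permutations_of_set Z" "value_le F s ?H (insert t ?H) c" for ms c
    proof -
      have "(\<Sum>zs\<in>permutations_of_set ?Y. g (ms @ t # zs)) = (\<Sum>zs\<in>permutations_of_set ?Y. (1 + b ms - ?C) + chain_count F ?H (t # zs))"
        by (rule sum.cong) (simp_all add: g_def split[OF that(1)] del: chain_count.simps)
      also have "\<dots> = (1 + b ms - ?C) * ?n + (\<Sum>zs\<in>permutations_of_set ?Y. chain_count F ?H (t # zs))"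
        using fZ by (simp add: sum.distrib)
      also have "\<dots> \<le> (1 + b ms - ?C) * ?n + c * ?n"
        using IH[OF Z(1,2) that(2)] by simp
      finally show ?thesis by (simp add: algebra_simps)
    qed
    show ?thesis
    proof (cases "\<forall>ms\<in>permutations_of_set Z. value_le F s ?H (insert t ?H) (mu R + 4 - b ms)")
      case True
      show ?thesis
      proof (rule sum_nonpos)
        fix ms assume ms: "ms \<in> permutations_of_set Z"
        show "(\<Sum>zs\<in>permutations_of_set ?Y. g (ms @ t # zs)) \<le> 0"
          using inner[OF ms bspec[OF True ms]] by simp
      qed
    next
      case False
      then obtain ms where ms: "ms \<in> permutations_of_set Z" "\<not> value_le F s ?H (insert t ?H) (mu R + 4 - b ms)" by blast
      have c1: "distinct (ms @ [t])" "set (ms @ [t]) \<inter> A = {}" "?H = A \<union> set ms"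
        using ms(1) Z X by (auto simp: permutations_of_set_def)
      note ctx = c1 Z(3,4)
      have len: "length ms = card Z" using ms(1) by (rule length_finite_permutations_of_set)
      have bud: "budget ms t (length ms) = mu R + 4 - b ms"
        unfolding budget_def[OF ctx] b_def fb_def[OF ctx] cnt_def[OF ctx] by simp
      then have ns: "\<not> value_le F s ?H (insert t ?H) (budget ms t (length ms))" using ms(2) by simp
      then have tr: "trouble ms t ?H" using run[OF ctx] by blast
      obtain b' q p d where w: "{b', q, p, d} \<subseteq> ?H - A" "b' \<noteq> q" "p \<noteq> d" "b' \<noteq> p" "q \<noteq> d" "b' \<noteq> d"
        "length ms = 3 \<longrightarrow> p = q" "insert b' A \<notin> F" "?H - {d} \<notin> F" "insert q M \<notin> F" "insert t (?H - {p}) \<notin> F"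
        "\<not> (insert d A \<in> F \<and> insert d M \<in> F)" "\<not> (?H - {b'} \<in> F \<and> insert t (?H - {b'}) \<in> F)"
        "?H \<in> F" "state F s R 4 0 ?H (insert t ?H)" "3 \<le> length ms"
        by (rule stuck[OF ctx tr ns])
      have AZ: "A \<inter> Z = {}" "t \<notin> A \<union> Z" using X Z by auto
      have sum: "(\<Sum>ms\<in>permutations_of_set Z. b ms) \<le> 4 * fact (card Z)"
        unfolding b_def
        by (rule class_sum[OF fZ(1) AZ refl card_between[OF ctx] w(1-6) _ w(8-13)])
           (use w(7,16) len in auto)
      have "remaining R 4 0 \<le> mu R" using remaining_shared[OF sh] by simp
      then have st: "value_le F s ?H (insert t ?H) (mu R)" using value_leI(1)[OF w(15)] by blast
      have "(\<Sum>ms\<in>permutations_of_set Z. \<Sum>zs\<in>permutations_of_set ?Y. g (ms @ t # zs))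
          \<le> (\<Sum>ms\<in>permutations_of_set Z. (1 + b ms + mu R - ?C) * ?n)"
        by (rule sum_mono) (rule inner[OF _ st])
      also have "\<dots> = ((\<Sum>ms\<in>permutations_of_set Z. b ms) - 4 * fact (card Z)) * ?n"
        using fZ by (simp add: sum_distrib_right[symmetric] sum_subtractf)
      also have "\<dots> \<le> 0" using sum by (simp add: mult_nonpos_nonneg)
      finally show ?thesis .
    qed
  qed
  have "(\<Sum>ys\<in>permutations_of_set X. g ys) \<le> 0"
    unfolding dec by (rule sum_nonpos) (use block in auto)
  then show ?thesis using X by (simp add: g_def sum_subtractf algebra_simps)
qed

end

section \<open>The value of a configuration\<close>

context levels begin

lemma remaining_nonneg:
  assumes "state F s r k e U V" "\<not> embeds F (elems s)"
  shows "0 \<le> remaining r k e"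
proof (cases "r < h")
  case True
  then show ?thesis using mu_nonneg[of r] zi_nonneg[of r] by (auto simp: remaining_def)
next
  case False
  then have r: "r = h" "s \<le> h" "k \<le> l h" using assms by (auto simp: state_def)
  have "k \<noteq> l h"
    using assms progress_embeds[of F "seg s h (l h)"] r elems_eq_seg[of s] by (auto simp: state_def)
  then show ?thesis using r mu_h zi_nonneg[of h] by (auto simp: remaining_def)
qed

lemma value_le_nonneg:
  assumes "value_le F s U V c" "\<not> embeds F (elems s)"
  shows "0 \<le> c"
  using assms(1) unfolding value_le_def
proof (elim disjE exE conjE)
  fix r k e assume "state F s r k e U V" "remaining r k e \<le> c"
  then show ?thesis using remaining_nonneg[OF _ assms(2)] by force
next
  fix r assume r: "T r = Vee" "remaining (Suc r) 1 0 \<le> c"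
  then have "3 \<le> l (Suc r)" "r < h" using T_Vee T_range[of r] by auto
  then have "0 \<le> remaining (Suc r) 1 0"
    using zi_nonneg[of "Suc r"] mu_nonneg[of "Suc r"] mu_h by (cases "Suc r = h") (auto simp: remaining_def)
  then show ?thesis using r by simp
next
  fix r assume r: "shared (Suc r)" "mu (Suc r) + 1 \<le> c"
  then show ?thesis using shared_facts(9) mu_nonneg[of "Suc r"] by force
qed

text \<open>
  The two situations that are not treated by a single step: a window opens, or the levels beyond a shared level have
  ceased to fit.
\<close>

definition window_case :: "'b set set \<Rightarrow> nat \<Rightarrow> 'b set \<Rightarrow> 'b set \<Rightarrow> int \<Rightarrow> bool" where
  "window_case F s U V c \<longleftrightarrow> (\<exists>r e. state F s r (l r - 1) e U V \<and> e \<noteq> 0 \<and> remaining r (l r - 1) e \<le> c \<and> shared (Suc r)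
     \<and> V \<in> F \<and> Up F (Suc r) V)"

definition tail_case :: "'b set set \<Rightarrow> nat \<Rightarrow> 'b set \<Rightarrow> int \<Rightarrow> bool" where
  "tail_case F s V c \<longleftrightarrow> (\<exists>r. shared (Suc r) \<and> s \<le> r \<and> \<not> Up F (Suc r) V \<and> mu (Suc r) + 1 \<le> c)"

lemma value_le_step:
  assumes val: "value_le F s U V c" and free: "\<not> embeds F (elems s)"
    and V: "V = insert y U" "y \<notin> U" "q \<notin> V"
    and nw: "\<not> window_case F s U V c" and nt: "\<not> tail_case F s V c"
  shows "value_le F s V (insert q V) (c - (of_bool (V \<in> F) + of_bool (insert q U \<in> F)))"
proof -
  let ?V = "insert q V" and ?ab = "of_bool (V \<in> F) + of_bool (insert q U \<in> F) :: int"
  have mono: "\<not> Up F R V \<Longrightarrow> \<not> Up F R ?V" for R using Up_mono[of F R ?V V] by blast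
  from val show ?thesis unfolding value_le_def[of F s U V c]
  proof (elim disjE exE conjE)
    fix r k e assume st: "state F s r k e U V" and c: "remaining r k e \<le> c"
    from state_step[OF st free V]
    consider r' k' e' where "state F s r' k' e' V ?V" "?ab + remaining r' k' e' \<le> remaining r k e"
      | "V \<in> F" "insert q U \<in> F" "T r = Vee" "Suc k = l r" "e \<noteq> 0" "progress F (seg s (Suc r) 1) {(r, l r)} V ?V"
      by blast
    then show ?thesis
    proof cases
      case 1
      then show ?thesis using c by (intro value_leI(1)[OF 1(1)]) linarith
    next
      case 2
      have s: "1 \<le> s" "s \<le> r" using st by (auto simp: state_def)
      have k: "k = l r - 1" using 2(4) by simp
      have l3: "3 \<le> l (Suc r)" "r < h" using T_Vee 2(3) T_range[of r] by auto
      have "remaining (Suc r) 1 0 + 2 \<le> remaining r k e"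
        using mu_Suc[OF l3(2)] l3 k 2(4) zi_nonneg[of r] by (auto simp: remaining_def)
      then have "remaining (Suc r) 1 0 \<le> c - ?ab" using c 2 by simp
      moreover have "mu (Suc r) + 1 \<le> remaining (Suc r) 1 0" "\<not> Up F (Suc r) V" if sh: "shared (Suc r)"
      proof -
        show "mu (Suc r) + 1 \<le> remaining (Suc r) 1 0" using remaining_shared[OF sh] by simp
        show "\<not> Up F (Suc r) V" using nw st c 2 k sh unfolding window_case_def by blast
      qed
      ultimately show ?thesis using mono value_leI(2)[OF 2(3) s _ 2(6)] s(2) value_leI(3)[of r s F ?V] order_trans by meson
    qed
  next
    fix r assume r: "T r = Vee" "1 \<le> s" "s \<le> r" "\<not> shared (Suc r)"
      "progress F (seg s (Suc r) 1) {(r, l r)} U V" "remaining (Suc r) 1 0 \<le> c"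
    obtain k' e' where "state F s (Suc r) k' e' V ?V" "?ab + remaining (Suc r) k' e' \<le> remaining (Suc r) 1 0"
      using vee_step[OF r(1,2,3,5) V] r(4) by blast
    then show ?thesis using r(6) value_leI(1) by force
  next
    fix r assume r: "shared (Suc r)" "s \<le> r" "\<not> Up F (Suc r) V" "mu (Suc r) + 1 \<le> c"
    have False using nt r unfolding tail_case_def by blast
    then show ?thesis ..
  qed
qed

text \<open>
  The claim that values bound averages, for the poset formed by the levels from \<open>s\<close> upwards.
\<close>

definition value_ok :: "nat \<Rightarrow> bool" where
  "value_ok s \<longleftrightarrow> (\<forall>F U V y X c. (\<not> embeds F (elems s) \<and> finite X \<and> finite V \<and> V \<inter> X = {} \<and> V = insert (y :: nat) U
     \<and> y \<notin> U \<and> (\<forall>G\<in>F. G \<subseteq> V \<union> X) \<and> value_le F s U V c) \<longrightarrow>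
       (\<Sum>ys\<in>permutations_of_set X. chain_count F U (y # ys)) \<le> c * fact (card X))"

text \<open>
  Before the first element is placed, the bound is the number of elements minus one plus the number of boundaries without
  a triple.
\<close>

lemma scratch_bound:
  fixes F :: "nat set set"
  assumes val: "value_ok s" and s: "1 \<le> s" "s \<le> h" and free: "\<not> embeds F (elems s)"
    and X: "finite X" "finite V" "V \<inter> X = {}" and FX: "\<And>G. G \<in> F \<Longrightarrow> G \<subseteq> V \<union> X"
  shows "(\<Sum>ys\<in>permutations_of_set X. of_bool (V \<in> F) + chain_count F V ys) \<le> mu (s - 1) * fact (card X)"
proof -
  define k :: nat where "k = of_bool (V \<in> F)"
  have mus: "mu (s - 1) = int (l s) + zi s + mu s" using mu_Suc[of "s - 1"] s by simp
  have ls: "1 \<le> l s" using l_pos s by simp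
  have mu1: "-1 \<le> mu s" using mu_h mu_nonneg[of s] s by (cases "s = h") auto
  have pl: "place F (seg s s k) (\<lambda>_. V)"
    by (auto simp: place_def k_def seg_def inj_on_def prec_def of_bool_def split: if_splits)
  have pr: "progress F (seg s s k) {} V V'" if "V \<subset> V'" for V'
    unfolding progress_def using pl that by blast
  have st: "state F s s k 0 V V'" if "V \<subset> V'" for V'
    using pr[OF that] s ls good0 by (auto simp: state_def exs_def k_def)
  have rk: "int k + remaining s k 0 \<le> mu (s - 1)"
    using mus ls zi_nonneg[of s] by (auto simp: k_def remaining_def of_bool_def)
  show ?thesis
  proof (cases "X = {}")
    case True
    \<comment> \<open>The chain ends at \<open>V\<close>; states need a next set, so one is made up.\<close>
    obtain q where "q \<notin> V" using ex_new_if_finite[OF infinite_UNIV_nat X(2)] by blast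
    then have "V \<subset> insert q V" by blast
    then have "0 \<le> remaining s k 0" using remaining_nonneg[OF st free] by blast
    then show ?thesis using True rk by (simp add: k_def)
  next
    case False
    let ?n = "fact (card X - 1) :: int"
    have "(\<Sum>ys\<in>permutations_of_set X. of_bool (V \<in> F) + chain_count F V ys)
      = (\<Sum>q\<in>X. \<Sum>zs\<in>permutations_of_set (X - {q}). of_bool (V \<in> F) + chain_count F V (q # zs))"
      by (rule sum_permutations_step[OF False])
    also have "\<dots> \<le> (\<Sum>q\<in>X. mu (s - 1) * ?n)"
    proof (rule sum_mono)
      fix q assume q: "q \<in> X"
      have cq: "card (X - {q}) = card X - 1" using q by (simp add: card_Diff_singleton)
      have qV: "q \<notin> V" "V \<subset> insert q V" using q X by auto
      have "value_le F s V (insert q V) (remaining s k 0)" using value_leI(1)[OF st[OF qV(2)]] by simp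
      then have "(\<Sum>zs\<in>permutations_of_set (X - {q}). chain_count F V (q # zs)) \<le> remaining s k 0 * fact (card (X - {q}))"
        by (intro val[unfolded value_ok_def, rule_format, of F "X - {q}" "insert q V"]) (use free X qV FX q in auto)
      then have "(\<Sum>zs\<in>permutations_of_set (X - {q}). of_bool (V \<in> F) + chain_count F V (q # zs)) \<le> (int k + remaining s k 0) * ?n"
        using X unfolding cq by (simp add: sum.distrib cq k_def distrib_right del: chain_count.simps)
      also have "\<dots> \<le> mu (s - 1) * ?n" using rk by (rule mult_right_mono) simp
      finally show "(\<Sum>zs\<in>permutations_of_set (X - {q}). of_bool (V \<in> F) + chain_count F V (q # zs)) \<le> mu (s - 1) * ?n" .
    qed
    also have "\<dots> = mu (s - 1) * fact (card X)"
      using False X by (simp add: fact_reduce card_gt_0_iff)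
    finally show ?thesis .
  qed
qed

text \<open>
  The members of \<open>F\<close> above \<open>V\<close> contain no copy of the levels beyond \<open>R\<close>, so the chain can be restarted at \<open>V\<close> with
  these levels only. The one set that this does not count is the partner of \<open>V\<close>.
\<close>

lemma tail_bound:
  fixes F :: "nat set set"
  assumes val: "value_ok (Suc R)" and R: "R < h" and nup: "\<not> Up F R V"
    and X: "finite X" "finite V" "V \<inter> X = {}" "V = insert y U" "y \<notin> U" and FX: "\<And>G. G \<in> F \<Longrightarrow> G \<subseteq> V \<union> X"
  shows "(\<Sum>ys\<in>permutations_of_set X. chain_count F U (y # ys)) \<le> (mu R + 1) * fact (card X)"
proof -
  let ?F = "{G \<in> F. V \<subseteq> G}"
  have same: "chain_count F W ys = chain_count ?F W ys" if "V \<subseteq> W" for W ys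
    using that
  proof (induction ys arbitrary: W)
    case (Cons z zs)
    have "V \<subseteq> insert z W" using Cons.prems by blast
    then show ?case using Cons.IH[of "insert z W"] Cons.prems by (auto split: list.splits)
  qed simp
  have "(\<Sum>ys\<in>permutations_of_set X. chain_count F U (y # ys))
      \<le> (\<Sum>ys\<in>permutations_of_set X. 1 + (of_bool (V \<in> ?F) + chain_count ?F V ys))"
  proof (rule sum_mono)
    fix ys
    show "chain_count F U (y # ys) \<le> 1 + (of_bool (V \<in> ?F) + chain_count ?F V ys)"
      using same[of V ys] X(4) by (auto split: list.splits)
  qed
  also have "\<dots> = fact (card X) + (\<Sum>ys\<in>permutations_of_set X. of_bool (V \<in> ?F) + chain_count ?F V ys)"
    using X by (simp add: sum.distrib)
  also have "(\<Sum>ys\<in>permutations_of_set X. of_bool (V \<in> ?F) + chain_count ?F V ys) \<le> mu (Suc R - 1) * fact (card X)"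
    by (rule scratch_bound[OF val]) (use R nup X FX in \<open>auto simp: Up_def\<close>)
  finally show ?thesis by (simp add: algebra_simps)
qed

text \<open>
  Induction along the chain: an ordinary step lowers the value by what it counts, a window is
  handled as a whole and a tail by the claim for fewer levels.
\<close>

lemma value_step:
  fixes F :: "nat set set"
  assumes tails: "\<And>s'. s < s' \<Longrightarrow> s' \<le> h \<Longrightarrow> value_ok s'"
    and free: "\<not> embeds F (elems s)" and val: "value_le F s U V c" and s: "s \<le> h"
    and X: "finite X" "finite V" "V \<inter> X = {}" "V = insert y U" "y \<notin> U" and FX: "\<And>G. G \<in> F \<Longrightarrow> G \<subseteq> V \<union> X"
  shows "(\<Sum>ys\<in>permutations_of_set X. chain_count F U (y # ys)) \<le> c * fact (card X)"
  using X val FX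
proof (induction "card X" arbitrary: X U V y c rule: less_induct)
  case less
  note X = less.prems(1-5) and val = less.prems(6) and FX = less.prems(7)
  consider (W) "window_case F s U V c" | (Tl) "tail_case F s V c" | (N) "\<not> window_case F s U V c" "\<not> tail_case F s V c" by blast
  then show ?case
  proof cases
    case W
    then obtain r e where st: "state F s r (l r - 1) e U V" and e: "e \<noteq> 0" "remaining r (l r - 1) e \<le> c"
      and sh: "shared (Suc r)" and V: "V \<in> F" and up: "Up F (Suc r) V" unfolding window_case_def by blast
    have ex: "exs r e = {(r, e)}" using e by (simp add: exs_def)
    obtain f where f: "place F (seg s r (l r - 1)) f" "\<And>p. p \<in> seg s r (l r - 1) \<Longrightarrow> f p \<subset> V"
      "\<And>p. p \<in> seg s r (l r - 1) \<Longrightarrow> p \<noteq> (r, e) \<Longrightarrow> f p \<subseteq> U"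
      using st unfolding state_def progress_def ex by blast
    have sr: "1 \<le> s" "s \<le> r" using st by (auto simp: state_def)
    have win: "window h l T F s r f e U V y"
      by unfold_locales (use sh sr f X V free in auto)
    have "(\<Sum>ys\<in>permutations_of_set X. chain_count F U (y # ys)) \<le> (mu (Suc r) + 5) * fact (card X)"
    proof (rule window.window_total[OF win X(1) X(3) up FX])
      fix Z t c' assume Z: "Z \<subseteq> X" "t \<in> X - Z" and st': "value_le F s (V \<union> Z) (insert t (V \<union> Z)) c'"
      have "card (X - Z - {t}) < card X" using Z X(1) by (intro psubset_card_mono) auto
      moreover have "finite (X - Z - {t})" "finite (insert t (V \<union> Z))" using X Z finite_subset by auto
      ultimately show "(\<Sum>zs\<in>permutations_of_set (X - Z - {t}). chain_count F (V \<union> Z) (t # zs)) \<le> c' * fact (card (X - Z - {t}))"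
        using X Z FX by (intro less.hyps[OF _ _ _ _ _ _ st']) auto
    qed
    also have "\<dots> \<le> c * fact (card X)"
    proof -
      have "remaining r (l r - 1) e = mu r + 1"
        using shared_facts[OF sh] by (auto simp: remaining_def zi_def)
      moreover have "mu r = mu (Suc r) + 4" using mu_Suc[of r] shared_facts[OF sh] by simp
      ultimately show ?thesis using e by (intro mult_right_mono) auto
    qed
    finally show ?thesis .
  next
    case Tl
    then obtain r where r: "shared (Suc r)" "\<not> Up F (Suc r) V" "mu (Suc r) + 1 \<le> c" "s \<le> r" unfolding tail_case_def by blast
    have rh: "Suc r < h" using shared_facts(9)[OF r(1)] .
    have "(\<Sum>ys\<in>permutations_of_set X. chain_count F U (y # ys)) \<le> (mu (Suc r) + 1) * fact (card X)"
        by (rule tail_bound[OF tails rh r(2) X FX]) (use r(4) rh in auto)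
      also have "\<dots> \<le> c * fact (card X)" using r by (intro mult_right_mono) auto
    finally show ?thesis .
  next
    case N
    have step: "value_le F s V (insert q V) (c - (of_bool (V \<in> F) + of_bool (insert q U \<in> F)))" if "q \<notin> V" for q
      by (rule value_le_step[OF val free X(4,5) that N])
    show ?thesis
    proof (cases "X = {}")
      case True
      \<comment> \<open>A fictitious next entry shows that the last set does not exceed the value.\<close>
      obtain q where "q \<notin> V" using ex_new_if_finite[OF infinite_UNIV_nat X(2)] by blast
      then have "0 \<le> c - (of_bool (V \<in> F) + of_bool (insert q U \<in> F))" using value_le_nonneg[OF step free] by blast
      then have "of_bool (V \<in> F) \<le> c" by (simp add: of_bool_def split: if_splits)
      then show ?thesis using True X(4) by simp
    next
      case False
      let ?n = "fact (card X - 1) :: int"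
      have "(\<Sum>ys\<in>permutations_of_set X. chain_count F U (y # ys))
        = (\<Sum>q\<in>X. \<Sum>zs\<in>permutations_of_set (X - {q}). chain_count F U (y # q # zs))"
        by (rule sum_permutations_step[OF False])
      also have "\<dots> \<le> (\<Sum>q\<in>X. c * ?n)"
      proof (rule sum_mono)
        fix q assume q: "q \<in> X"
        let ?ab = "of_bool (V \<in> F) + of_bool (insert q U \<in> F) :: int"
        have cq: "card (X - {q}) = card X - 1" "card (X - {q}) < card X"
          using q card_Diff1_less[OF X(1) q] by (simp_all only: card_Diff_singleton)
        have qV: "q \<notin> V" using q X by auto
        have "(\<Sum>zs\<in>permutations_of_set (X - {q}). chain_count F V (q # zs)) \<le> (c - ?ab) * fact (card (X - {q}))"
          by (rule less.hyps[OF cq(2) _ _ _ _ _ step[OF qV]]) (use X q FX qV in auto)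
        moreover have "(\<Sum>zs\<in>permutations_of_set (X - {q}). chain_count F U (y # q # zs))
            = (\<Sum>zs\<in>permutations_of_set (X - {q}). ?ab + chain_count F V (q # zs))"
          by (rule sum.cong) (simp_all add: X(4))
        moreover have "\<dots> = ?ab * fact (card (X - {q})) + (\<Sum>zs\<in>permutations_of_set (X - {q}). chain_count F V (q # zs))"
          using X(1) by (simp add: sum.distrib del: chain_count.simps)
        ultimately show "(\<Sum>zs\<in>permutations_of_set (X - {q}). chain_count F U (y # q # zs)) \<le> c * ?n"
          unfolding cq(1) by (simp add: left_diff_distrib del: chain_count.simps)
      qed
      also have "\<dots> = c * fact (card X)"
        using False X(1) by (simp add: fact_reduce card_gt_0_iff)
      finally show ?thesis .
    qed
  qed
qed

lemma value_ok_all: "s \<le> h \<Longrightarrow> value_ok s"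
proof (induction "h - s" arbitrary: s rule: less_induct)
  case less
  have tails: "value_ok s'" if "s < s'" "s' \<le> h" for s'
    using less.hyps[of s'] that by simp
  show ?case
    unfolding value_ok_def
  proof (intro allI impI, elim conjE)
    fix F :: "nat set set" and U V :: "nat set" and y X c
    assume "\<not> embeds F (elems s)" "finite X" "finite V" "V \<inter> X = {}" "V = insert y U" "y \<notin> U"
      "\<forall>G\<in>F. G \<subseteq> V \<union> X" "value_le F s U V c"
    then show "(\<Sum>ys\<in>permutations_of_set X. chain_count F U (y # ys)) \<le> c * fact (card X)"
      using value_step[OF tails _ _ less.prems, of F U V c X y] by blast
  qed
qed

lemma average_bound:
  fixes F :: "nat set set"
  assumes "\<not> embeds F (elems 1)" "1 \<le> h" "finite X" "F \<subseteq> Pow X"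
  shows "(\<Sum>ys\<in>permutations_of_set X. of_bool ({} \<in> F) + chain_count F {} ys) \<le> mu 0 * fact (card X)"
proof -
  have "G \<subseteq> {} \<union> X" if "G \<in> F" for G using that assms(4) by blast
  then show ?thesis
    using scratch_bound[OF value_ok_all[OF assms(2)] order_refl assms(2,1,3), of "{}"] by simp
qed

end

section \<open>From double chains to the size of a family\<close>

lemma central_binomial_ge_2:
  assumes "2 \<le> n"
  shows "2 \<le> n choose (n div 2)"
proof -
  have "n choose 1 \<le> n choose (n div 2)" by (rule binomial_maximum)
  then show ?thesis using assms by simp
qed

lemma chain_count_permutation:
  assumes ys: "ys \<in> permutations_of_set X" and n: "card X = n" "2 \<le> n"
  shows "chain_count F {} ys = (\<Sum>m=1..n-1. of_bool (aset {} ys m \<in> F) + of_bool (bset {} ys m \<in> F)) + of_bool (X \<in> F)"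
proof -
  have ys': "set ys = X" "length ys = n"
    using permutations_of_setD[OF ys] distinct_card[of ys] n by auto
  then obtain xs t where xs: "ys = xs @ [t]" using n by (cases ys rule: rev_cases) auto
  then have "length xs = n - 1" "insert t (set xs) = X" using ys' by auto
  then show ?thesis using chain_count_append[of F "{}" xs t "[]"] xs by simp
qed

text \<open>
  A set of size \<open>m\<close> with \<open>0 < m < n\<close> is met as \<open>aset\<close> by \<open>fact n / (n choose m)\<close> permutations and by as many as
  \<open>bset\<close>, and \<open>n choose m\<close> is at most the central coefficient. The empty and the full set are counted
  only once, but by all permutations, and the central coefficient is at least 2.
\<close>

lemma card_bound_from_average:
  fixes F :: "'b set set" and c :: int
  assumes n: "card X = n" "2 \<le> n" and F: "F \<subseteq> Pow X"
    and avg: "(\<Sum>ys\<in>permutations_of_set X. of_bool ({} \<in> F) + chain_count F {} ys) \<le> c * fact n"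
  shows "2 * int (card F) \<le> c * int (n choose (n div 2))"
proof -
  define N where "N m = card {G \<in> F. card G = m}" for m
  let ?C = "int (n choose (n div 2))"
  have X: "finite X" using n card.infinite by fastforce
  have finF: "finite F" using F X finite_subset by blast
  have N0: "N 0 = of_bool ({} \<in> F)"
  proof -
    have "{G \<in> F. card G = 0} = (if {} \<in> F then {{}} else {})"
      using F X finite_subset[of _ X] by (auto simp: card_eq_0_iff)
    then show ?thesis by (simp add: N_def)
  qed
  have Nn: "N n = of_bool (X \<in> F)"
  proof -
    have "{G \<in> F. card G = n} = F \<inter> {X}"
    proof (intro equalityI subsetI)
      fix G assume "G \<in> {G \<in> F. card G = n}"
      then have G: "G \<in> F" "card G = card X" by (simp_all add: n(1))
      then have "G \<subseteq> X" using F by blast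
      then have "G = X" by (rule card_subset_eq[OF X _ G(2)])
      then show "G \<in> F \<inter> {X}" using G by simp
    next
      fix G assume "G \<in> F \<inter> {X}"
      then have "G \<in> F" "G = X" by blast+
      then show "G \<in> {G \<in> F. card G = n}" using n(1) by simp
    qed
    then show ?thesis by (simp add: N_def)
  qed
  have cardF: "card F = (\<Sum>m\<le>n. N m)"
  proof -
    have "card G \<le> n" if "G \<in> F" for G using that F card_mono[OF X, of G] n by blast
    then have "F = (\<Union>m\<in>{..n}. {G \<in> F. card G = m})" by auto
    also have "card \<dots> = (\<Sum>m\<in>{..n}. card {G \<in> F. card G = m})"
      by (rule card_UN_disjoint) (use finF in auto)
    finally show ?thesis by (simp add: N_def)
  qed
  have split: "(\<Sum>m\<le>n. g m) = g 0 + (\<Sum>m=1..n-1. g m) + g n" for g :: "nat \<Rightarrow> int"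
  proof -
    have "{..n} = insert 0 (insert n {1..n-1})" using n by auto
    then show ?thesis using n by (simp add: algebra_simps)
  qed
  have mid: "(\<Sum>ys\<in>permutations_of_set X. of_bool (aset {} ys m \<in> F)) = int (N m) * (fact m * fact (n - m))"
    "(\<Sum>ys\<in>permutations_of_set X. of_bool (bset {} ys m \<in> F)) = int (N m) * (fact m * fact (n - m))"
    if "m \<in> {1..n-1}" for m
  proof -
    have "{G \<in> F. {} \<subseteq> G \<and> G \<subseteq> {} \<union> X \<and> card (G - {}) = m} = {G \<in> F. card G = m}" using F by auto
    then show "(\<Sum>ys\<in>permutations_of_set X. of_bool (aset {} ys m \<in> F)) = int (N m) * (fact m * fact (n - m))"
      "(\<Sum>ys\<in>permutations_of_set X. of_bool (bset {} ys m \<in> F)) = int (N m) * (fact m * fact (n - m))"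
      using sum_aset[OF X, of "{}" m F] sum_bset[OF X, of "{}" m F] that n by (auto simp: N_def)
  qed
  have "(\<Sum>ys\<in>permutations_of_set X. of_bool ({} \<in> F) + chain_count F {} ys)
    = (\<Sum>ys\<in>permutations_of_set X. int (N 0) + (\<Sum>m=1..n-1. of_bool (aset {} ys m \<in> F) + of_bool (bset {} ys m \<in> F)) + int (N n))"
    by (rule sum.cong) (simp_all add: chain_count_permutation[OF _ n] N0 Nn)
  also have "\<dots> = fact n * int (N 0) + (\<Sum>m=1..n-1. 2 * (int (N m) * (fact m * fact (n - m)))) + fact n * int (N n)"
  proof -
    have "(\<Sum>ys\<in>permutations_of_set X. \<Sum>m=1..n-1. of_bool (aset {} ys m \<in> F) + of_bool (bset {} ys m \<in> F))
      = (\<Sum>m=1..n-1. \<Sum>ys\<in>permutations_of_set X. of_bool (aset {} ys m \<in> F) + of_bool (bset {} ys m \<in> F) :: int)"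
      by (rule sum.swap)
    also have "\<dots> = (\<Sum>m=1..n-1. 2 * (int (N m) * (fact m * fact (n - m))))"
      by (rule sum.cong[OF refl]) (simp only: sum.distrib mid mult_2)
    finally show ?thesis using X n by (simp add: sum.distrib)
  qed
  finally have total: "fact n * int (N 0) + (\<Sum>m=1..n-1. 2 * (int (N m) * (fact m * fact (n - m)))) + fact n * int (N n)
      \<le> c * fact n" using avg by simp
  have C2: "2 \<le> ?C" using central_binomial_ge_2[OF n(2)] by linarith
  have ends: "fact n * int k * ?C \<ge> 2 * fact n * int k" for k
    using mult_left_mono[OF C2, of "fact n * int k"] by (simp add: algebra_simps)
  have layer: "2 * (int (N m) * (fact m * fact (n - m))) * ?C \<ge> 2 * fact n * int (N m)" if "m \<in> {1..n-1}" for m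
  proof -
    have "fact n = fact m * fact (n - m) * int (n choose m)"
      using binomial_fact_lemma[of m n] that n by (metis atLeastAtMost_iff diff_le_self le_trans of_nat_fact of_nat_mult)
    also have "\<dots> \<le> fact m * fact (n - m) * ?C"
      by (intro mult_left_mono) (use binomial_maximum[of n m] in \<open>simp_all\<close>)
    finally have "2 * int (N m) * fact n \<le> 2 * int (N m) * (fact m * fact (n - m) * ?C)"
      by (intro mult_left_mono) auto
    then show ?thesis by (simp add: algebra_simps)
  qed
  have "2 * fact n * int (card F) = 2 * fact n * int (N 0) + (\<Sum>m=1..n-1. 2 * fact n * int (N m)) + 2 * fact n * int (N n)"
    unfolding cardF using split[of "\<lambda>m. int (N m)"] by (simp add: sum_distrib_left algebra_simps)
  also have "\<dots> \<le> fact n * int (N 0) * ?C + (\<Sum>m=1..n-1. 2 * (int (N m) * (fact m * fact (n - m))) * ?C) + fact n * int (N n) * ?C"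
    by (intro add_mono ends sum_mono layer)
  also have "\<dots> = (fact n * int (N 0) + (\<Sum>m=1..n-1. 2 * (int (N m) * (fact m * fact (n - m)))) + fact n * int (N n)) * ?C"
    by (simp add: distrib_right sum_distrib_right)
  also have "\<dots> \<le> c * fact n * ?C" by (intro mult_right_mono total) simp
  finally have "fact n * (2 * int (card F)) \<le> fact n * (c * ?C)" by (simp add: algebra_simps)
  then show ?thesis by (simp add: mult_le_cancel_left)
qed

lemma (in levels) family_bound:
  fixes F :: "nat set set"
  assumes "1 \<le> h" "2 \<le> n" "F \<subseteq> Pow {1..n}" "\<not> embeds F (elems 1)"
  shows "2 * int (card F) \<le> mu 0 * int (n choose (n div 2))"
  by (rule card_bound_from_average[of "{1..n}"])
    (use assms average_bound[OF assms(4,1) _ assms(3)] in auto)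

section \<open>Levels of graded posets\<close>

text \<open>
  The four cells into which the two subsets cut each side have equal sizes.
\<close>

lemma ex_bij_two_subsets:
  assumes "finite A" "finite B" "card A = card B"
    and "X \<subseteq> A" "Y \<subseteq> A" "X' \<subseteq> B" "Y' \<subseteq> B"
    and "card X = card X'" "card Y = card Y'" "card (X \<inter> Y) = card (X' \<inter> Y')"
  shows "\<exists>g. bij_betw g A B \<and> g ` X = X' \<and> g ` Y = Y'"
proof -
  have fin: "finite X" "finite Y" "finite X'" "finite Y'" using assms finite_subset by blast+
  have cXY: "card (X - Y) = card (X' - Y')" "card (Y - X) = card (Y' - X')"
    using assms fin by (simp_all add: card_Diff_subset_Int Int_commute)
  have "card (X \<union> Y) = card (X' \<union> Y')"
    using card_Un_Int[OF fin(1,2)] card_Un_Int[OF fin(3,4)] assms by linarith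
  then have cR: "card (A - (X \<union> Y)) = card (B - (X' \<union> Y'))"
    using assms fin by (simp add: card_Diff_subset)
  obtain f1 where f1: "bij_betw f1 (X \<inter> Y) (X' \<inter> Y')"
    using finite_same_card_bij[of "X \<inter> Y" "X' \<inter> Y'"] fin assms by auto
  obtain f2 where f2: "bij_betw f2 (X - Y) (X' - Y')"
    using finite_same_card_bij[of "X - Y" "X' - Y'"] fin cXY by auto
  obtain f3 where f3: "bij_betw f3 (Y - X) (Y' - X')"
    using finite_same_card_bij[of "Y - X" "Y' - X'"] fin cXY by auto
  obtain f4 where f4: "bij_betw f4 (A - (X \<union> Y)) (B - (X' \<union> Y'))"
    using finite_same_card_bij[of "A - (X \<union> Y)" "B - (X' \<union> Y')"] assms cR by auto
  define g where "g x = (if x \<in> X then if x \<in> Y then f1 x else f2 x else if x \<in> Y then f3 x else f4 x)" for x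
  have b: "bij_betw g (X \<inter> Y) (X' \<inter> Y')" "bij_betw g (X - Y) (X' - Y')"
    "bij_betw g (Y - X) (Y' - X')" "bij_betw g (A - (X \<union> Y)) (B - (X' \<union> Y'))"
    using bij_betw_cong[of "X \<inter> Y" g f1] bij_betw_cong[of "X - Y" g f2]
      bij_betw_cong[of "Y - X" g f3] bij_betw_cong[of "A - (X \<union> Y)" g f4] f1 f2 f3 f4
    by (auto simp: g_def)
  have bX: "bij_betw g ((X \<inter> Y) \<union> (X - Y)) ((X' \<inter> Y') \<union> (X' - Y'))"
    by (rule bij_betw_combine[OF b(1,2)]) auto
  have bXY: "bij_betw g (((X \<inter> Y) \<union> (X - Y)) \<union> (Y - X)) (((X' \<inter> Y') \<union> (X' - Y')) \<union> (Y' - X'))"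
    by (rule bij_betw_combine[OF bX b(3)]) auto
  have "bij_betw g ((((X \<inter> Y) \<union> (X - Y)) \<union> (Y - X)) \<union> (A - (X \<union> Y)))
      ((((X' \<inter> Y') \<union> (X' - Y')) \<union> (Y' - X')) \<union> (B - (X' \<union> Y')))"
    by (rule bij_betw_combine[OF bXY b(4)]) auto
  moreover have "(((X \<inter> Y) \<union> (X - Y)) \<union> (Y - X)) \<union> (A - (X \<union> Y)) = A"
    "(((X' \<inter> Y') \<union> (X' - Y')) \<union> (Y' - X')) \<union> (B - (X' \<union> Y')) = B" using assms by blast+
  moreover have "g ` X = g ` (X \<inter> Y) \<union> g ` (X - Y)" "g ` Y = g ` (X \<inter> Y) \<union> g ` (Y - X)" by blast+
  moreover have "g ` (X \<inter> Y) = X' \<inter> Y'" "g ` (X - Y) = X' - Y'" "g ` (Y - X) = Y' - X'"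
    using b by (simp_all add: bij_betw_def)
  moreover have "X' \<inter> Y' \<union> (X' - Y') = X'" "X' \<inter> Y' \<union> (Y' - X') = Y'" by blast+
  ultimately show ?thesis by (intro exI[of _ g]) simp
qed

locale graded_poset =
  fixes P :: "'a::order set"
  assumes fin: "finite P" and ne: "P \<noteq> {}" and gr: "graded P"
begin

abbreviation h :: nat where "h \<equiv> height P"

lemma mem_level:
  assumes "1 \<le> i"
  shows "x \<in> level P i \<longleftrightarrow> x \<in> P \<and> (\<forall>j<i. x \<notin> level P j) \<and> (\<forall>y\<in>P. y < x \<longrightarrow> (\<exists>j<i. y \<in> level P j))"
proof -
  obtain k where "i = Suc k" using assms by (cases i) auto
  then show ?thesis by (auto simp: minimal_elements_def less_Suc_eq_le)
qed

lemma level_pos: "x \<in> level P i \<Longrightarrow> 1 \<le> i"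
  by (cases i) auto

declare level.simps [simp del]

lemma level_sub: "x \<in> level P i \<Longrightarrow> x \<in> P"
  using level_pos mem_level by blast

lemma level_unique: "x \<in> level P i \<Longrightarrow> x \<in> level P j \<Longrightarrow> i = j"
  using mem_level level_pos by (metis nat_neq_iff)

lemma level_less: "x \<in> level P i \<Longrightarrow> y \<in> level P j \<Longrightarrow> x < y \<Longrightarrow> i < j"
proof -
  assume x: "x \<in> level P i" and y: "y \<in> level P j" and xy: "x < y"
  obtain k where "k < j" "x \<in> level P k"
    using mem_level[OF level_pos[OF y], of y] y xy level_sub[OF x] by blast
  then show "i < j" using level_unique[OF x] by blast
qed

lemma finite_level: "finite (level P i)"
  by (rule finite_subset[OF _ fin]) (use level_sub in blast)

lemma ex_level: "x \<in> P \<Longrightarrow> \<exists>i. x \<in> level P i"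
proof (induction "card {y \<in> P. y < x}" arbitrary: x rule: less_induct)
  case less
  let ?D = "{y \<in> P. y < x}"
  have "\<exists>i. y \<in> level P i" if y: "y \<in> ?D" for y
  proof -
    have "{z \<in> P. z < y} \<subset> ?D" using y by auto
    then show ?thesis using less.hyps[of y] psubset_card_mono[of ?D] fin y by simp
  qed
  then obtain f where f: "\<forall>y\<in>?D. y \<in> level P (f y)" by metis
  define i where "i = Suc (Max (insert 0 (f ` ?D)))"
  have "f y < i" if "y \<in> ?D" for y
    using that fin unfolding i_def less_Suc_eq_le by (intro Max_ge) auto
  then have "x \<in> level P i" if "\<forall>j. x \<notin> level P j"
    using mem_level[of i x] f less.prems that by (auto simp: i_def)
  then show ?case by blast
qed

definition lv :: "'a \<Rightarrow> nat" where "lv x = (THE i. x \<in> level P i)"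

lemma lv_eq: "x \<in> level P i \<Longrightarrow> lv x = i"
  unfolding lv_def using level_unique by blast

lemma lv: "x \<in> P \<Longrightarrow> x \<in> level P (lv x)"
  using ex_level lv_eq by blast

lemma card_chain: "pred_on.chain P (<) C \<Longrightarrow> card C \<le> h"
proof -
  assume C: "pred_on.chain P (<) C"
  have "{card C | C. pred_on.chain P (<) C} \<subseteq> card ` Pow P" by (auto simp: pred_on.chain_def)
  then have "finite {card C | C. pred_on.chain P (<) C}" using fin finite_subset by blast
  then show ?thesis unfolding height_def using C by (intro Max_ge) auto
qed

lemma chain_below: "x \<in> level P (Suc i) \<Longrightarrow> \<exists>C. pred_on.chain P (<) C \<and> finite C \<and> card C = Suc i \<and> (\<forall>y\<in>C. y \<le> x)"
proof (induction i arbitrary: x)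
  case 0
  have "x \<in> P" by (rule level_sub[OF 0])
  then show ?case by (intro exI[of _ "{x}"]) (auto simp: pred_on.chain_def)
next
  case (Suc i)
  have x: "x \<notin> level P (Suc i)" using Suc.prems level_unique by fastforce
  then obtain y where y: "y \<in> P" "y < x" "\<forall>j<Suc i. y \<notin> level P j"
    using mem_level[of "Suc i" x] mem_level[of "Suc (Suc i)" x] Suc.prems by auto
  moreover have "\<exists>j<Suc (Suc i). y \<in> level P j" using mem_level[of "Suc (Suc i)" x] Suc.prems y by auto
  ultimately have "y \<in> level P (Suc i)" using less_Suc_eq by metis
  then obtain C where C: "pred_on.chain P (<) C" "finite C" "card C = Suc i" "\<forall>z\<in>C. z \<le> y"
    using Suc.IH by blast
  then have lt: "\<forall>z\<in>C. z < x" using y by force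
  then have "pred_on.chain P (<) (insert x C)"
    using C(1) level_sub[OF Suc.prems] unfolding pred_on.chain_def by blast
  moreover have "card (insert x C) = Suc (Suc i)" using C lt by (subst card_insert_disjoint) auto
  ultimately show ?case using C lt by (intro exI[of _ "insert x C"]) auto
qed

lemma level_le: "x \<in> level P i \<Longrightarrow> i \<le> h"
proof -
  assume x: "x \<in> level P i"
  then obtain k where k: "i = Suc k" using level_pos[OF x] by (cases i) auto
  obtain C where "pred_on.chain P (<) C" "card C = i" using chain_below[OF x[unfolded k]] k by blast
  then show "i \<le> h" using card_chain by blast
qed

text \<open>
  A maximal chain through \<open>x\<close> has \<open>h\<close> elements by gradedness, all on different levels, and there are only \<open>h\<close>
  levels; so it meets every one of them.
\<close>

lemma comparable_on_level:
  assumes x: "x \<in> P" and i: "1 \<le> i" "i \<le> h"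
  shows "\<exists>y\<in>level P i. y < x \<or> y = x \<or> x < y"
proof -
  let ?A = "{C. pred_on.chain P (<) C \<and> x \<in> C}"
  have "finite ?A" using fin by (rule_tac finite_subset[of _ "Pow P"]) (auto simp: pred_on.chain_def)
  moreover have "{x} \<in> ?A" using x by (simp add: pred_on.chain_def)
  ultimately obtain C where C: "C \<in> ?A" "\<And>B. B \<in> ?A \<Longrightarrow> C \<subseteq> B \<Longrightarrow> C = B"
    using finite_has_maximal[of ?A] by blast
  have "pred_on.maxchain P (<) C" unfolding pred_on.maxchain_def using C by blast
  then have card: "card C = h" using gr by (simp add: graded_def)
  have CP: "C \<subseteq> P" and cmp: "\<And>y z. y \<in> C \<Longrightarrow> z \<in> C \<Longrightarrow> y < z \<or> y = z \<or> z < y"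
    using C(1) by (auto simp: pred_on.chain_def)
  have "inj_on lv C"
  proof (rule inj_onI)
    fix y z assume yz: "y \<in> C" "z \<in> C" "lv y = lv z"
    then show "y = z" using cmp[OF yz(1,2)] lv[of y] lv[of z] CP level_less[of y "lv y" z] level_less[of z "lv z" y] by force
  qed
  then have "card (lv ` C) = h" using card by (simp add: card_image)
  moreover have "lv ` C \<subseteq> {1..h}"
  proof (intro image_subsetI)
    fix y assume "y \<in> C"
    then have "y \<in> level P (lv y)" using lv CP by blast
    then show "lv y \<in> {1..h}" using level_pos level_le by (simp only: atLeastAtMost_iff)
  qed
  ultimately have "lv ` C = {1..h}" by (intro card_subset_eq) auto
  then obtain y where "y \<in> C" "lv y = i" using i by (metis atLeastAtMost_iff imageE)
  then show ?thesis using cmp[of y x] C(1) lv[of y] CP by blast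
qed

lemma upper_neighbour:
  assumes x: "x \<in> level P r" and r: "r < h"
  shows "\<exists>y\<in>level P (Suc r). x < y"
proof -
  obtain y where y: "y \<in> level P (Suc r)" "y < x \<or> y = x \<or> x < y"
    using comparable_on_level[OF level_sub[OF x], of "Suc r"] r by auto
  moreover have "\<not> y < x" using level_less[OF y(1) x] by auto
  moreover have "y \<noteq> x" using level_unique[OF x, of "Suc r"] y(1) by auto
  ultimately show ?thesis by blast
qed

lemma lower_neighbour:
  assumes y: "y \<in> level P (Suc r)" and r: "1 \<le> r"
  shows "\<exists>x\<in>level P r. x < y"
proof -
  obtain x where x: "x \<in> level P r" "x < y \<or> x = y \<or> y < x"
    using comparable_on_level[OF level_sub[OF y] r] level_le[OF y] by auto
  moreover have "\<not> y < x" using level_less[OF y x(1)] by auto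
  moreover have "x \<noteq> y" using level_unique[OF y, of r] x(1) by auto
  ultimately show ?thesis by blast
qed

lemma card_level_pos: "1 \<le> i \<Longrightarrow> i \<le> h \<Longrightarrow> 1 \<le> card (level P i)"
proof -
  assume i: "1 \<le> i" "i \<le> h"
  obtain x where "x \<in> P" using ne by blast
  then have "level P i \<noteq> {}" using comparable_on_level[OF _ i] by blast
  then show "1 \<le> card (level P i)" using finite_level[of i] by (simp add: Suc_le_eq card_gt_0_iff)
qed

lemma card_levels: "card P = (\<Sum>i\<in>{0<..h}. card (level P i))"
proof -
  have "P = (\<Union>i\<in>{0<..h}. level P i)"
  proof (intro equalityI subsetI)
    fix x assume "x \<in> P"
    then have x: "x \<in> level P (lv x)" by (rule lv)
    then have "lv x \<in> {0<..h}" using level_pos[OF x] level_le[OF x] by simp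
    then show "x \<in> (\<Union>i\<in>{0<..h}. level P i)" using x by blast
  qed (use level_sub in blast)
  also have "card \<dots> = (\<Sum>i\<in>{0<..h}. card (level P i))"
    by (rule card_UN_disjoint) (use finite_level level_unique in auto)
  finally show ?thesis .
qed

end

section \<open>Independent sets of triples\<close>

context graded_poset begin

text \<open>
  A triple of \<open>V\<close>-type at the boundary of the levels \<open>r\<close> and \<open>r + 1\<close>, described by how many elements it has in each of
  the two. Pairs on one level are incomparable anyway.
\<close>

definition V_at :: "nat \<Rightarrow> 'a set \<Rightarrow> bool" where
  "V_at r v \<longleftrightarrow> 1 \<le> r \<and> v \<subseteq> level P r \<union> level P (Suc r) \<and> card (v \<inter> level P r) = 1
     \<and> card (v \<inter> level P (Suc r)) = 2 \<and> (\<forall>x\<in>v \<inter> level P r. \<forall>y\<in>v \<inter> level P (Suc r). \<not> x < y)"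

definition Lambda_at :: "nat \<Rightarrow> 'a set \<Rightarrow> bool" where
  "Lambda_at r v \<longleftrightarrow> 1 \<le> r \<and> v \<subseteq> level P r \<union> level P (Suc r) \<and> card (v \<inter> level P r) = 2
     \<and> card (v \<inter> level P (Suc r)) = 1 \<and> (\<forall>x\<in>v \<inter> level P r. \<forall>y\<in>v \<inter> level P (Suc r). \<not> x < y)"

definition lies_at :: "nat \<Rightarrow> 'a set \<Rightarrow> bool" where
  "lies_at r v \<longleftrightarrow> V_at r v \<or> Lambda_at r v"

lemma V_type_V_at: "V_type P v \<Longrightarrow> \<exists>r. V_at r v"
proof -
  assume "V_type P v"
  then obtain x y z i where v: "v = {x, y, z}" "incomparable x y" "incomparable x z" "incomparable y z"
    and i: "1 \<le> i" "x \<in> level P i" "y \<in> level P (Suc i)" "z \<in> level P (Suc i)"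
    unfolding V_type_def by auto
  have "x \<notin> level P (Suc i)" "y \<notin> level P i" "z \<notin> level P i" "y \<noteq> z"
    using level_unique[OF i(2), of "Suc i"] level_unique[OF i(3), of i] level_unique[OF i(4), of i] v(4)
    by (auto simp: incomparable_def)
  then have e: "v \<inter> level P i = {x}" "v \<inter> level P (Suc i) = {y, z}" "y \<noteq> z" "\<not> x < y" "\<not> x < z"
    using v i by (auto simp: incomparable_def)
  have "v \<subseteq> level P i \<union> level P (Suc i)" using i v(1) by blast
  then have "V_at i v" unfolding V_at_def e(1,2) using i(1) e(3-5) by simp
  then show ?thesis ..
qed

lemma Lambda_type_Lambda_at: "Lambda_type P v \<Longrightarrow> \<exists>r. Lambda_at r v"
proof -
  assume "Lambda_type P v"
  then obtain x y z i where v: "v = {x, y, z}" "incomparable x y" "incomparable x z" "incomparable y z"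
    and i: "1 \<le> i" "x \<in> level P i" "y \<in> level P i" "z \<in> level P (Suc i)"
    unfolding Lambda_type_def by auto
  have "x \<notin> level P (Suc i)" "y \<notin> level P (Suc i)" "z \<notin> level P i" "x \<noteq> y"
    using level_unique[OF i(2), of "Suc i"] level_unique[OF i(3), of "Suc i"] level_unique[OF i(4), of i] v(2)
    by (auto simp: incomparable_def)
  then have e: "v \<inter> level P i = {x, y}" "v \<inter> level P (Suc i) = {z}" "x \<noteq> y" "\<not> x < z" "\<not> y < z"
    using v i by (auto simp: incomparable_def)
  have "v \<subseteq> level P i \<union> level P (Suc i)" using i v(1) by blast
  then have "Lambda_at i v" unfolding Lambda_at_def e(1,2) using i(1) e(3-5) by simp
  then show ?thesis ..
qed

lemma lies_atD:
  assumes "lies_at r v"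
  shows "1 \<le> r" "v \<subseteq> level P r \<union> level P (Suc r)" "v \<inter> level P r \<noteq> {}" "v \<inter> level P (Suc r) \<noteq> {}"
    "\<And>x y. x \<in> v \<inter> level P r \<Longrightarrow> y \<in> v \<inter> level P (Suc r) \<Longrightarrow> \<not> x < y"
proof -
  show "1 \<le> r" "v \<subseteq> level P r \<union> level P (Suc r)"
    using assms by (auto simp: lies_at_def V_at_def Lambda_at_def)
  have "card (v \<inter> level P r) \<noteq> 0" "card (v \<inter> level P (Suc r)) \<noteq> 0"
    using assms unfolding lies_at_def V_at_def Lambda_at_def by linarith+
  then show "v \<inter> level P r \<noteq> {}" "v \<inter> level P (Suc r) \<noteq> {}" by (metis card.empty)+
  show "\<not> x < y" if "x \<in> v \<inter> level P r" "y \<in> v \<inter> level P (Suc r)" for x y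
    using assms that unfolding lies_at_def V_at_def Lambda_at_def by blast
qed

lemma lies_at_unique:
  assumes v: "lies_at r v" "lies_at q v"
  shows "r = q"
proof -
  obtain x y where x: "x \<in> v" "x \<in> level P r" and y: "y \<in> v" "y \<in> level P (Suc r)"
    using lies_atD(3,4)[OF v(1)] by blast
  have "x \<in> level P q \<or> x \<in> level P (Suc q)" "y \<in> level P q \<or> y \<in> level P (Suc q)"
    using x y lies_atD(2)[OF v(2)] by blast+
  then have "r = q \<or> r = Suc q" "Suc r = q \<or> Suc r = Suc q"
    using level_unique[OF x(2)] level_unique[OF y(2)] by blast+
  then show ?thesis by linarith
qed

lemma lies_at_less:
  assumes "lies_at r v"
  shows "r < h"
  using lies_atD(4)[OF assms] level_le[of _ "Suc r"] by fastforce

text \<open>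
  An element of the triple in the upper level has a lower neighbour, which is outside the triple.
\<close>

lemma card_lower_less:
  assumes v: "lies_at r v"
  shows "card (v \<inter> level P r) < card (level P r)"
proof -
  obtain y where y: "y \<in> v \<inter> level P (Suc r)" using lies_atD(4)[OF v] by blast
  then obtain x where x: "x \<in> level P r" "x < y" using lower_neighbour[of y r] lies_atD(1)[OF v] by blast
  then have "x \<notin> v" using lies_atD(5)[OF v _ y] by blast
  then show ?thesis using x by (intro psubset_card_mono[OF finite_level]) blast
qed

lemma card_upper_less:
  assumes v: "lies_at r v"
  shows "card (v \<inter> level P (Suc r)) < card (level P (Suc r))"
proof -
  obtain x where x: "x \<in> v \<inter> level P r" using lies_atD(3)[OF v] by blast
  then obtain y where y: "y \<in> level P (Suc r)" "x < y" using upper_neighbour[of x r] lies_at_less[OF v] by blast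
  then have "y \<notin> v" using lies_atD(5)[OF v x] by blast
  then show ?thesis using y by (intro psubset_card_mono[OF finite_level]) blast
qed

end

text \<open>
  An independent set has at most one triple at each boundary, and therefore determines the data of
  \<open>levels\<close>.
\<close>

locale independent_triples = graded_poset P for P :: "'a::order set" +
  fixes S :: "'a set set"
  assumes ind: "G_independent P S"
begin

definition T :: "nat \<Rightarrow> boundary" where
  "T r = (if \<exists>v\<in>S. V_at r v then Vee else if \<exists>v\<in>S. Lambda_at r v then Wedge else Full)"

text \<open>
  The parts in level \<open>r\<close> and, for \<open>Upper r\<close>, in level \<open>r + 1\<close> of the triple at their boundary; by independence the
  union ranges over at most one triple.
\<close>

definition Lower :: "nat \<Rightarrow> 'a set" where "Lower r = \<Union>{v \<inter> level P r | v. v \<in> S \<and> lies_at r v}"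
definition Upper :: "nat \<Rightarrow> 'a set" where "Upper r = \<Union>{v \<inter> level P (Suc r) | v. v \<in> S \<and> lies_at r v}"

lemma not_adj: "v \<in> S \<Longrightarrow> w \<in> S \<Longrightarrow> \<not> G_adj P v w"
  and S_verts: "v \<in> S \<Longrightarrow> v \<in> G_verts P"
  using ind by (auto simp: G_independent_def)

lemma ex_lies_at: "v \<in> S \<Longrightarrow> \<exists>r. lies_at r v"
  using S_verts[of v] V_type_V_at Lambda_type_Lambda_at unfolding G_verts_def lies_at_def by blast

lemma lies_at_inj:
  assumes "v \<in> S" "w \<in> S" "lies_at r v" "lies_at r w"
  shows "v = w"
proof (rule ccontr)
  assume "v \<noteq> w"
  then have "G_adj P v w"
    unfolding G_adj_def using assms S_verts lies_atD(1,2)[OF assms(3)] lies_atD(2)[OF assms(4)]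
    by (auto intro!: exI[of _ r])
  then show False using not_adj assms by blast
qed

lemma T_VeeI: "v \<in> S \<Longrightarrow> V_at r v \<Longrightarrow> T r = Vee"
  by (auto simp: T_def)

lemma T_WedgeI: "v \<in> S \<Longrightarrow> Lambda_at r v \<Longrightarrow> T r = Wedge"
proof -
  assume v: "v \<in> S" "Lambda_at r v"
  have "\<not> V_at r w" if w: "w \<in> S" for w
  proof
    assume V: "V_at r w"
    then have "w = v" using lies_at_inj[OF w v(1), of r] v V by (simp add: lies_at_def)
    then show False using V v by (simp add: V_at_def Lambda_at_def)
  qed
  then show ?thesis using v by (auto simp: T_def)
qed

lemma T_cases:
  obtains (Full) "T r = Full" "\<And>v. v \<in> S \<Longrightarrow> \<not> lies_at r v" "Lower r = {}" "Upper r = {}"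
  | (Vee) v where "T r = Vee" "v \<in> S" "V_at r v" "lies_at r v" "Lower r = v \<inter> level P r" "Upper r = v \<inter> level P (Suc r)"
  | (Wedge) v where "T r = Wedge" "v \<in> S" "Lambda_at r v" "lies_at r v" "Lower r = v \<inter> level P r" "Upper r = v \<inter> level P (Suc r)"
proof (cases "\<exists>v\<in>S. lies_at r v")
  case True
  then obtain v where v: "v \<in> S" "lies_at r v" by blast
  have "Lower r = v \<inter> level P r" "Upper r = v \<inter> level P (Suc r)"
    unfolding Lower_def Upper_def using v lies_at_inj[OF v(1) _ v(2)] by blast+
  then show thesis using that(2,3)[of v] v T_VeeI T_WedgeI unfolding lies_at_def by blast
next
  case False
  then have n: "\<And>v. v \<in> S \<Longrightarrow> \<not> lies_at r v" by blast
  then have "T r = Full" by (auto simp: T_def lies_at_def)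
  moreover have "Lower r = {}" "Upper r = {}" unfolding Lower_def Upper_def using n by blast+
  ultimately show thesis using that(1) n by blast
qed

text \<open>
  The rules of adjacency, read for two triples of the independent set that meet in a level.
\<close>

lemma consecutive:
  assumes v: "v \<in> S" "lies_at q v" and w: "w \<in> S" "lies_at (Suc q) w"
  defines "L \<equiv> level P (Suc q)"
  shows "(v \<inter> L) \<inter> (w \<inter> L) = v \<inter> w" "card L \<noteq> 2" "5 \<le> card L \<Longrightarrow> v \<inter> w = {}"
    "card L \<in> {3, 4} \<Longrightarrow> v \<inter> w \<noteq> {} \<Longrightarrow> T q = Vee \<and> T (Suc q) = Wedge \<and> card (v \<inter> w) = 1"
    "card L \<in> {3, 4} \<Longrightarrow> v \<inter> w = {} \<Longrightarrow> card (v \<inter> L) + card (w \<inter> L) \<noteq> card L"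
proof -
  note vL = lies_atD(1,2)[OF v(2)] and wL = lies_atD(2)[OF w(2)]
  have "x \<in> L" if x: "x \<in> v" "x \<in> w" for x
  proof (rule ccontr)
    assume "x \<notin> L"
    then have "x \<in> level P q" "x \<in> level P (Suc (Suc q))"
      using subsetD[OF vL(2) x(1)] subsetD[OF wL x(2)] unfolding L_def by simp_all
    then show False using level_unique[of x q "Suc (Suc q)"] by simp
  qed
  then show eq: "(v \<inter> L) \<inter> (w \<inter> L) = v \<inter> w" by blast
  have "v \<noteq> w" using lies_at_unique[OF v(2), of "Suc q"] w(2) by auto
  then have nadj: "\<not> G_adj_consecutive P v w" using not_adj[OF v(1) w(1)] S_verts[OF v(1)] S_verts[OF w(1)] unfolding G_adj_def by simp
  have "\<not> (v \<subseteq> level P (Suc q - 1) \<union> L \<and> w \<subseteq> L \<union> level P (Suc q + 1) \<and>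
        (card L \<ge> 5 \<and> v \<inter> w \<noteq> {} \<or>
         card L \<in> {3, 4} \<and> v \<inter> w \<noteq> {} \<and>
           \<not> (V_type P v \<and> Lambda_type P w \<and> card (v \<inter> w) = 1) \<or>
         card L \<in> {3, 4} \<and> v \<inter> w = {} \<and>
           card (v \<inter> L) + card (w \<inter> L) = card L \<or>
         card L = 2))"
  proof -
    have i: "2 \<le> Suc q" using vL(1) by simp
    show ?thesis
      by (rule notI, rule notE[OF nadj]) (unfold G_adj_consecutive_def, intro exI[of _ "Suc q"] conjI[OF i], unfold L_def, assumption)
  qed
  moreover have "v \<subseteq> level P (Suc q - 1) \<union> L" "w \<subseteq> L \<union> level P (Suc q + 1)"
    using vL wL unfolding L_def by simp_all
  ultimately have *: "card L \<noteq> 2" "5 \<le> card L \<Longrightarrow> v \<inter> w = {}"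
    "card L \<in> {3, 4} \<Longrightarrow> v \<inter> w \<noteq> {} \<Longrightarrow> V_type P v \<and> Lambda_type P w \<and> card (v \<inter> w) = 1"
    "card L \<in> {3, 4} \<Longrightarrow> v \<inter> w = {} \<Longrightarrow> card (v \<inter> L) + card (w \<inter> L) \<noteq> card L"
    by blast+
  show "card L \<noteq> 2" "5 \<le> card L \<Longrightarrow> v \<inter> w = {}"
    "card L \<in> {3, 4} \<Longrightarrow> v \<inter> w = {} \<Longrightarrow> card (v \<inter> L) + card (w \<inter> L) \<noteq> card L" using * by blast+
  have "T q = Vee" if V: "V_type P v"
  proof -
    obtain r where r: "V_at r v" using V_type_V_at[OF V] by blast
    then have "r = q" using lies_at_unique[OF _ v(2)] by (simp add: lies_at_def)
    then show ?thesis using r T_VeeI v by blast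
  qed
  moreover have "T (Suc q) = Wedge" if W: "Lambda_type P w"
  proof -
    obtain r where r: "Lambda_at r w" using Lambda_type_Lambda_at[OF W] by blast
    then have "r = Suc q" using lies_at_unique[OF _ w(2)] by (simp add: lies_at_def)
    then show ?thesis using r T_WedgeI w by blast
  qed
  ultimately show "card L \<in> {3, 4} \<Longrightarrow> v \<inter> w \<noteq> {} \<Longrightarrow> T q = Vee \<and> T (Suc q) = Wedge \<and> card (v \<inter> w) = 1"
    using *(3) by blast
qed

lemma card_Lower: "card (Lower r) = (case T r of Full \<Rightarrow> 0 | Vee \<Rightarrow> 1 | Wedge \<Rightarrow> 2)"
  by (cases r rule: T_cases) (simp_all add: V_at_def Lambda_at_def)

lemma card_Upper: "card (Upper r) = (case T r of Full \<Rightarrow> 0 | Vee \<Rightarrow> 2 | Wedge \<Rightarrow> 1)"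
  by (cases r rule: T_cases) (simp_all add: V_at_def Lambda_at_def)

lemma nonFull:
  assumes "T r \<noteq> Full"
  obtains v where "v \<in> S" "lies_at r v" "Lower r = v \<inter> level P r" "Upper r = v \<inter> level P (Suc r)"
  using assms by (cases r rule: T_cases) auto

lemma Lower_less: "T r \<noteq> Full \<Longrightarrow> card (Lower r) < card (level P r)"
  and Upper_less: "T r \<noteq> Full \<Longrightarrow> card (Upper r) < card (level P (Suc r))"
  by (metis nonFull card_lower_less card_upper_less)+

text \<open>
  The size of the overlap is forced. In a level of size three or four the triples can only share an element
  if a \<open>V\<close>-triple is below a \<open>\<Lambda>\<close>-triple, and then they must: for size three by the pigeonhole principle, for
  size four since disjoint triples would cover the level and be adjacent.
\<close>

lemma both:
  assumes "T q \<noteq> Full" "T (Suc q) \<noteq> Full"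
  defines "n \<equiv> card (level P (Suc q))"
  shows "3 \<le> n" "n = 3 \<Longrightarrow> T q \<noteq> T (Suc q)"
    "card (Upper q \<inter> Lower (Suc q)) = (if T q = Vee \<and> T (Suc q) = Wedge \<and> n \<le> 4 then 1 else 0)"
proof -
  obtain v where v: "v \<in> S" "lies_at q v" "Upper q = v \<inter> level P (Suc q)" using nonFull[OF assms(1)] by metis
  obtain w where w: "w \<in> S" "lies_at (Suc q) w" "Lower (Suc q) = w \<inter> level P (Suc q)" using nonFull[OF assms(2)] by metis
  note c = consecutive[OF v(1,2) w(1,2), folded v(3) w(3) n_def]
  have "n \<noteq> 0" "n \<noteq> 1" using Upper_less[OF assms(1)] card_Upper[of q] assms(1)
    by (auto simp: n_def split: boundary.splits)
  then show n3: "3 \<le> n" using c(2) by linarith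
  have cards: "T q = Vee \<Longrightarrow> card (Upper q) = 2" "T q = Wedge \<Longrightarrow> card (Upper q) = 1"
    "T (Suc q) = Vee \<Longrightarrow> card (Lower (Suc q)) = 1" "T (Suc q) = Wedge \<Longrightarrow> card (Lower (Suc q)) = 2"
    by (simp_all add: card_Upper card_Lower)
  have Tq: "T q = Vee \<or> T q = Wedge" "T (Suc q) = Vee \<or> T (Suc q) = Wedge"
    using assms(1,2) by (metis boundary.exhaust)+
  show "T q \<noteq> T (Suc q)" if n: "n = 3"
  proof
    assume same: "T q = T (Suc q)"
    then have "card (Upper q) + card (Lower (Suc q)) = n" using Tq cards n by auto
    then have "v \<inter> w \<noteq> {}" using c(5) n by blast
    then have "T q = Vee" "T (Suc q) = Wedge" using c(4) n by blast+
    then show False using same by simp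
  qed
  have pigeon: "v \<inter> w \<noteq> {}" if "T q = Vee" "T (Suc q) = Wedge" "n \<le> 4"
  proof
    assume e: "v \<inter> w = {}"
    have "card (Upper q \<union> Lower (Suc q)) \<le> n"
      unfolding n_def v(3) w(3) by (intro card_mono finite_level) auto
    moreover have "card (Upper q \<union> Lower (Suc q)) = card (Upper q) + card (Lower (Suc q))"
      using c(1) e unfolding v(3) w(3) by (intro card_Un_disjoint) (auto simp: finite_level)
    ultimately have "n = 4" using cards that by linarith
    then show False using c(5) e cards that by simp
  qed
  have n34: "n \<in> {3, 4} \<or> 5 \<le> n" using n3 by auto
  show "card (Upper q \<inter> Lower (Suc q)) = (if T q = Vee \<and> T (Suc q) = Wedge \<and> n \<le> 4 then 1 else 0)"
  proof (cases "T q = Vee \<and> T (Suc q) = Wedge \<and> n \<le> 4")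
    case True
    then have "n \<in> {3, 4}" using n3 by auto
    then have "card (v \<inter> w) = 1" using c(4) pigeon True by blast
    then show ?thesis unfolding c(1) using True by simp
  next
    case False
    then have "v \<inter> w = {}" using c(3,4) n34 by force
    then show ?thesis unfolding c(1) using False by simp
  qed
qed

sublocale levels h "\<lambda>r. card (level P r)" T
proof
  show "1 \<le> card (level P r)" if "1 \<le> r" "r \<le> h" for r using card_level_pos that by blast
  show "1 \<le> r \<and> r < h" if "T r \<noteq> Full" for r
    using nonFull[OF that] lies_atD(1) lies_at_less by metis
  show "2 \<le> card (level P r) \<and> 2 \<le> card (level P (Suc r))" if "T r \<noteq> Full" for r
    using Lower_less[OF that] Upper_less[OF that] card_Lower[of r] card_Upper[of r] that
    by (cases "T r") auto
  show "3 \<le> card (level P r)" if "T r = Wedge" for r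
    using Lower_less[of r] card_Lower[of r] that by simp
  show "3 \<le> card (level P (Suc r))" if "T r = Vee" for r
    using Upper_less[of r] card_Upper[of r] that by simp
  show "3 \<le> card (level P (Suc r)) \<and> (card (level P (Suc r)) = 3 \<longrightarrow> T r \<noteq> T (Suc r))"
    if "T r \<noteq> Full" "T (Suc r) \<noteq> Full" for r
    using both(1,2)[OF that] by blast
qed

end

section \<open>Labelling the poset\<close>

context independent_triples begin

lemma card_Hi: "1 \<le> r \<Longrightarrow> card (Hi r) = card (Lower r)"
  using T_Wedge[of r] unfolding card_Lower by (cases "T r") (simp_all add: Hi_def)

lemma card_Lo: "card (Lo (Suc q)) = card (Upper q)"
  unfolding card_Upper by (cases "T q") (simp_all add: Lo_def)

lemma empty_if_Full: "T r = Full \<Longrightarrow> Lower r = {} \<and> Upper r = {}"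
  by (cases r rule: T_cases) simp_all

lemma card_Lo_Int_Hi: "card (Lo (Suc q) \<inter> Hi (Suc q)) = card (Upper q \<inter> Lower (Suc q))"
proof (cases "T q = Full \<or> T (Suc q) = Full")
  case True
  then show ?thesis
  proof
    assume "T q = Full"
    then show ?thesis using empty_if_Full[of q] by (simp add: Lo_def)
  next
    assume "T (Suc q) = Full"
    then show ?thesis using empty_if_Full[of "Suc q"] by (simp add: Hi_def)
  qed
next
  case False
  then have nf: "T q \<noteq> Full" "T (Suc q) \<noteq> Full" by simp_all
  let ?n = "card (level P (Suc q))"
  have sh: "shared (Suc q) \<longleftrightarrow> T q = Vee \<and> T (Suc q) = Wedge \<and> ?n = 4" by (simp add: shared_def)
  have n: "3 \<le> ?n" "?n = 3 \<Longrightarrow> T q \<noteq> T (Suc q)" using both(1,2)[OF nf] by blast+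
  have *: "card (Lo (Suc q) \<inter> Hi (Suc q)) = (if T q = Vee \<and> T (Suc q) = Wedge \<and> ?n \<le> 4 then 1 else 0)"
  proof -
    consider (VV) "T q = Vee" "T (Suc q) = Vee" | (VW) "T q = Vee" "T (Suc q) = Wedge"
      | (WV) "T q = Wedge" "T (Suc q) = Vee" | (WW) "T q = Wedge" "T (Suc q) = Wedge"
      using nf by (metis boundary.exhaust)
    then show ?thesis
    proof cases
      case VV
      then have "?n \<noteq> 3" using n(2) by auto
      then have "4 \<le> ?n" using n(1) by linarith
      then show ?thesis using VV sh by (simp add: Lo_def Hi_def)
    next
      case VW
      consider "?n = 3" | "?n = 4" | "5 \<le> ?n" using n by linarith
      then show ?thesis
      proof cases
        case 1
        have "{1, 2} \<inter> {2, 3::nat} = {2}" by auto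
        then show ?thesis using VW sh 1 by (simp add: Lo_def Hi_def)
      next
        case 2
        have "{1, 3} \<inter> {3, 4::nat} = {3}" by auto
        then show ?thesis using VW sh 2 by (simp add: Lo_def Hi_def)
      next
        case 3
        then show ?thesis using VW sh by (simp add: Lo_def Hi_def)
      qed
    next
      case WV
      then show ?thesis using n by (simp add: Lo_def Hi_def)
    next
      case WW
      then have "?n \<noteq> 3" using n(2) by auto
      then have "4 \<le> ?n" using n(1) by linarith
      then show ?thesis using WW by (simp add: Lo_def Hi_def)
    qed
  qed
  show ?thesis unfolding * both(3)[OF nf] ..
qed

lemma Lower_sub: "Lower r \<subseteq> level P r" and Upper_sub: "Upper r \<subseteq> level P (Suc r)"
  unfolding Lower_def Upper_def by blast+

lemma Hi_Lo_sub:
  assumes "Suc q \<le> h"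
  shows "Hi (Suc q) \<subseteq> {1..card (level P (Suc q))}" "Lo (Suc q) \<subseteq> {1..card (level P (Suc q))}"
proof -
  have "1 \<le> card (level P (Suc q))" using card_level_pos assms by simp
  moreover have "T (Suc q) = Wedge \<Longrightarrow> 3 \<le> card (level P (Suc q))" by (rule T_Wedge)
  ultimately show "Hi (Suc q) \<subseteq> {1..card (level P (Suc q))}" by (cases "T (Suc q)") (auto simp: Hi_def)
  have "T q = Vee \<Longrightarrow> 3 \<le> card (level P (Suc q))" by (rule T_Vee)
  then show "Lo (Suc q) \<subseteq> {1..card (level P (Suc q))}"
    using \<open>1 \<le> card (level P (Suc q))\<close> by (cases "T q") (auto simp: Lo_def)
qed

text \<open>
  Possible since \<open>Lo\<close> and \<open>Hi\<close> have the sizes of the parts of the triples in this level, and so do their intersections.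
\<close>

lemma ex_enumeration:
  assumes "Suc q \<le> h"
  shows "\<exists>g. bij_betw g (level P (Suc q)) {1..card (level P (Suc q))}
    \<and> g ` Upper q = Lo (Suc q) \<and> g ` Lower (Suc q) = Hi (Suc q)"
  by (rule ex_bij_two_subsets)
    (use finite_level Upper_sub Lower_sub Hi_Lo_sub[OF assms] card_Lo card_Hi card_Lo_Int_Hi in simp_all)

lemma Lower_Upper_incomparable: "x \<in> Lower r \<Longrightarrow> y \<in> Upper r \<Longrightarrow> \<not> x < y"
  by (cases r rule: T_cases) (use lies_atD(5) in blast)+

text \<open>
  Under such numberings the unrelated pairs all come from triples, hence are incomparable in \<open>P\<close>.
\<close>

lemma ex_labelling: "\<exists>\<phi>. inj_on \<phi> P \<and> \<phi> ` P \<subseteq> elems 1 \<and> (\<forall>x\<in>P. \<forall>y\<in>P. x < y \<longrightarrow> prec (\<phi> x) (\<phi> y))"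
proof -
  have "\<forall>q. \<exists>g. Suc q \<le> h \<longrightarrow> bij_betw g (level P (Suc q)) {1..card (level P (Suc q))}
    \<and> g ` Upper q = Lo (Suc q) \<and> g ` Lower (Suc q) = Hi (Suc q)"
    using ex_enumeration by blast
  then obtain g where g: "\<And>q. Suc q \<le> h \<Longrightarrow> bij_betw (g q) (level P (Suc q)) {1..card (level P (Suc q))}
    \<and> g q ` Upper q = Lo (Suc q) \<and> g q ` Lower (Suc q) = Hi (Suc q)"
    by metis
  define \<phi> where "\<phi> x = (lv x, g (lv x - 1) x)" for x
  have \<phi>: "\<phi> x = (Suc q, g q x)" if "x \<in> level P (Suc q)" for x q
    using lv_eq[OF that] by (simp add: \<phi>_def)
  have lev: "\<exists>q. x \<in> level P (Suc q) \<and> Suc q \<le> h" if x: "x \<in> P" for x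
  proof -
    obtain i where i: "x \<in> level P i" using ex_level[OF x] by blast
    then have "1 \<le> i" "i \<le> h" using level_pos level_le by blast+
    then show ?thesis using i by (cases i) auto
  qed
  have "inj_on \<phi> P"
  proof (rule inj_onI)
    fix x y assume xy: "x \<in> P" "y \<in> P" "\<phi> x = \<phi> y"
    obtain q q' where q: "x \<in> level P (Suc q)" "Suc q \<le> h" "y \<in> level P (Suc q')" using lev xy by blast
    then have "q' = q" "g q x = g q y" using \<phi> xy(3) by auto
    then show "x = y" using g[OF q(2)] q unfolding bij_betw_def by (meson inj_onD)
  qed
  moreover have "\<phi> ` P \<subseteq> elems 1"
  proof (intro image_subsetI)
    fix x assume "x \<in> P"
    then obtain q where q: "x \<in> level P (Suc q)" "Suc q \<le> h" using lev by blast
    then have "g q x \<in> {1..card (level P (Suc q))}" using bij_betwE[OF conjunct1[OF g[OF q(2)]]] q(1) by blast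
    then show "\<phi> x \<in> elems 1" unfolding \<phi>[OF q(1)] elems_def using q by auto
  qed
  moreover have "prec (\<phi> x) (\<phi> y)" if xy: "x \<in> P" "y \<in> P" "x < y" for x y
  proof -
    obtain q where q: "x \<in> level P (Suc q)" "Suc q \<le> h" using lev xy by blast
    obtain r where r: "y \<in> level P (Suc r)" "Suc r \<le> h" using lev xy by blast
    have qr: "Suc q < Suc r" by (rule level_less[OF q(1) r(1) xy(3)])
    have "\<not> conf (\<phi> x) (\<phi> y)"
    proof
      assume "conf (\<phi> x) (\<phi> y)"
      then have c: "r = Suc q" "g q x \<in> Hi (Suc q)" "g r y \<in> Lo (Suc r)" unfolding conf_def \<phi>[OF q(1)] \<phi>[OF r(1)] by auto
      have inj: "inj_on (g q) (level P (Suc q))" "inj_on (g r) (level P (Suc r))"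
        using g[OF q(2)] g[OF r(2)] by (auto simp: bij_betw_def)
      have im: "g q ` Lower (Suc q) = Hi (Suc q)" "g r ` Upper r = Lo (Suc r)"
        using g[OF q(2)] g[OF r(2)] by simp_all
      have "x \<in> Lower (Suc q)"
        using c(2) inj_on_image_mem_iff[OF inj(1) q(1) Lower_sub] unfolding im by simp
      moreover have "y \<in> Upper r"
        using c(3) inj_on_image_mem_iff[OF inj(2) r(1) Upper_sub] unfolding im by simp
      ultimately show False using Lower_Upper_incomparable xy(3) c(1) by blast
    qed
    then show ?thesis unfolding prec_def using qr by (simp add: \<phi>[OF q(1)] \<phi>[OF r(1)])
  qed
  ultimately show ?thesis by (intro exI[of _ \<phi>]) simp
qed

lemma embeds_contains: "embeds F (elems 1) \<Longrightarrow> contains_poset F P"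
proof -
  assume "embeds F (elems 1)"
  then obtain f where pl: "place F (elems 1) f" unfolding embeds_def by (rule exE)
  have f: "inj_on f (elems 1)" "f ` elems 1 \<subseteq> F"
    "\<And>p q. p \<in> elems 1 \<Longrightarrow> q \<in> elems 1 \<Longrightarrow> prec p q \<Longrightarrow> f p \<subset> f q"
    using pl unfolding place_def by simp_all
  obtain \<phi> where lab: "inj_on \<phi> P \<and> \<phi> ` P \<subseteq> elems 1 \<and> (\<forall>x\<in>P. \<forall>y\<in>P. x < y \<longrightarrow> prec (\<phi> x) (\<phi> y))"
    using ex_labelling by (rule exE)
  then have \<phi>: "inj_on \<phi> P" "\<phi> ` P \<subseteq> elems 1" "\<And>x y. x \<in> P \<Longrightarrow> y \<in> P \<Longrightarrow> x < y \<Longrightarrow> prec (\<phi> x) (\<phi> y)"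
    by simp_all
  have "inj_on (f \<circ> \<phi>) P" using \<phi>(1) inj_on_subset[OF f(1) \<phi>(2)] by (rule comp_inj_on)
  moreover have "(f \<circ> \<phi>) ` P \<subseteq> F" using f(2) \<phi>(2) by (auto simp del: One_nat_def)
  moreover have "mono_on P (f \<circ> \<phi>)"
  proof (rule mono_onI)
    fix x y assume xy: "x \<in> P" "y \<in> P" "x \<le> y"
    show "(f \<circ> \<phi>) x \<le> (f \<circ> \<phi>) y"
    proof (cases "x = y")
      case False
      then have "prec (\<phi> x) (\<phi> y)" using \<phi>(3) xy by simp
      then have "f (\<phi> x) \<subset> f (\<phi> y)" using f(3)[of "\<phi> x" "\<phi> y"] \<phi>(2) xy by blast
      then show ?thesis by auto
    qed simp
  qed
  ultimately show ?thesis unfolding contains_poset_def by (intro exI[of _ "f \<circ> \<phi>"] conjI)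
qed

lemma card_S: "card S = card {r \<in> {0<..<h}. T r \<noteq> Full}"
proof -
  obtain f where f: "\<And>v. v \<in> S \<Longrightarrow> lies_at (f v) v" using ex_lies_at by metis
  have "bij_betw f S {r \<in> {0<..<h}. T r \<noteq> Full}"
  proof (rule bij_betw_imageI)
    show "inj_on f S"
      using lies_at_inj f by (intro inj_onI) (rule lies_at_inj, assumption, assumption, rule f, assumption, simp only: f)
    show "f ` S = {r \<in> {0<..<h}. T r \<noteq> Full}"
    proof (intro equalityI subsetI)
      fix r assume "r \<in> f ` S"
      then obtain v where v: "v \<in> S" "lies_at r v" using f by blast
      then have "T r = Vee \<or> T r = Wedge" using T_VeeI T_WedgeI unfolding lies_at_def by blast
      then have "T r \<noteq> Full" by auto
      then show "r \<in> {r \<in> {0<..<h}. T r \<noteq> Full}" using lies_atD(1)[OF v(2)] lies_at_less[OF v(2)] by simp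
    next
      fix r assume "r \<in> {r \<in> {0<..<h}. T r \<noteq> Full}"
      then have "T r \<noteq> Full" by simp
      then obtain v where v: "v \<in> S" "lies_at r v" by (rule nonFull)
      then have "f v = r" using lies_at_unique[OF f] by blast
      then show "r \<in> f ` S" using v by blast
    qed
  qed
  then show ?thesis by (rule bij_betw_same_card)
qed

lemma height_pos: "1 \<le> h"
  using ne ex_level level_pos level_le by (metis all_not_in_conv le_trans)

lemma mu_0: "mu 0 = int (card P) + int h - int (card S) - 2"
proof -
  let ?A = "{r \<in> {0<..<h}. T r \<noteq> Full}" and ?B = "{r \<in> {0<..<h}. T r = Full}"
  have "card ?A + card ?B = card (?A \<union> ?B)" by (rule card_Un_disjoint[symmetric]) auto
  also have "?A \<union> ?B = {0<..<h}" by blast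
  finally have AB: "int (card S) + int (card ?B) = int h - 1" using height_pos by (simp add: card_S)
  have "(\<Sum>i\<in>{0<..h}. zi i) = (\<Sum>i\<in>?B. zi i)"
    by (rule sum.mono_neutral_right) (auto simp: zi_def)
  also have "\<dots> = int (card ?B)" by (simp add: zi_def)
  finally show ?thesis using AB unfolding mu_def card_levels by (simp add: sum.distrib)
qed

end

section \<open>The bound on La\<close>

lemma (in graded_poset) G_verts_sub: "v \<in> G_verts P \<Longrightarrow> v \<subseteq> P"
  using level_sub unfolding G_verts_def V_type_def Lambda_type_def by blast

lemma (in graded_poset) ex_maximum_independent: "\<exists>S. G_independent P S \<and> card S = alpha_G P"
proof -
  let ?A = "{card S | S. G_independent P S}"
  have "?A \<subseteq> card ` Pow (Pow P)" unfolding G_independent_def using G_verts_sub by blast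
  then have "finite ?A" using fin finite_subset by blast
  moreover have "G_independent P {}" by (simp add: G_independent_def)
  then have "?A \<noteq> {}" by blast
  ultimately have "Max ?A \<in> ?A" by (rule Max_in)
  then show ?thesis unfolding alpha_G_def by auto
qed

lemma (in graded_poset) bound_of_family:
  assumes "2 \<le> n" "F \<subseteq> Pow {1..n}" "\<not> contains_poset F P"
  shows "2 * int (card F) \<le> (int (card P) + int h - int (alpha_G P) - 2) * int (n choose (n div 2))"
proof -
  obtain S where S: "G_independent P S" "card S = alpha_G P" using ex_maximum_independent by blast
  interpret independent_triples P S by unfold_locales (rule S(1))
  show ?thesis using family_bound[OF height_pos assms(1,2)] embeds_contains assms(3) mu_0 S(2) by auto
qed

lemma (in graded_poset) alpha_le: "int (alpha_G P) \<le> int h - 1"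
proof -
  obtain S where S: "G_independent P S" "card S = alpha_G P" using ex_maximum_independent by blast
  interpret independent_triples P S by unfold_locales (rule S(1))
  have "card {r \<in> {0<..<h}. T r \<noteq> Full} \<le> card {0<..<h}" by (rule card_mono) auto
  then show ?thesis using S(2) card_S height_pos by simp
qed

lemma (in graded_poset) alpha_of_two:
  assumes "card P = 2"
  shows "alpha_G P = 0"
proof -
  obtain S where S: "G_independent P S" "card S = alpha_G P" using ex_maximum_independent by blast
  interpret independent_triples P S by unfold_locales (rule S(1))
  have "3 \<le> card v" if v: "v \<in> S" for v
  proof -
    obtain r where "lies_at r v" using ex_lies_at[OF v] by blast
    then have r: "card (v \<inter> level P r) + card (v \<inter> level P (Suc r)) = 3"
      by (auto simp: lies_at_def V_at_def Lambda_at_def)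
    have "finite v" by (rule finite_subset[OF G_verts_sub[OF S_verts[OF v]] fin])
    moreover have "(v \<inter> level P r) \<inter> (v \<inter> level P (Suc r)) = {}" using level_unique[of _ r "Suc r"] by auto
    ultimately have "card ((v \<inter> level P r) \<union> (v \<inter> level P (Suc r))) = 3"
      using r by (subst card_Un_disjoint) auto
    then show ?thesis using card_mono[OF \<open>finite v\<close>, of "(v \<inter> level P r) \<union> (v \<inter> level P (Suc r))"] by auto
  qed
  moreover have "card v \<le> 2" if "v \<in> S" for v
    using card_mono[OF fin G_verts_sub[OF S_verts[OF that]]] assms by simp
  ultimately have "S = {}" by fastforce
  then show ?thesis using S(2) by simp
qed

lemma (in graded_poset) height_ge_2:
  assumes "connected_poset P" "2 \<le> card P"
  shows "2 \<le> h"
proof -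
  obtain x y where xy: "x \<in> P" "y \<in> P" "x \<noteq> y"
    using assms(2) card_le_Suc0_iff_eq[OF fin] by fastforce
  then have "(\<lambda>u v. covers P u v \<or> covers P v u)\<^sup>*\<^sup>* x y" using assms(1) by (simp add: connected_poset_def)
  then obtain z where "covers P x z \<or> covers P z x" using xy(3) by (cases rule: converse_rtranclpE) auto
  then have "pred_on.chain P (<) {x, z}" "x \<noteq> z" by (auto simp: covers_def pred_on.chain_def)
  then show ?thesis using card_chain[of "{x, z}"] by simp
qed

lemma La_attained:
  assumes "P \<noteq> {}"
  obtains F :: "nat set set" where "F \<subseteq> Pow {1..n}" "\<not> contains_poset F P" "card F = La n P"
proof -
  let ?A = "{card F | F :: nat set set. F \<subseteq> Pow {1..n} \<and> \<not> contains_poset F P}"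
  have "?A \<subseteq> card ` Pow (Pow {1..n})" by blast
  then have "finite ?A" by (rule finite_subset) simp
  moreover have "{} \<subseteq> Pow {1..n} \<and> \<not> contains_poset {} P" using assms by (auto simp: contains_poset_def)
  then have "?A \<noteq> {}" by blast
  ultimately have "Max ?A \<in> ?A" by (rule Max_in)
  then show thesis using that unfolding La_def by auto
qed

lemma contains_singleton: "G \<in> F \<Longrightarrow> contains_poset F {x}"
  unfolding contains_poset_def by (intro exI[of _ "\<lambda>_. G"]) (auto simp: mono_on_def)

theorem corollary1p5:
  fixes P :: "'a::order set" and n :: nat
  assumes "finite P"
    and "connected_poset P"
    and "graded P"
    and "n \<noteq> 1"
  shows "real (La n P) \<le>
    (real (card P) + real (height P) - real (alpha_G P) - 2) / 2 * real (n choose (n div 2))"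
proof -
  have ne: "P \<noteq> {}" using assms(2) by (simp add: connected_poset_def)
  interpret graded_poset P by unfold_locales (use assms ne in auto)
  obtain F :: "nat set set" where F: "F \<subseteq> Pow {1..n}" "\<not> contains_poset F P" "card F = La n P"
    using La_attained[OF ne] by metis
  let ?m = "int (card P) + int h - int (alpha_G P) - 2" and ?C = "int (n choose (n div 2))"
  have "2 * int (card F) \<le> ?m * ?C"
  proof (cases "n = 0")
    case False
    then show ?thesis using bound_of_family[of n F] F assms(4) by simp
  next
    case True
    \<comment> \<open>Over the empty ground set a family has at most one member, and none if \<open>P\<close> is a single point. Otherwise the
      factor in the bound is at least 2.\<close>
    then have FP: "F \<subseteq> {{}}" using F(1) by simp
    then have cF: "card F \<le> 1" using card_mono[OF _ FP] by simp
    have "card P \<noteq> 0" using ne fin by simp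
    then consider (one) "card P = 1" | (two) "card P = 2" | (more) "3 \<le> card P" by linarith
    then show ?thesis
    proof cases
      case one
      then obtain x where "P = {x}" by (auto simp: card_1_singleton_iff)
      then have "F = {}" using contains_singleton F(2) by blast
      then show ?thesis using True one alpha_le by simp
    next
      case two
      then have "2 \<le> ?m" using alpha_of_two[OF two] height_ge_2[OF assms(2)] by simp
      then show ?thesis using True cF by simp
    next
      case more
      then have "3 - 1 \<le> ?m" using alpha_le by linarith
      then show ?thesis using True cF by simp
    qed
  qed
  then have "2 * real (La n P) \<le> (real (card P) + real (height P) - real (alpha_G P) - 2) * real (n choose (n div 2))"
    unfolding F(3)[symmetric] by (simp flip: of_int_le_iff[where ?'a = real])
  then show ?thesis by simp
qed

end
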